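(* Let $p\in\{1,2,\dots,\infty\}$ and $d\ge1$. For instances whose points lie in $\mathbb{R}^d$ with the distance given by the $L_p$-metric, there exists a polynomial-time $O(d^{2+1/p})$-approximation algorithm for the connected $k$-center problem with disjoint clusters and for the connected $k$-diameter problem with disjoint clusters.
   Context: An instance consists of a finite point set $V$, a metric on $V$, an integer $k\ge1$, and an unweighted undirected connectivity graph $G=(V,E)$. A feasible solution (disjoint clusters) is a partition of $V$ into $k$ clusters $C_1,\dots,C_k$, each inducing a connected subgraph of $G$. For connected $k$-center, centers $c_i\in C_i$ are also chosen and the cost is the maximum distance of a point to the center of its cluster; for connected $k$-diameter the cost is the maximum distance between two points in the same cluster. The cost is to be minimized; an $\alpha$-approximation algorithm returns a feasible solution of cost at most $\alpha$ times optimal. *)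

theory Defs
  imports Complex_Main
    "HOL-Library.Extended_Nat"
    "HOL-Library.Disjoint_Sets"
    "HOL-Library.Log_Nat"
    "HOL-Computational_Algebra.Polynomial"
begin

section \<open>Connected clustering with disjoint clusters\<close>

text \<open>An undirected graph on \<open>V\<close> is given by its set of edges, each a two-element subset of \<open>V\<close>.\<close>

definition graph_on :: "'a set \<Rightarrow> 'a set set \<Rightarrow> bool" where
  "graph_on V E \<longleftrightarrow> (\<forall>e\<in>E. \<exists>u\<in>V. \<exists>v\<in>V. u \<noteq> v \<and> e = {u, v})"

definition induces_connected :: "'a set set \<Rightarrow> 'a set \<Rightarrow> bool" where
  "induces_connected E C \<longleftrightarrow>
     C \<noteq> {} \<and> (\<forall>u\<in>C. \<forall>v\<in>C. (u, v) \<in> {(x, y). x \<in> C \<and> y \<in> C \<and> {x, y} \<in> E}\<^sup>*)"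

text \<open>The clusters are \<open>C 0, \<dots>, C (k - 1)\<close>; values of \<open>C\<close> and of the centers \<open>z\<close> at
  other indices are irrelevant. Clusters are nonempty, so there are exactly \<open>k\<close> of them.\<close>

definition feasible_clustering ::
  "'a set \<Rightarrow> 'a set set \<Rightarrow> nat \<Rightarrow> (nat \<Rightarrow> 'a set) \<Rightarrow> bool" where
  "feasible_clustering V E k C \<longleftrightarrow>
     (\<Union>j<k. C j) = V \<and> disjoint_family_on C {..<k} \<and> (\<forall>j<k. induces_connected E (C j))"

definition feasible_centers ::
  "'a set \<Rightarrow> 'a set set \<Rightarrow> nat \<Rightarrow> (nat \<Rightarrow> 'a set) \<Rightarrow> (nat \<Rightarrow> 'a) \<Rightarrow> bool" where
  "feasible_centers V E k C z \<longleftrightarrow> feasible_clustering V E k C \<and> (\<forall>j<k. z j \<in> C j)"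

definition center_cost ::
  "('a \<Rightarrow> 'a \<Rightarrow> real) \<Rightarrow> nat \<Rightarrow> (nat \<Rightarrow> 'a set) \<Rightarrow> (nat \<Rightarrow> 'a) \<Rightarrow> real" where
  "center_cost \<delta> k C z = Max {\<delta> x (z j) | x j. j < k \<and> x \<in> C j}"

definition diameter_cost ::
  "('a \<Rightarrow> 'a \<Rightarrow> real) \<Rightarrow> nat \<Rightarrow> (nat \<Rightarrow> 'a set) \<Rightarrow> real" where
  "diameter_cost \<delta> k C = Max {\<delta> x y | x y j. j < k \<and> x \<in> C j \<and> y \<in> C j}"

text \<open>For finite \<open>V\<close> only finitely many costs occur, so on feasible inputs the infima below
  are minima.\<close>

definition center_opt ::
  "('a \<Rightarrow> 'a \<Rightarrow> real) \<Rightarrow> 'a set \<Rightarrow> 'a set set \<Rightarrow> nat \<Rightarrow> real" where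
  "center_opt \<delta> V E k = Inf {center_cost \<delta> k C z | C z. feasible_centers V E k C z}"

definition diameter_opt ::
  "('a \<Rightarrow> 'a \<Rightarrow> real) \<Rightarrow> 'a set \<Rightarrow> 'a set set \<Rightarrow> nat \<Rightarrow> real" where
  "diameter_opt \<delta> V E k = Inf {diameter_cost \<delta> k C | C. feasible_clustering V E k C}"


section \<open>Instances in \<open>d\<close>-dimensional space with an \<open>L\<^sub>p\<close>-metric\<close>

text \<open>A point of \<open>d\<close>-dimensional real space is a list of \<open>d\<close> reals.\<close>

definition Lp_dist :: "nat \<Rightarrow> enat \<Rightarrow> real list \<Rightarrow> real list \<Rightarrow> real" where
  "Lp_dist d p x y =
     (case p of
        enat q \<Rightarrow> root q (\<Sum>i<d. \<bar>x ! i - y ! i\<bar> ^ q)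
      | \<infinity> \<Rightarrow> Max ((\<lambda>i. \<bar>x ! i - y ! i\<bar>) ` {..<d}))"

definition inverse_exponent :: "enat \<Rightarrow> real" where
  "inverse_exponent p = (case p of enat q \<Rightarrow> 1 / real q | \<infinity> \<Rightarrow> 0)"

text \<open>The list of points fixes the order in which the point set is presented to an algorithm.\<close>

record clustering_input =
  points :: "real list list"
  edges :: "real list set set"
  num_clusters :: nat

definition valid_input :: "nat \<Rightarrow> clustering_input \<Rightarrow> bool" where
  "valid_input d I \<longleftrightarrow>
     distinct (points I) \<and> (\<forall>x\<in>set (points I). length x = d) \<and>
     graph_on (set (points I)) (edges I) \<and> num_clusters I \<ge> 1"


section \<open>Real random access machines\<close>

text \<open>Programs work on integer arrays and on real arrays of any dimension; scalars are arrays
  indexed by the empty list. Real values admit exact field operations and comparisons (with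
  \<open>x / 0 = 0\<close>), but there is neither rounding nor any other way to turn a real value into an
  integer other than by comparing, and only integer constants are available. Integers, which also
  serve as array indices, can only be added, subtracted and compared, so that charging one unit of
  time for each operation on them is polynomially equivalent to charging for their bits.\<close>

datatype iexp =
    IConst int
  | IRead string "iexp list"
  | IAdd iexp iexp
  | ISub iexp iexp

datatype rexp =
    RConst int
  | RRead string "iexp list"
  | RAdd rexp rexp
  | RSub rexp rexp
  | RMul rexp rexp
  | RDiv rexp rexp

datatype bexp =
    ILess iexp iexp
  | RLess rexp rexp
  | BNot bexp
  | BAnd bexp bexp

datatype com =
    Skip
  | IAssign string "iexp list" iexp
  | RAssign string "iexp list" rexp
  | Seq com com
  | Cond bexp com com
  | While bexp com

record state =
  ints :: "string \<Rightarrow> int list \<Rightarrow> int"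
  reals :: "string \<Rightarrow> int list \<Rightarrow> real"

primrec ival :: "iexp \<Rightarrow> state \<Rightarrow> int" where
  "ival (IConst c) s = c"
| "ival (IRead a es) s = ints s a (map (\<lambda>e. ival e s) es)"
| "ival (IAdd e f) s = ival e s + ival f s"
| "ival (ISub e f) s = ival e s - ival f s"

primrec rval :: "rexp \<Rightarrow> state \<Rightarrow> real" where
  "rval (RConst c) s = of_int c"
| "rval (RRead a es) s = reals s a (map (\<lambda>e. ival e s) es)"
| "rval (RAdd e f) s = rval e s + rval f s"
| "rval (RSub e f) s = rval e s - rval f s"
| "rval (RMul e f) s = rval e s * rval f s"
| "rval (RDiv e f) s = rval e s / rval f s"

primrec bval :: "bexp \<Rightarrow> state \<Rightarrow> bool" where
  "bval (ILess e f) s \<longleftrightarrow> ival e s < ival f s"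
| "bval (RLess e f) s \<longleftrightarrow> rval e s < rval f s"
| "bval (BNot b) s \<longleftrightarrow> \<not> bval b s"
| "bval (BAnd b c) s \<longleftrightarrow> bval b s \<and> bval c s"

definition write_int :: "string \<Rightarrow> int list \<Rightarrow> int \<Rightarrow> state \<Rightarrow> state" where
  "write_int a is v s = s\<lparr>ints := (ints s)(a := (ints s a)(is := v))\<rparr>"

definition write_real :: "string \<Rightarrow> int list \<Rightarrow> real \<Rightarrow> state \<Rightarrow> state" where
  "write_real a is v s = s\<lparr>reals := (reals s)(a := (reals s a)(is := v))\<rparr>"

text \<open>The bit length of a rational number, as the length of its shortest representation as a
  fraction. It is used for rational numbers only; the value for an irrational argument is
  unspecified.\<close>

definition rat_bits :: "real \<Rightarrow> nat" where
  "rat_bits x = (LEAST m. \<exists>a b :: int. b > 0 \<and> x = of_int a / of_int b \<and>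
     m = nat (bitlen \<bar>a\<bar>) + nat (bitlen b))"

text \<open>\<open>exec c s t m s'\<close>: started in \<open>s\<close>, the program \<open>c\<close> halts in \<open>s'\<close> after \<open>t\<close> steps, and \<open>m\<close>
  is the maximum of \<open>rat_bits\<close> over the values written to real arrays during the run. Expressions
  have constant size in a fixed program, hence one step per assignment or test, and hence no
  account of the intermediate values of an expression.\<close>

inductive exec :: "com \<Rightarrow> state \<Rightarrow> nat \<Rightarrow> nat \<Rightarrow> state \<Rightarrow> bool" where
  Skip: "exec Skip s 1 0 s"
| IAssign: "exec (IAssign a es e) s 1 0 (write_int a (map (\<lambda>f. ival f s) es) (ival e s) s)"
| RAssign: "exec (RAssign a es e) s 1 (rat_bits (rval e s))
     (write_real a (map (\<lambda>f. ival f s) es) (rval e s) s)"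
| Seq: "exec c s t m s' \<Longrightarrow> exec c' s' t' m' s'' \<Longrightarrow> exec (Seq c c') s (t + t') (max m m') s''"
| CondTrue: "bval b s \<Longrightarrow> exec c s t m s' \<Longrightarrow> exec (Cond b c c') s (Suc t) m s'"
| CondFalse: "\<not> bval b s \<Longrightarrow> exec c' s t m s' \<Longrightarrow> exec (Cond b c c') s (Suc t) m s'"
| WhileFalse: "\<not> bval b s \<Longrightarrow> exec (While b c) s 1 0 s"
| WhileTrue: "bval b s \<Longrightarrow> exec c s t m s' \<Longrightarrow> exec (While b c) s' t' m' s'' \<Longrightarrow>
     exec (While b c) s (Suc (t + t')) (max m m') s''"

inductive_cases SkipE: "exec Skip s t m s'"
inductive_cases IAssignE: "exec (IAssign a es e) s t m s'"
inductive_cases RAssignE: "exec (RAssign a es e) s t m s'"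
inductive_cases SeqE: "exec (Seq c c') s t m s'"
inductive_cases CondE: "exec (Cond b c c') s t m s'"
inductive_cases WhileE: "exec (While b c) s t m s'"

lemma exec_deterministic:
  "exec c s t m s' \<Longrightarrow> exec c s u n s'' \<Longrightarrow> u = t \<and> n = m \<and> s'' = s'"
proof (induction arbitrary: u n s'' rule: exec.induct)
  case (Skip s)
  then show ?case by (auto elim: SkipE)
next
  case (IAssign a es e s)
  then show ?case by (auto elim: IAssignE)
next
  case (RAssign a es e s)
  then show ?case by (auto elim: RAssignE)
next
  case (Seq c s t m s1 c' t' m' s2)
  from Seq.prems show ?case by (rule SeqE) (use Seq.IH in blast)
next
  case (CondTrue b s c t m s' c')
  from CondTrue.prems show ?case by (rule CondE) (use CondTrue in blast)+
next
  case (CondFalse b s c' t m s' c)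
  from CondFalse.prems show ?case by (rule CondE) (use CondFalse in blast)+
next
  case (WhileFalse b s c)
  from WhileFalse.prems show ?case by (rule WhileE) (use WhileFalse in auto)
next
  case (WhileTrue b s c t m s1 t' m' s2)
  from WhileTrue.prems show ?case by (rule WhileE) (use WhileTrue in blast)+
qed


section \<open>Polynomial-time approximation algorithms\<close>

definition initial_state :: "clustering_input \<Rightarrow> state" where
  "initial_state I = (let n = length (points I) in
     \<lparr>ints = (\<lambda>a is.
        if a = ''n'' \<and> is = [] then int n
        else if a = ''k'' \<and> is = [] then int (num_clusters I)
        else if a = ''adj'' \<and>
          (\<exists>i<n. \<exists>j<n. is = [int i, int j] \<and> {points I ! i, points I ! j} \<in> edges I) then 1
        else 0),
      reals = (\<lambda>a is.
        if a = ''x'' \<and> (\<exists>i<n. \<exists>j<length (points I ! i). is = [int i, int j])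
        then points I ! nat (is ! 0) ! nat (is ! 1)
        else 0)\<rparr>)"

text \<open>On halting, \<open>cluster[i]\<close> holds the index of the cluster of the \<open>i\<close>-th point and, for
  \<open>k\<close>-center, \<open>center[j]\<close> the position in the list of points of the \<open>j\<close>-th center.\<close>

definition output_clusters :: "clustering_input \<Rightarrow> state \<Rightarrow> nat \<Rightarrow> real list set" where
  "output_clusters I s j =
     {points I ! i | i. i < length (points I) \<and> ints s ''cluster'' [int i] = int j}"

definition output_centers :: "clustering_input \<Rightarrow> state \<Rightarrow> nat \<Rightarrow> real list" where
  "output_centers I s j = points I ! nat (ints s ''center'' [int j])"

text \<open>The number of values that make up the input, and the number of bits of a rational input.\<close>

definition input_count :: "nat \<Rightarrow> clustering_input \<Rightarrow> nat" where
  "input_count d I = 2 + length (points I) ^ 2 + length (points I) * d"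

definition input_bits :: "clustering_input \<Rightarrow> nat" where
  "input_bits I =
     nat (bitlen (int (length (points I)))) + nat (bitlen (int (num_clusters I))) +
     length (points I) ^ 2 + (\<Sum>x\<leftarrow>points I. \<Sum>r\<leftarrow>x. rat_bits r)"

text \<open>As usual for algorithms on real data, the number of arithmetic operations is polynomial in
  the number of input values, and on rational inputs moreover the numbers computed have bit length
  polynomial in that of the input. So the program runs in polynomial time on a real random access
  machine for arbitrary inputs, and on a Turing machine for rational ones.\<close>

definition polynomial_time :: "nat \<Rightarrow> com \<Rightarrow> bool" where
  "polynomial_time d A \<longleftrightarrow>
     (\<exists>q :: nat poly. \<forall>I. valid_input d I \<longrightarrow>
        (\<exists>t m s. exec A (initial_state I) t m s \<and>
           t \<le> poly q (input_count d I) \<and>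
           ((\<forall>x\<in>set (points I). set x \<subseteq> \<rat>) \<longrightarrow> m \<le> poly q (input_bits I))))"

definition approximates_k_center :: "nat \<Rightarrow> enat \<Rightarrow> real \<Rightarrow> com \<Rightarrow> bool" where
  "approximates_k_center d p \<alpha> A \<longleftrightarrow>
     (\<forall>I t m s. let V = set (points I); E = edges I; k = num_clusters I; \<delta> = Lp_dist d p in
        valid_input d I \<and> (\<exists>C z. feasible_centers V E k C z) \<and>
        exec A (initial_state I) t m s \<longrightarrow>
          feasible_centers V E k (output_clusters I s) (output_centers I s) \<and>
          center_cost \<delta> k (output_clusters I s) (output_centers I s) \<le> \<alpha> * center_opt \<delta> V E k)"

definition approximates_k_diameter :: "nat \<Rightarrow> enat \<Rightarrow> real \<Rightarrow> com \<Rightarrow> bool" where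
  "approximates_k_diameter d p \<alpha> A \<longleftrightarrow>
     (\<forall>I t m s. let V = set (points I); E = edges I; k = num_clusters I; \<delta> = Lp_dist d p in
        valid_input d I \<and> (\<exists>C. feasible_clustering V E k C) \<and>
        exec A (initial_state I) t m s \<longrightarrow>
          feasible_clustering V E k (output_clusters I s) \<and>
          diameter_cost \<delta> k (output_clusters I s) \<le> \<alpha> * diameter_opt \<delta> V E k)"

end

theory Submission imports Defs begin

text \<open>
  Since \<open>L\<^sub>\<infinity> \<le> L\<^sub>p \<le> d\<^bsup>1/p\<^esup> L\<^sub>\<infinity>\<close> and the two objectives differ by a factor of at most 2, one
  algorithm that loses a factor \<open>O(d\<^sup>2)\<close> for the \<open>L\<^sub>\<infinity>\<close>-diameter serves all cases. For every candidate
  radius \<open>r\<close> (a coordinate difference of two input points) it picks centers greedily: an uncovered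
  point becomes a center and covers all points reachable from it inside its \<open>r\<close>-ball. If the
  clusters of some solution have diameter at most \<open>r\<close>, then no cluster contains two centers, so
  there are at most \<open>k\<close> of them.

  To make the clusters disjoint, quantize each coordinate into levels such that points at distance
  at most \<open>2r\<close> have levels that differ by at most 1, and call a center active in layer
  \<open>t \<in> {0..d}\<close> if none of its \<open>d\<close> levels is congruent to \<open>t\<close> modulo \<open>d + 1\<close>; by counting, every
  center is active in some layer. The levels congruent to \<open>t\<close> cut space into cells of width
  \<open>O(d r)\<close>, and the regions covered by active centers in different cells are disjoint. The layers are
  processed one after the other: existing clusters are extended along edges inside the regions of
  active centers, and an active center that stays unlabelled founds a new cluster. Every layer adds
  \<open>O(d r)\<close> to the distance of a point to the root of its cluster, hence \<open>O(d\<^sup>2 r)\<close> in total. Finally,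
  the points attached last are leaves and can be split off as singletons until there are exactly
  \<open>k\<close> clusters.
\<close>

section \<open>Programs with bounded loops\<close>

text \<open>An old cluster may take over the region of another center, and such takeovers could
  chain without bound. Layers stop this: active centers whose regions share a point are at distance
  at most \<open>2r\<close>, hence in one cell, so the takeovers of one layer stay inside a cell.
  This is why levels are quantized at width \<open>2r\<close>. A cell comprises \<open>d+1\<close>
  levels and has width at most \<open>(d+1) 2r\<close>; a layer adds this width and another
  \<open>2r\<close> for the way between regions and their centers. With \<open>d+1\<close> layers,
  and a factor 2 for connecting two points through a root, the diameter is at most
  \<open>4(d+1)(d+2)r\<close>. The levels need a construction of their own because the machine
  cannot round to a grid: greedy jumps between input points are counted instead, which takes
  comparisons only. Every root is a center, so clusters never outnumber centers. A radius with more
  than \<open>k\<close> centers is refuted; a radius with at most \<open>k\<close> centers is usable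
  even if no solution has that diameter. Hence the smallest usable radius is at most the
  \<open>L_\<infinity>\<close>-diameter of any solution.\<close>

text \<open>Loops only count from \<open>0\<close> to \<open>n - 1\<close>, where \<open>n\<close> is the number of input points, and only integers
  are written. Termination, polynomial running time and bit length zero are thus syntactic.\<close>

datatype prg =
    Nop
  | Set string "iexp list" iexp
  | Then prg prg (infixr ";;" 60)
  | When bexp prg
  | Loop string prg

primrec compile :: "prg \<Rightarrow> com" where
  "compile Nop = Skip"
| "compile (Set a es e) = IAssign a es e"
| "compile (p ;; q) = Seq (compile p) (compile q)"
| "compile (When b p) = Cond b (compile p) Skip"
| "compile (Loop i p) = Seq (IAssign i [] (IConst 0))
     (While (ILess (IRead i []) (IRead ''n'' []))
       (Seq (compile p) (IAssign i [] (IAdd (IRead i []) (IConst 1)))))"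

primrec run :: "prg \<Rightarrow> state \<Rightarrow> state" where
  "run Nop s = s"
| "run (Set a es e) s = write_int a (map (\<lambda>f. ival f s) es) (ival e s) s"
| "run (p ;; q) s = run q (run p s)"
| "run (When b p) s = (if bval b s then run p s else s)"
| "run (Loop i p) s =
     ((\<lambda>s. write_int i [] (ints (run p s) i [] + 1) (run p s)) ^^ nat (ints s ''n'' []))
       (write_int i [] 0 s)"

primrec writes :: "prg \<Rightarrow> string set" where
  "writes Nop = {}"
| "writes (Set a es e) = {a}"
| "writes (p ;; q) = writes p \<union> writes q"
| "writes (When b p) = writes p"
| "writes (Loop i p) = insert i (writes p)"

text \<open>Since a body changes neither its counter nor \<open>n\<close>, the number of iterations
  is known on entry, and \<open>run\<close> can iterate exactly \<open>n\<close> times. Preserving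
  \<open>n\<close> in the first part of a sequence lets one bound in \<open>n\<close> apply to both
  parts.\<close>

primrec well_formed :: "prg \<Rightarrow> bool" where
  "well_formed Nop \<longleftrightarrow> True"
| "well_formed (Set a es e) \<longleftrightarrow> True"
| "well_formed (p ;; q) \<longleftrightarrow> well_formed p \<and> well_formed q \<and> ''n'' \<notin> writes p"
| "well_formed (When b p) \<longleftrightarrow> well_formed p"
| "well_formed (Loop i p) \<longleftrightarrow>
     i \<noteq> ''n'' \<and> i \<notin> writes p \<and> ''n'' \<notin> writes p \<and> well_formed p"

text \<open>The argument stands for \<open>n\<close>. An iteration costs its body, one test and one
  increment; initialization and the last, failing test give the final 2. A skipped
  \<open>When\<close> costs its test and the step of \<open>Skip\<close>.\<close>

primrec time_poly :: "prg \<Rightarrow> nat poly" where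
  "time_poly Nop = 1"
| "time_poly (Set a es e) = 1"
| "time_poly (p ;; q) = time_poly p + time_poly q"
| "time_poly (When b p) = time_poly p + 2"
| "time_poly (Loop i p) = [:0, 1:] * (time_poly p + 2) + 2"

lemma ints_write_int [simp]:
  "ints (write_int a is v s) b = (if b = a then (ints s a)(is := v) else ints s b)"
  by (simp add: write_int_def)

lemma reals_write_int [simp]: "reals (write_int a is v s) = reals s"
  by (simp add: write_int_def)

lemma funpow_invariant:
  assumes "P s" and "\<And>s. P s \<Longrightarrow> P (f s)"
  shows "P ((f ^^ m) s)"
  by (induction m) (auto simp: assms)

lemma ints_run: "a \<notin> writes p \<Longrightarrow> ints (run p s) a = ints s a"
proof (induction p arbitrary: s)
  case (Loop i p)
  let ?f = "\<lambda>s. write_int i [] (ints (run p s) i [] + 1) (run p s)"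
  have "ints ((?f ^^ m) (write_int i [] 0 s)) a = ints s a" for m
    by (rule funpow_invariant[where P = "\<lambda>s'. ints s' a = ints s a"]) (use Loop in auto)
  then show ?case by simp
qed auto

lemma reals_run [simp]: "reals (run p s) = reals s"
proof (induction p arbitrary: s)
  case (Loop i p)
  let ?f = "\<lambda>s. write_int i [] (ints (run p s) i [] + 1) (run p s)"
  have "reals ((?f ^^ m) (write_int i [] 0 s)) = reals s" for m
    by (rule funpow_invariant[where P = "\<lambda>s'. reals s' = reals s"]) (use Loop in auto)
  then show ?case by simp
qed auto

text \<open>Induction on the number \<open>m\<close> of remaining rounds, the distance from the
  counter to \<open>n\<close>, which drops by exactly one per round.\<close>

lemma exec_while:
  fixes i :: string and p :: prg
  defines "f \<equiv> (\<lambda>s. write_int i [] (ints (run p s) i [] + 1) (run p s))"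
  defines "w \<equiv> While (ILess (IRead i []) (IRead ''n'' []))
       (Seq (compile p) (IAssign i [] (IAdd (IRead i []) (IConst 1))))"
  assumes body: "\<And>s. ints s ''n'' [] = N \<Longrightarrow> \<exists>t\<le>T. exec (compile p) s t 0 (run p s)"
  assumes i: "i \<noteq> ''n''" "i \<notin> writes p" "''n'' \<notin> writes p"
  shows "ints s ''n'' [] = N \<Longrightarrow> m = nat (N - ints s i []) \<Longrightarrow>
    \<exists>t\<le>m * (T + 2) + 1. exec w s t 0 ((f ^^ m) s)"
proof (induction m arbitrary: s)
  case 0
  then have "\<not> bval (ILess (IRead i []) (IRead ''n'' [])) s" by simp
  then have "exec w s 1 0 s" unfolding w_def by (rule WhileFalse)
  then show ?case by auto
next
  case (Suc m)
  obtain t where t: "t \<le> T" "exec (compile p) s t 0 (run p s)"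
    using body Suc.prems by blast
  have f: "exec (IAssign i [] (IAdd (IRead i []) (IConst 1))) (run p s) 1 0 (f s)"
    using IAssign[of i "[]" "IAdd (IRead i []) (IConst 1)" "run p s"] by (simp add: f_def)
  have b: "exec (Seq (compile p) (IAssign i [] (IAdd (IRead i []) (IConst 1)))) s (t + 1) 0 (f s)"
    using Seq[OF t(2) f] by simp
  have "ints (f s) ''n'' [] = N" "ints (f s) i [] = ints s i [] + 1"
    using Suc.prems i by (auto simp: f_def ints_run)
  then obtain t' where t': "t' \<le> m * (T + 2) + 1" "exec w (f s) t' 0 ((f ^^ m) (f s))"
    using Suc.IH[of "f s"] Suc.prems by fastforce
  have g: "bval (ILess (IRead i []) (IRead ''n'' [])) s" using Suc.prems by simp
  have "exec w s (Suc (t + 1 + t')) 0 ((f ^^ m) (f s))"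
    using WhileTrue[OF g b t'(2)[unfolded w_def]] unfolding w_def by simp
  moreover have "(f ^^ m) (f s) = (f ^^ Suc m) s" by (simp add: funpow_swap1)
  moreover have "Suc (t + 1 + t') \<le> Suc m * (T + 2) + 1" using t t' by simp
  ultimately show ?case by metis
qed

text \<open>The bit length is 0 because compiled programs contain no \<open>RAssign\<close>, so the
  requirement on rational inputs needs no further argument.\<close>

lemma exec_compile:
  "well_formed p \<Longrightarrow>
     \<exists>t\<le>poly (time_poly p) (nat (ints s ''n'' [])). exec (compile p) s t 0 (run p s)"
proof (induction p arbitrary: s)
  case Nop
  then show ?case using exec.Skip[of s] by auto
next
  case (Set a es e)
  then show ?case using exec.IAssign[of a es e s] by auto
next
  case (Then p q)
  obtain t where t: "t \<le> poly (time_poly p) (nat (ints s ''n'' []))"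
    "exec (compile p) s t 0 (run p s)" using Then by auto
  have "ints (run p s) ''n'' [] = ints s ''n'' []" using Then.prems by (simp add: ints_run)
  then obtain t' where t': "t' \<le> poly (time_poly q) (nat (ints s ''n'' []))"
    "exec (compile q) (run p s) t' 0 (run q (run p s))"
    using Then.IH(2)[of "run p s"] Then.prems by auto
  have "exec (compile (p ;; q)) s (t + t') 0 (run (p ;; q) s)"
    using Seq[OF t(2) t'(2)] by simp
  then show ?case using t t' by (intro exI[of _ "t + t'"]) auto
next
  case (When b p)
  then obtain t where t: "t \<le> poly (time_poly p) (nat (ints s ''n'' []))"
    "exec (compile p) s t 0 (run p s)" by auto
  show ?case
  proof (cases "bval b s")
    case True
    have "exec (compile (When b p)) s (Suc t) 0 (run (When b p) s)"
      using CondTrue[OF True t(2)] True by simp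
    then show ?thesis using t by (metis time_poly.simps(4) poly_add add_2_eq_Suc' le_SucI Suc_le_mono poly_numeral)
  next
    case False
    have "exec (compile (When b p)) s (Suc 1) 0 (run (When b p) s)"
      using CondFalse[OF False exec.Skip] False by simp
    then show ?thesis using t by (intro exI[of _ "Suc 1"]) auto
  qed
next
  case (Loop i p)
  let ?N = "ints s ''n'' []"
  have "\<exists>t\<le>poly (time_poly p) (nat ?N). exec (compile p) s' t 0 (run p s')"
    if "ints s' ''n'' [] = ?N" for s' using Loop.IH[of s'] Loop.prems that by simp
  from exec_while[OF this, where i = i and s = "write_int i [] 0 s" and m = "nat ?N"] Loop.prems
  obtain t where t: "t \<le> nat ?N * (poly (time_poly p) (nat ?N) + 2) + 1"
    "exec (While (ILess (IRead i []) (IRead ''n'' []))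
       (Seq (compile p) (IAssign i [] (IAdd (IRead i []) (IConst 1)))))
       (write_int i [] 0 s) t 0 (run (Loop i p) s)" by auto
  have "exec (compile (Loop i p)) s (1 + t) 0 (run (Loop i p) s)"
    using Seq[OF IAssign[of i "[]" "IConst 0" s], of _ t 0] t(2) by simp
  then show ?case using t(1) by (intro exI[of _ "1 + t"]) auto
qed

text \<open>The invariant is given before the counter is reset and is also wanted after each
  increment, hence \<open>index\<close>. The step may rely on every array outside the write set
  still having its contents from before the loop.\<close>

lemma run_Loop:
  assumes "i \<notin> writes p" and "''n'' \<notin> writes p" and "i \<noteq> ''n''"
    and n: "ints s0 ''n'' [] = int N" and init: "I 0 s0"
    and index: "\<And>j s v. I j s \<Longrightarrow> I j (write_int i [] v s)"
    and step: "\<And>j s. \<lbrakk>j < N; I j s; ints s i [] = int j; reals s = reals s0;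
      \<And>a. a \<notin> insert i (writes p) \<Longrightarrow> ints s a = ints s0 a\<rbrakk> \<Longrightarrow> I (Suc j) (run p s)"
  shows "I N (run (Loop i p) s0)"
proof -
  define f where "f = (\<lambda>s. write_int i [] (ints (run p s) i [] + 1) (run p s))"
  have "m \<le> N \<Longrightarrow> (let s = (f ^^ m) (write_int i [] 0 s0) in I m s \<and> ints s i [] = int m \<and>
     reals s = reals s0 \<and> (\<forall>a. a \<notin> insert i (writes p) \<longrightarrow> ints s a = ints s0 a))" for m
  proof (induction m)
    case 0
    then show ?case using index[OF init] by (simp add: Let_def)
  next
    case (Suc m)
    define s where "s = (f ^^ m) (write_int i [] 0 s0)"
    have s: "I m s" "ints s i [] = int m" "reals s = reals s0"
      "\<And>a. a \<notin> insert i (writes p) \<Longrightarrow> ints s a = ints s0 a"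
      using Suc by (auto simp: s_def Let_def)
    have "I (Suc m) (run p s)" using step[of m s] s Suc.prems by auto
    moreover have "(f ^^ Suc m) (write_int i [] 0 s0) =
        write_int i [] (ints (run p s) i [] + 1) (run p s)"
      by (simp add: s_def f_def)
    ultimately show ?case using assms(1) s index by (auto simp: ints_run)
  qed
  from this[of N] show ?thesis using n by (simp add: Let_def f_def)
qed

section \<open>Coordinate levels and cells\<close>

text \<open>\<open>P v\<close> is a leftmost input point among those at most \<open>w\<close> to the
  left of \<open>v\<close>. With equal coordinates the choice is ambiguous, and only
  \<open>Y (P v)\<close> is determined.\<close>

definition left_ends :: "nat \<Rightarrow> real \<Rightarrow> (nat \<Rightarrow> real) \<Rightarrow> (nat \<Rightarrow> nat) \<Rightarrow> bool" where
  "left_ends n w Y P \<longleftrightarrow> (\<forall>v<n. P v < n \<and> Y (P v) \<le> Y v \<and> Y v \<le> Y (P v) + w \<and>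
     (\<forall>u<n. Y v \<le> Y u + w \<longrightarrow> Y (P v) \<le> Y u))"

text \<open>The number of points strictly to the left serves as termination measure for the jumps
  and as induction measure for the facts about levels.\<close>

lemma card_below_less:
  fixes n :: nat and Y :: "nat \<Rightarrow> real"
  assumes "p < n" and "Y p < Y v"
  shows "card {u. u < n \<and> Y u < Y p} < card {u. u < n \<and> Y u < Y v}"
  using assms
  by (intro psubset_card_mono finite_subset[of "{u. u < n \<and> Y u < Y v}" "{..<n}"])
    (auto intro: order_less_trans)

text \<open>Following \<open>P\<close> from a point means jumping greedily to the left by at most \<open>w\<close>. The level counts the
  jumps, and the base is where they end; two points connected by steps of length at most \<open>w\<close> have
  the same base.\<close>

function lev :: "nat \<Rightarrow> (nat \<Rightarrow> real) \<Rightarrow> (nat \<Rightarrow> nat) \<Rightarrow> nat \<Rightarrow> nat" where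
  "lev n Y P v = (if P v < n \<and> Y (P v) < Y v then Suc (lev n Y P (P v)) else 0)"
  by auto
termination
  by (relation "measure (\<lambda>(n, Y, P, v). card {u. u < n \<and> Y u < Y v})") (auto simp: card_below_less)

function base :: "nat \<Rightarrow> (nat \<Rightarrow> real) \<Rightarrow> (nat \<Rightarrow> nat) \<Rightarrow> nat \<Rightarrow> real" where
  "base n Y P v = (if P v < n \<and> Y (P v) < Y v then base n Y P (P v) else Y v)"
  by auto
termination
  by (relation "measure (\<lambda>(n, Y, P, v). card {u. u < n \<and> Y u < Y v})") (auto simp: card_below_less)

declare lev.simps [simp del] base.simps [simp del]

lemma lev_le_card_below: "lev n Y P v \<le> card {u. u < n \<and> Y u < Y v}"
proof (induction n Y P v rule: lev.induct)
  case (1 n Y P v)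
  show ?case
  proof (cases "P v < n \<and> Y (P v) < Y v")
    case True
    then have "lev n Y P v = Suc (lev n Y P (P v))" by (simp add: lev.simps[of n Y P v])
    with True 1 card_below_less[of "P v" n Y v] show ?thesis by simp
  qed (auto simp: lev.simps[of n Y P v])
qed

text \<open>Bounds the number of passes over the points after which all levels have been
  computed.\<close>

lemma lev_less:
  assumes "v < n" shows "lev n Y P v < n"
proof -
  have "card {u. u < n \<and> Y u < Y v} < card {..<n}"
    using assms by (intro psubset_card_mono) auto
  then show ?thesis using lev_le_card_below[of n Y P v] by simp
qed

text \<open>If \<open>u\<close> is strictly left of \<open>v\<close> but within \<open>w\<close>,
  then \<open>P v\<close> is not right of \<open>u\<close>, and \<open>u\<close> is within
  \<open>w\<close> of \<open>P v\<close>. So the induction hypothesis applies to the pair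
  \<open>P v\<close>, \<open>u\<close> with the roles interchanged, and one jump from
  \<open>v\<close> turns its inequalities into the claim. If \<open>u\<close> and \<open>v\<close>
  have equal coordinates, so do \<open>P u\<close> and \<open>P v\<close>, and both jump.\<close>

lemma lev_step:
  assumes P: "left_ends n w Y P"
  shows "\<lbrakk>u < n; v < n; Y u \<le> Y v; Y v \<le> Y u + w\<rbrakk> \<Longrightarrow>
    lev n Y P u \<le> lev n Y P v \<and> lev n Y P v \<le> Suc (lev n Y P u) \<and> base n Y P u = base n Y P v"
proof (induction "card {x. x < n \<and> Y x < Y v}" arbitrary: u v rule: less_induct)
  case less
  have Pu: "P u < n" "Y (P u) \<le> Y u" "Y u \<le> Y (P u) + w"
    and Pv: "P v < n" "Y (P v) \<le> Y v" "Y v \<le> Y (P v) + w"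
    and Puv: "Y (P v) \<le> Y u"
    using P less.prems unfolding left_ends_def by blast+
  show ?case
  proof (cases "Y u = Y v")
    case True
    then have "Y (P v) = Y (P u)"
      using P less.prems Pu Pv unfolding left_ends_def by (metis order_antisym)
    show ?thesis
    proof (cases "Y (P v) < Y v")
      case s: True
      have "w \<ge> 0" using s Pv by simp
      then have "lev n Y P (P u) \<le> lev n Y P (P v) \<and> base n Y P (P u) = base n Y P (P v)"
        "lev n Y P (P v) \<le> lev n Y P (P u)"
        using less.hyps[of "P v" "P u"] less.hyps[of "P u" "P v"] \<open>Y (P v) = Y (P u)\<close> s Pu Pv True
          card_below_less[of "P v" n Y v] by auto
      then show ?thesis using s True \<open>Y (P v) = Y (P u)\<close> Pu Pv
        by (simp add: lev.simps[of n Y P u] lev.simps[of n Y P v]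
            base.simps[of n Y P u] base.simps[of n Y P v])
    next
      case False
      then show ?thesis using True \<open>Y (P v) = Y (P u)\<close> Pu Pv
        by (simp add: lev.simps[of n Y P u] lev.simps[of n Y P v]
            base.simps[of n Y P u] base.simps[of n Y P v])
    qed
  next
    case False
    then have uv: "Y u < Y v" using less.prems by simp
    have "lev n Y P (P v) \<le> lev n Y P u \<and> lev n Y P u \<le> Suc (lev n Y P (P v)) \<and>
        base n Y P (P v) = base n Y P u"
      using less.prems Pv Puv uv card_below_less[of u n Y v]
      by (intro less.hyps[of u "P v"]) auto
    then show ?thesis using uv Pv Puv
      by (simp add: lev.simps[of n Y P v] base.simps[of n Y P v])
  qed
qed

lemma base_le: "base n Y P v \<le> Y v"
proof (induction n Y P v rule: base.induct)
  case (1 n Y P v)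
  then show ?case by (auto simp: base.simps[of n Y P v])
qed

text \<open>Each jump from \<open>v\<close> towards \<open>u\<close> covers at most \<open>w\<close>
  and lowers the level by one; the last stretch, once \<open>u\<close> is within \<open>w\<close>,
  accounts for the \<open>+ 1\<close>.\<close>

lemma lev_expansion:
  assumes P: "left_ends n w Y P" and "w \<ge> 0" and "u < n"
  shows "\<lbrakk>v < n; Y u \<le> Y v; base n Y P u = base n Y P v\<rbrakk> \<Longrightarrow>
    lev n Y P u \<le> lev n Y P v \<and>
    Y v - Y u \<le> (real (lev n Y P v) - real (lev n Y P u) + 1) * w"
proof (induction "card {x. x < n \<and> Y x < Y v}" arbitrary: v rule: less_induct)
  case less
  have Pv: "P v < n" "Y (P v) \<le> Y v" "Y v \<le> Y (P v) + w"
    using P less.prems unfolding left_ends_def by blast+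
  show ?case
  proof (cases "Y v \<le> Y u + w")
    case True
    then have l: "lev n Y P u \<le> lev n Y P v" using lev_step[OF P] less.prems \<open>u < n\<close> by blast
    then have "1 * w \<le> (real (lev n Y P v) - real (lev n Y P u) + 1) * w"
      using \<open>w \<ge> 0\<close> by (intro mult_right_mono) auto
    with l True show ?thesis by simp
  next
    case False
    \<comment> \<open>The jumps cannot get stuck before coming close to \<open>u\<close>: otherwise
      the base of \<open>v\<close> would be \<open>Y v\<close>, which exceeds \<open>Y u\<close> and
      hence the base of \<open>u\<close>.\<close>
    have s: "Y (P v) < Y v"
    proof (rule ccontr)
      assume "\<not> Y (P v) < Y v"
      then have "base n Y P v = Y v" by (simp add: base.simps[of n Y P v])
      then show False using base_le[of n Y P u] less.prems False \<open>w \<ge> 0\<close> by simp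
    qed
    have "lev n Y P u \<le> lev n Y P (P v) \<and>
      Y (P v) - Y u \<le> (real (lev n Y P (P v)) - real (lev n Y P u) + 1) * w"
      using less.prems Pv s False card_below_less[of "P v" n Y v]
      by (intro less.hyps) (auto simp: base.simps[of n Y P v])
    then show ?thesis using s Pv by (simp add: lev.simps[of n Y P v] algebra_simps)
  qed
qed

text \<open>The cells of layer \<open>t\<close> are separated by the points whose level is \<open>t\<close> modulo \<open>d + 1\<close>.\<close>

definition cell :: "nat \<Rightarrow> nat \<Rightarrow> (nat \<Rightarrow> real) \<Rightarrow> (nat \<Rightarrow> nat) \<Rightarrow> nat \<Rightarrow> nat \<Rightarrow> real \<times> nat" where
  "cell n d Y P t v = (base n Y P v, (lev n Y P v + d - t) div Suc d)"

text \<open>The offset \<open>d - t\<close> makes each level congruent to \<open>t\<close> the last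
  one of its block of \<open>d + 1\<close> levels, so the quotient grows only on leaving such a
  level. As \<open>t \<le> d\<close>, the subtraction is never truncated.\<close>

lemma div_Suc_eq:
  fixes d t l :: nat
  assumes "t \<le> d" and "l mod Suc d \<noteq> t"
  shows "(Suc l + d - t) div Suc d = (l + d - t) div Suc d"
proof -
  have "Suc (l + d - t) mod Suc d \<noteq> 0"
  proof
    assume "Suc (l + d - t) mod Suc d = 0"
    then obtain q where "Suc (l + d - t) = Suc d * q" by (auto simp: mod_eq_0_iff_dvd)
    then have q: "l + Suc d = Suc d * q + t" using assms(1) by simp
    then have "l mod Suc d = (Suc d * q + t) mod Suc d" by (metis mod_add_self2)
    then show False using assms 
      by (simp only: mod_mult_self4) (simp add: less_Suc_eq_le)
  qed
  moreover have "Suc l + d - t = Suc (l + d - t)" using assms by simp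
  ultimately show ?thesis by (simp add: div_Suc)
qed

text \<open>The levels differ by at most 1, and the lower one is not the last of its block, so no
  boundary lies between them.\<close>

lemma cell_near:
  assumes P: "left_ends n w Y P" and t: "t \<le> d"
    and "u < n" "v < n" "lev n Y P u mod Suc d \<noteq> t" "lev n Y P v mod Suc d \<noteq> t"
    and "\<bar>Y u - Y v\<bar> \<le> w"
  shows "cell n d Y P t u = cell n d Y P t v"
proof -
  have *: "cell n d Y P t u = cell n d Y P t v"
    if "u < n" "v < n" "lev n Y P u mod Suc d \<noteq> t" "Y u \<le> Y v" "Y v \<le> Y u + w" for u v
  proof -
    have "lev n Y P v = lev n Y P u \<or> lev n Y P v = Suc (lev n Y P u)"
      "base n Y P u = base n Y P v"
      using lev_step[OF P, of u v] that by auto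
    then show ?thesis using div_Suc_eq[OF t that(3)] by (auto simp: cell_def)
  qed
  show ?thesis using *[of u v] *[of v u] assms by (cases "Y u \<le> Y v") auto
qed

lemma le_of_div_eq:
  fixes a b m :: nat
  assumes "a div Suc m = b div Suc m"
  shows "a \<le> b + m"
proof -
  have "b div Suc m * Suc m + a mod Suc m = a" "b div Suc m * Suc m + b mod Suc m = b"
    using div_mult_mod_eq[of a "Suc m"] div_mult_mod_eq[of b "Suc m"] assms by simp_all
  moreover have "a mod Suc m \<le> m" by (simp add: less_Suc_eq_le[symmetric])
  ultimately show ?thesis by linarith
qed

text \<open>Levels in one block differ by at most \<open>d\<close>, and \<open>lev_expansion\<close>
  adds 1.\<close>

lemma cell_width:
  assumes P: "left_ends n w Y P" and w: "w \<ge> 0" and t: "t \<le> d" and "u < n" "v < n"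
    and "cell n d Y P t u = cell n d Y P t v"
  shows "\<bar>Y u - Y v\<bar> \<le> real (d + 1) * w"
proof -
  have *: "\<bar>Y u - Y v\<bar> \<le> real (d + 1) * w"
    if "u < n" "v < n" "cell n d Y P t u = cell n d Y P t v" "Y u \<le> Y v" for u v
  proof -
    have l: "Y v - Y u \<le> (real (lev n Y P v) - real (lev n Y P u) + 1) * w"
      using lev_expansion[OF P w, of u v] that by (auto simp: cell_def)
    have "lev n Y P v + d - t \<le> lev n Y P u + d - t + d"
      using that by (intro le_of_div_eq) (simp add: cell_def)
    then have "lev n Y P v \<le> lev n Y P u + d" using t by simp
    then have "(real (lev n Y P v) - real (lev n Y P u) + 1) * w \<le> real (d + 1) * w"
      using w by (intro mult_right_mono) auto
    with l that show ?thesis by simp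
  qed
  show ?thesis using *[of u v] *[of v u] assms by (cases "Y u \<le> Y v") auto
qed

section \<open>Growing clusters in layers\<close>

text \<open>Labels of the clusters are positive, and \<open>0\<close> marks points outside all clusters. The list holds the
  attached points with the latest first, so its head is a leaf.\<close>

inductive grown :: "nat \<Rightarrow> (nat \<Rightarrow> nat \<Rightarrow> bool) \<Rightarrow> (nat \<Rightarrow> int) \<Rightarrow> int \<Rightarrow> nat list \<Rightarrow> bool"
  for n adj where
  empty: "grown n adj (\<lambda>_. 0) 0 []"
| root: "grown n adj l m vs \<Longrightarrow> v < n \<Longrightarrow> l v = 0 \<Longrightarrow> grown n adj (l(v := m + 1)) (m + 1) vs"
| attach: "grown n adj l m vs \<Longrightarrow> v < n \<Longrightarrow> l v = 0 \<Longrightarrow> l u > 0 \<Longrightarrow> adj u v \<Longrightarrow>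
     grown n adj (l(v := l u)) m (v # vs)"

lemma grown_labels: "grown n adj l m vs \<Longrightarrow> 0 \<le> m \<and> (\<forall>v. 0 \<le> l v \<and> l v \<le> m \<and> (l v > 0 \<longrightarrow> v < n))"
proof (induction rule: grown.induct)
  case empty then show ?case by simp
next
  case (root l m vs v) then show ?case by (auto intro: order_trans)
next
  case (attach l m vs v u) then show ?case by auto
qed

lemma grown_surj: "grown n adj l m vs \<Longrightarrow> 0 < j \<Longrightarrow> j \<le> m \<Longrightarrow> \<exists>v<n. l v = j"
proof (induction rule: grown.induct)
  case (root l m vs v)
  show ?case
  proof (cases "j = m + 1")
    case False
    then obtain w where "w < n" "l w = j" using root by force
    with root.hyps root.prems show ?thesis by (intro exI[of _ w]) auto
  qed (use root in auto)
next
  case (attach l m vs v u)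
  then obtain w where "w < n" "l w = j" by force
  with attach.hyps attach.prems show ?case by (intro exI[of _ w]) auto
qed auto

text \<open>Each labelled point is either one of the \<open>m\<close> roots or on the list. Once all
  \<open>n\<close> points are labelled, an empty list therefore forces \<open>m = n\<close>, so
  splitting cannot run out of leaves before reaching \<open>k \<le> n\<close> clusters.\<close>

lemma grown_card: "grown n adj l m vs \<Longrightarrow> m + int (length vs) = int (card {v. v < n \<and> l v > 0})"
proof (induction rule: grown.induct)
  case empty then show ?case by simp
next
  case (root l m vs v)
  have "{w. w < n \<and> (l(v := m + 1)) w > 0} = insert v {w. w < n \<and> l w > 0}"
    using root.hyps grown_labels[OF root.hyps(1)] by auto
  then show ?case using root by simp
next
  case (attach l m vs v u)
  have "{w. w < n \<and> (l(v := l u)) w > 0} = insert v {w. w < n \<and> l w > 0}"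
    using attach.hyps by auto
  then show ?case using attach by simp
qed

lemma grown_connected:
  assumes sym: "\<And>u v. adj u v \<Longrightarrow> adj v u"
  shows "grown n adj l m vs \<Longrightarrow> l u = j \<Longrightarrow> l v = j \<Longrightarrow> 0 < j \<Longrightarrow>
    (u, v) \<in> {(x, y). l x = j \<and> l y = j \<and> adj x y}\<^sup>*"
proof (induction arbitrary: j u v rule: grown.induct)
  case (root l m vs w)
  show ?case
  proof (cases "j = m + 1")
    case True
    moreover have "l x \<noteq> m + 1" for x
      using grown_labels[OF root.hyps(1)] by (metis zle_add1_eq_le less_irrefl)
    ultimately have "u = w" "v = w" using root.prems by (auto split: if_splits)
    then show ?thesis by simp
  next
    case False
    then have "(u, v) \<in> {(x, y). l x = j \<and> l y = j \<and> adj x y}\<^sup>*"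
      using root by (auto split: if_splits)
    moreover have "{(x, y). l x = j \<and> l y = j \<and> adj x y} \<subseteq>
        {(x, y). (l(w := m + 1)) x = j \<and> (l(w := m + 1)) y = j \<and> adj x y}"
      using root by auto
    ultimately show ?thesis using rtrancl_mono by blast
  qed
next
  case (attach l m vs w p)
  let ?l = "l(w := l p)"
  let ?R = "{(x, y). ?l x = j \<and> ?l y = j \<and> adj x y}"
  have mono: "{(x, y). l x = j \<and> l y = j \<and> adj x y}\<^sup>* \<subseteq> ?R\<^sup>*"
    using attach by (intro rtrancl_mono) auto
  have old: "(x, y) \<in> ?R\<^sup>*" if "l x = j" "l y = j" for x y
    using attach.IH[OF that attach.prems(3)] mono by blast
  have pw: "p \<noteq> w" using attach by auto
  have a: "\<exists>y. l y = j \<and> (x, y) \<in> ?R\<^sup>* \<and> (y, x) \<in> ?R\<^sup>*" if "?l x = j" for x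
  proof (cases "x = w")
    case True
    then have "l p = j" using that by simp
    then have "(p, w) \<in> ?R" "(w, p) \<in> ?R" using attach.hyps sym pw by auto
    then show ?thesis using True \<open>l p = j\<close> by blast
  next
    case False
    then show ?thesis using that by auto
  qed
  obtain x where x: "l x = j" "(u, x) \<in> ?R\<^sup>*" using a[OF attach.prems(1)] by blast
  obtain y where y: "l y = j" "(y, v) \<in> ?R\<^sup>*" using a[OF attach.prems(2)] by blast
  have "(x, v) \<in> ?R\<^sup>*" by (rule rtrancl_trans[OF old[OF x(1) y(1)] y(2)])
  with x(2) show ?case by (rule rtrancl_trans)
qed auto

text \<open>Nothing was attached after \<open>v\<close>, so \<open>v\<close> supports no other
  point. Roots may have been founded later, but such steps do not depend on \<open>v\<close> and
  commute with its removal.\<close>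

lemma grown_pop:
  "grown n adj l m ws \<Longrightarrow> ws = v # vs \<Longrightarrow> v < n \<and> l v > 0 \<and> grown n adj (l(v := 0)) m vs"
proof (induction arbitrary: vs rule: grown.induct)
  case (root l m ws w)
  have IH: "v < n" "l v > 0" "grown n adj (l(v := 0)) m vs" using root.IH[OF root.prems] by blast+
  then have "v \<noteq> w" using root.hyps by auto
  then have "(l(w := m + 1))(v := 0) = (l(v := 0))(w := m + 1)" by (simp add: fun_upd_twist)
  moreover have "grown n adj ((l(v := 0))(w := m + 1)) (m + 1) vs"
    by (rule grown.root[OF IH(3)]) (use root.hyps \<open>v \<noteq> w\<close> in auto)
  ultimately have "grown n adj ((l(w := m + 1))(v := 0)) (m + 1) vs" by (simp only:)
  moreover have "(l(w := m + 1)) v = l v" using \<open>v \<noteq> w\<close> by simp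
  ultimately show ?case using IH by metis
next
  case (attach l m ws w u)
  then have eq: "v = w" "vs = ws" "(l(w := l u))(w := 0) = l" by auto
  have "(l(w := l u)) w > 0" using attach.hyps by simp
  with attach.hyps(1,2) show ?case unfolding eq(1,2) eq(3) by blast
qed auto

lemma grown_split:
  assumes "grown n adj l m (v # vs)"
  shows "grown n adj (l(v := m + 1)) (m + 1) vs"
  using grown.root[of n adj "l(v := 0)" m vs v] grown_pop[OF assms refl] by simp

section \<open>Regions of centers and nets\<close>

locale points_graph =
  fixes n d :: nat and adj :: "nat \<Rightarrow> nat \<Rightarrow> bool" and X :: "nat \<Rightarrow> nat \<Rightarrow> real"
  assumes adj_sym: "adj u v \<Longrightarrow> adj v u" and adj_less: "adj u v \<Longrightarrow> u < n \<and> v < n"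
begin

definition near :: "real \<Rightarrow> nat \<Rightarrow> nat \<Rightarrow> bool" where
  "near r u v \<longleftrightarrow> (\<forall>i<d. \<bar>X u i - X v i\<bar> \<le> r)"

text \<open>The region of \<open>c\<close>: the component of \<open>c\<close> in the graph induced
  by its \<open>r\<close>-ball (for \<open>r \<ge> 0\<close>). All points of a path are compared
  with \<open>c\<close>, so the relation is not symmetric in general.\<close>

inductive reach :: "real \<Rightarrow> nat \<Rightarrow> nat \<Rightarrow> bool" for r c where
  refl: "c < n \<Longrightarrow> reach r c c"
| step: "reach r c u \<Longrightarrow> adj u v \<Longrightarrow> near r c v \<Longrightarrow> reach r c v"

lemma near_refl: "r \<ge> 0 \<Longrightarrow> near r v v"
  by (simp add: near_def)

lemma near_sym: "near r u v \<Longrightarrow> near r v u"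
  by (simp add: near_def abs_minus_commute)

lemma near_trans: "near a u v \<Longrightarrow> near b v w \<Longrightarrow> near (a + b) u w"
  unfolding near_def by fastforce

lemma reach_near: "reach r c v \<Longrightarrow> r \<ge> 0 \<Longrightarrow> near r c v"
  by (induction rule: reach.induct) (auto simp: near_refl)

lemma reach_less: "reach r c v \<Longrightarrow> c < n \<and> v < n"
  by (induction rule: reach.induct) (auto dest: adj_less)

text \<open>True if the clusters of some feasible solution all have \<open>L\<^sub>\<infinity>\<close>-diameter at most \<open>r\<close>.\<close>

definition coverable :: "nat \<Rightarrow> real \<Rightarrow> bool" where
  "coverable k r \<longleftrightarrow> (\<exists>f. (\<forall>v<n. f v < k) \<and> (\<forall>u<n. \<forall>v<n. f u = f v \<longrightarrow> reach r u v))"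

text \<open>Greedy selection in index order separates centers in one direction only. That suffices
  for \<open>card_net\<close>, since two centers with the same index under a cover would reach each
  other in both directions.\<close>

definition net :: "real \<Rightarrow> nat set \<Rightarrow> bool" where
  "net r Z \<longleftrightarrow> Z \<subseteq> {..<n} \<and> (\<forall>v<n. \<exists>c\<in>Z. reach r c v) \<and>
     (\<forall>c\<in>Z. \<forall>c'\<in>Z. c < c' \<longrightarrow> \<not> reach r c c')"

lemma card_net:
  assumes "net r Z" and "coverable k r"
  shows "card Z \<le> k"
proof -
  obtain f where f: "\<forall>v<n. f v < k" "\<forall>u<n. \<forall>v<n. f u = f v \<longrightarrow> reach r u v"
    using assms unfolding coverable_def by blast
  have "inj_on f Z"
    using assms(1) f(2) unfolding net_def inj_on_def
    by (metis lessThan_iff linorder_neqE_nat subsetD)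
  moreover have "f ` Z \<subseteq> {..<k}" using f(1) assms(1) unfolding net_def by auto
  ultimately show ?thesis using card_inj_on_le[of f Z "{..<k}"] by simp
qed

text \<open>The anchor is attached to the label, so it stays fixed while the cluster grows over
  several layers and only \<open>B\<close> has to be updated.\<close>

definition rooted :: "real \<Rightarrow> (nat \<Rightarrow> int) \<Rightarrow> bool" where
  "rooted B l \<longleftrightarrow> (\<exists>rt. \<forall>v. l v > 0 \<longrightarrow> near B v (rt (l v)))"

text \<open>Invariant of one layer: \<open>A\<close> are its centers, \<open>C\<close> their cells, \<open>L\<close> the labels at its
  start. A newly labelled point shares its cell with a point of the same cluster that is within
  the old distance bound \<open>B\<close> of the root.\<close>

definition layer :: "nat set \<Rightarrow> (nat \<Rightarrow> 'c) \<Rightarrow> real \<Rightarrow> real \<Rightarrow> (nat \<Rightarrow> int) \<Rightarrow> (nat \<Rightarrow> int) \<Rightarrow> bool"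
  where
  "layer A C r B L l \<longleftrightarrow> (\<forall>v. L v > 0 \<longrightarrow> l v = L v) \<and>
     (\<exists>rt. \<forall>v. l v > 0 \<longrightarrow>
        (if L v > 0 then near B v (rt (l v))
         else \<exists>c\<in>A. \<exists>c'\<in>A. \<exists>y. C c = C c' \<and> reach r c v \<and> reach r c' y \<and> l y = l v \<and>
            near B y (rt (l v))))"

lemma layer_start: "rooted B l \<Longrightarrow> layer A C r B l l"
  by (simp add: layer_def rooted_def)

text \<open>The new root is its own witness: it reaches itself and has distance 0 to its anchor. The
  label \<open>m + 1\<close> is fresh, so no other anchor changes.\<close>

lemma layer_root:
  assumes l: "layer A C r B L l" and g: "grown n adj l m vs"
    and c: "c \<in> A" "c < n" "l c = 0" and B: "B \<ge> 0"
  shows "layer A C r B L (l(c := m + 1))"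
proof -
  obtain rt where L: "\<And>v. L v > 0 \<Longrightarrow> l v = L v" and rt: "\<And>v. l v > 0 \<Longrightarrow>
        (if L v > 0 then near B v (rt (l v))
         else \<exists>c\<in>A. \<exists>c'\<in>A. \<exists>y. C c = C c' \<and> reach r c v \<and> reach r c' y \<and> l y = l v \<and>
            near B y (rt (l v)))" using l unfolding layer_def by blast
  let ?l = "l(c := m + 1)" and ?rt = "rt(m + 1 := c)"
  have m: "l v \<noteq> m + 1" for v using grown_labels[OF g] by (metis zle_add1_eq_le less_irrefl)
  have "L c \<le> 0" using L[of c] c by force
  have "if L v > 0 then near B v (?rt (?l v))
         else \<exists>c\<in>A. \<exists>c'\<in>A. \<exists>y. C c = C c' \<and> reach r c v \<and> reach r c' y \<and> ?l y = ?l v \<and>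
            near B y (?rt (?l v))" if v: "?l v > 0" for v
  proof (cases "v = c")
    case True
    then show ?thesis using \<open>L c \<le> 0\<close> c near_refl[OF B] reach.refl[of c r]
      by (auto intro!: bexI[of _ c] exI[of _ c])
  next
    case False
    then have "l v > 0" using v by simp
    show ?thesis
    proof (cases "L v > 0")
      case True
      then show ?thesis using rt[OF \<open>l v > 0\<close>] False m by simp
    next
      case nL: False
      then obtain a a' y where y: "a \<in> A" "a' \<in> A" "C a = C a'" "reach r a v" "reach r a' y"
        "l y = l v" "near B y (rt (l v))" using rt[OF \<open>l v > 0\<close>] by auto
      then have "y \<noteq> c" using \<open>l v > 0\<close> c by auto
      then show ?thesis using y False nL m by auto
    qed
  qed
  moreover have "\<forall>v. L v > 0 \<longrightarrow> ?l v = L v" using L \<open>L c \<le> 0\<close> by auto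
  ultimately show ?thesis unfolding layer_def by blast
qed

text \<open>The new point takes over the witness \<open>y\<close> of its neighbour instead of using
  the neighbour itself, so distances do not add up along a path of attachments.\<close>

lemma layer_attach:
  assumes l: "layer A C r B L l"
    and A: "\<And>c c' v. c \<in> A \<Longrightarrow> c' \<in> A \<Longrightarrow> reach r c v \<Longrightarrow> reach r c' v \<Longrightarrow> C c = C c'"
    and c: "c \<in> A" "reach r c u" "reach r c v" and uv: "l u > 0" "l v = 0"
  shows "layer A C r B L (l(v := l u))"
proof -
  obtain rt where L: "\<And>v. L v > 0 \<Longrightarrow> l v = L v" and rt: "\<And>v. l v > 0 \<Longrightarrow>
        (if L v > 0 then near B v (rt (l v))
         else \<exists>c\<in>A. \<exists>c'\<in>A. \<exists>y. C c = C c' \<and> reach r c v \<and> reach r c' y \<and> l y = l v \<and>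
            near B y (rt (l v)))" using l unfolding layer_def by blast
  let ?l = "l(v := l u)"
  have Lv: "L v \<le> 0" using L[of v] uv by force
  have "if L w > 0 then near B w (rt (?l w))
         else \<exists>c\<in>A. \<exists>c'\<in>A. \<exists>y. C c = C c' \<and> reach r c w \<and> reach r c' y \<and> ?l y = ?l w \<and>
            near B y (rt (?l w))" if w: "?l w > 0" for w
  proof (cases "w = v")
    case True
    have "\<exists>c'\<in>A. \<exists>y. C c = C c' \<and> reach r c' y \<and> l y = l u \<and> near B y (rt (l u))"
    proof (cases "L u > 0")
      case True
      then show ?thesis using rt[OF uv(1)] c by auto
    next
      case False
      then obtain a a' y where "a \<in> A" "a' \<in> A" "C a = C a'" "reach r a u" "reach r a' y"
        "l y = l u" "near B y (rt (l u))" using rt[OF uv(1)] by auto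
      \<comment> \<open>Both regions contain \<open>u\<close>, so their centers lie in one cell.
        This is where separation of the cells enters.\<close>
      moreover have "C c = C a" using A c calculation by blast
      ultimately show ?thesis by auto
    qed
    then obtain c' y where "c' \<in> A" "C c = C c'" "reach r c' y" "l y = l u" "near B y (rt (l u))"
      by blast
    moreover have "y \<noteq> v" using calculation uv by auto
    ultimately show ?thesis using c True Lv by auto
  next
    case False
    then have "l w > 0" using w by simp
    show ?thesis
    proof (cases "L w > 0")
      case True
      then show ?thesis using rt[OF \<open>l w > 0\<close>] False by simp
    next
      case nL: False
      then obtain a a' y where y: "a \<in> A" "a' \<in> A" "C a = C a'" "reach r a w" "reach r a' y"
        "l y = l w" "near B y (rt (l w))" using rt[OF \<open>l w > 0\<close>] by auto
      then have "y \<noteq> v" using \<open>l w > 0\<close> uv by auto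
      then show ?thesis using y False nL by auto
    qed
  qed
  moreover have "\<forall>v. L v > 0 \<longrightarrow> ?l v = L v" using L Lv by auto
  ultimately show ?thesis unfolding layer_def by blast
qed

text \<open>The way from a new point to its anchor goes to its center (\<open>r\<close>), to a
  center in the same cell (\<open>D\<close>), to the witness (\<open>r\<close>) and on to the anchor
  (\<open>B\<close>).\<close>

lemma layer_end:
  assumes l: "layer A C r B L l" and "r \<ge> 0" "D \<ge> 0"
    and A: "\<And>c c'. c \<in> A \<Longrightarrow> c' \<in> A \<Longrightarrow> C c = C c' \<Longrightarrow> near D c c'"
  shows "rooted (B + (D + 2 * r)) l"
proof -
  obtain rt where rt: "\<And>v. l v > 0 \<Longrightarrow>
        (if L v > 0 then near B v (rt (l v))
         else \<exists>c\<in>A. \<exists>c'\<in>A. \<exists>y. C c = C c' \<and> reach r c v \<and> reach r c' y \<and> l y = l v \<and>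
            near B y (rt (l v)))" using l unfolding layer_def by blast
  have "near (B + (D + 2 * r)) v (rt (l v))" if v: "l v > 0" for v
  proof (cases "L v > 0")
    case True
    then have "near B v (rt (l v))" using rt[OF v] by simp
    then show ?thesis using assms(2,3) unfolding near_def by force
  next
    case False
    then obtain a a' y where y: "a \<in> A" "a' \<in> A" "C a = C a'" "reach r a v" "reach r a' y"
        "near B y (rt (l v))" using rt[OF v] by (auto split: if_splits)
    have "near (r + D) v a'"
      using near_trans near_sym reach_near y A assms(2) by blast
    then have "near (r + D + r) v y" using near_trans reach_near y assms(2) by blast
    then have "near (r + D + r + B) v (rt (l v))" using near_trans y by blast
    then show ?thesis by (simp add: algebra_simps)
  qed
  then show ?thesis unfolding rooted_def by blast
qed

lemma exists_good_layer: "\<exists>t\<le>d. \<forall>i<d. f i \<noteq> (t::nat)"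
proof (rule ccontr)
  assume "\<not> ?thesis"
  then have "{..d} \<subseteq> f ` {..<d}" by force
  then have "card {..d} \<le> card (f ` {..<d})" by (intro card_mono) auto
  also have "\<dots> \<le> d" using card_image_le[of "{..<d}" f] by simp
  finally show False by simp
qed

text \<open>The program only computes the residues \<open>\<tau>\<close>. Bases and cells exist for
  the analysis alone, so they appear as an existentially quantified \<open>C\<close>, which assigns
  to each point its cell in every coordinate.\<close>

definition colored :: "real \<Rightarrow> (nat \<Rightarrow> nat \<Rightarrow> nat) \<Rightarrow> bool" where
  "colored w \<tau> \<longleftrightarrow> (\<forall>t\<le>d. \<exists>C :: nat \<Rightarrow> nat \<Rightarrow> real \<times> nat. \<forall>u<n. \<forall>v<n.
     (\<forall>i<d. \<tau> i u \<noteq> t) \<and> (\<forall>i<d. \<tau> i v \<noteq> t) \<longrightarrow>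
       (near w u v \<longrightarrow> C u = C v) \<and> (C u = C v \<longrightarrow> near (real (d + 1) * w) u v))"

lemma colored_levels:
  assumes w: "w \<ge> 0" and P: "\<And>i. i < d \<Longrightarrow> left_ends n w (\<lambda>v. X v i) (P i)"
    and \<tau>: "\<And>i v. i < d \<Longrightarrow> v < n \<Longrightarrow> \<tau> i v = lev n (\<lambda>v. X v i) (P i) v mod Suc d"
  shows "colored w \<tau>"
  unfolding colored_def
proof (intro allI impI)
  fix t assume t: "t \<le> d"
  \<comment> \<open>The constant value at indices from \<open>d\<close> on makes equality of these
    functions mean equality in the first \<open>d\<close> coordinates.\<close>
  let ?C = "\<lambda>v i. if i < d then cell n d (\<lambda>v. X v i) (P i) t v else (0, 0)"
  show "\<exists>C :: nat \<Rightarrow> nat \<Rightarrow> real \<times> nat. \<forall>u<n. \<forall>v<n.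
     (\<forall>i<d. \<tau> i u \<noteq> t) \<and> (\<forall>i<d. \<tau> i v \<noteq> t) \<longrightarrow>
       (near w u v \<longrightarrow> C u = C v) \<and> (C u = C v \<longrightarrow> near (real (d + 1) * w) u v)"
  proof (intro exI[of _ ?C] allI impI conjI)
    fix u v assume uv: "u < n" "v < n" "(\<forall>i<d. \<tau> i u \<noteq> t) \<and> (\<forall>i<d. \<tau> i v \<noteq> t)" "near w u v"
    show "?C u = ?C v"
    proof
      fix i show "?C u i = ?C v i"
      proof (cases "i < d")
        case True
        then show ?thesis using cell_near[OF P[OF True] t uv(1,2)] uv \<tau>[of i] by (auto simp: near_def)
      qed auto
    qed
  next
    fix u v assume uv: "u < n" "v < n" "(\<forall>i<d. \<tau> i u \<noteq> t) \<and> (\<forall>i<d. \<tau> i v \<noteq> t)" "?C u = ?C v"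
    show "near (real (d + 1) * w) u v" unfolding near_def
    proof (intro allI impI)
      fix i assume i: "i < d"
      have "cell n d (\<lambda>v. X v i) (P i) t u = cell n d (\<lambda>v. X v i) (P i) t v"
        using fun_cong[OF uv(4), of i] i by simp
      then show "\<bar>X u i - X v i\<bar> \<le> real (d + 1) * w"
        using cell_width[OF P[OF i] w t uv(1,2)] by simp
    qed
  qed
qed

end

section \<open>Reachability and greedy centers\<close>

text \<open>For loops that enlarge a set \<open>S\<close> in place: what iteration \<open>a\<close>
  achieves depends monotonically on \<open>S\<close> and so survives the later iterations.\<close>

lemma run_each:
  fixes S :: "state \<Rightarrow> nat set"
  assumes wf: "well_formed (Loop i p)" and n: "ints s0 ''n'' [] = int N" and init: "I s0"
    and index: "\<And>v s. I (write_int i [] v s) = I s" "\<And>v s. S (write_int i [] v s) = S s"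
      "\<And>a v s. Q a (write_int i [] v s) = Q a s"
    and stable: "\<And>a s s'. Q a s \<Longrightarrow> I s \<Longrightarrow> I s' \<Longrightarrow> S s \<subseteq> S s' \<Longrightarrow> Q a s'"
    and step: "\<And>a s. a < N \<Longrightarrow> I s \<Longrightarrow> ints s i [] = int a \<Longrightarrow>
      I (run p s) \<and> S s \<subseteq> S (run p s) \<and> Q a (run p s)"
  shows "I (run (Loop i p) s0) \<and> S s0 \<subseteq> S (run (Loop i p) s0) \<and> (\<forall>a<N. Q a (run (Loop i p) s0))"
proof (rule run_Loop[where I = "\<lambda>j s. I s \<and> S s0 \<subseteq> S s \<and> (\<forall>a<j. Q a s)"])
  fix j s assume *: "j < N" "I s \<and> S s0 \<subseteq> S s \<and> (\<forall>a<j. Q a s)" "ints s i [] = int j"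
  then have st: "I (run p s)" "S s \<subseteq> S (run p s)" "Q j (run p s)" using step by blast+
  then have "\<forall>a<Suc j. Q a (run p s)" using * stable by (metis less_Suc_eq)
  with st * show "I (run p s) \<and> S s0 \<subseteq> S (run p s) \<and> (\<forall>a<Suc j. Q a (run p s))" by blast
qed (use assms in auto)

text \<open>A round that does not stop adds an element to a subset of \<open>{..<N}\<close>. After
  \<open>N\<close> rounds the set is closed or full, and the full set is closed as well; thus a
  counting loop can replace an unbounded fixpoint iteration.\<close>

lemma run_closure:
  fixes S :: "state \<Rightarrow> nat set"
  assumes wf: "well_formed (Loop i p)" and n: "ints s0 ''n'' [] = int N" and init: "I s0"
    and index: "\<And>v s. I (write_int i [] v s) = I s" "\<And>v s. S (write_int i [] v s) = S s"
    and bound: "\<And>s. I s \<Longrightarrow> S s \<subseteq> {..<N}"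
    and closed: "\<And>s. I s \<Longrightarrow> S s = {..<N} \<Longrightarrow> stop (S s)"
    and step: "\<And>s. I s \<Longrightarrow> I (run p s) \<and> S s \<subseteq> S (run p s) \<and>
      (if stop (S s) then S (run p s) = S s else S (run p s) \<noteq> S s)"
  shows "I (run (Loop i p) s0) \<and> S s0 \<subseteq> S (run (Loop i p) s0) \<and> stop (S (run (Loop i p) s0))"
proof -
  have "I (run (Loop i p) s0) \<and> S s0 \<subseteq> S (run (Loop i p) s0) \<and>
      (stop (S (run (Loop i p) s0)) \<or> N \<le> card (S (run (Loop i p) s0)))"
  proof (rule run_Loop[where I = "\<lambda>j s. I s \<and> S s0 \<subseteq> S s \<and> (stop (S s) \<or> j \<le> card (S s))"])
    fix j s assume *: "I s \<and> S s0 \<subseteq> S s \<and> (stop (S s) \<or> j \<le> card (S s))"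
    have "I (run p s)" using step * by blast
    then have fin: "finite (S (run p s))" using finite_subset[OF bound] by blast
    have "Suc j \<le> card (S (run p s))" if "\<not> stop (S s)"
    proof -
      have "S s \<subset> S (run p s)" using step[of s] * that by auto
      from psubset_card_mono[OF fin this] show ?thesis using * that by simp
    qed
    then show "I (run p s) \<and> S s0 \<subseteq> S (run p s) \<and>
        (stop (S (run p s)) \<or> Suc j \<le> card (S (run p s)))"
      using * step[of s] by (auto split: if_splits)
  qed (use assms in auto)
  moreover have "S s = {..<N}" if "I s" "N \<le> card (S s)" for s
    using card_seteq[OF finite_lessThan bound[OF that(1)]] that(2) by simp
  ultimately show ?thesis using closed by blast
qed

declare run.simps(5) [simp del]

abbreviation scalar :: "string \<Rightarrow> iexp" where "scalar a \<equiv> IRead a []"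
abbreviation entry :: "string \<Rightarrow> string \<Rightarrow> iexp" where "entry a i \<equiv> IRead a [scalar i]"
abbreviation entry2 :: "string \<Rightarrow> string \<Rightarrow> string \<Rightarrow> iexp" where
  "entry2 a i j \<equiv> IRead a [scalar i, scalar j]"
abbreviation positive :: "iexp \<Rightarrow> bexp" where "positive e \<equiv> ILess (IConst 0) e"

text \<open>The dimension is a constant of the program, so a conjunction over coordinates is
  expanded into one test. The base case is a test that is always true.\<close>

primrec all_below :: "nat \<Rightarrow> (nat \<Rightarrow> bexp) \<Rightarrow> bexp" where
  "all_below 0 f = BNot (ILess (IConst 0) (IConst 0))"
| "all_below (Suc m) f = BAnd (f m) (all_below m f)"

lemma bval_all_below [simp]: "bval (all_below m f) s \<longleftrightarrow> (\<forall>i<m. bval (f i) s)"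
  by (induction m) (auto simp: less_Suc_eq)

definition coord :: "iexp \<Rightarrow> nat \<Rightarrow> rexp" where
  "coord e i = RRead ''x'' [e, IConst (int i)]"

text \<open>The radius is always a coordinate difference of two input points, so no real number is
  ever stored.\<close>

definition radius :: "nat \<Rightarrow> rexp" where
  "radius i = RSub (coord (scalar ''a'') i) (coord (scalar ''b'') i)"

definition near_test :: "nat \<Rightarrow> nat \<Rightarrow> string \<Rightarrow> string \<Rightarrow> bexp" where
  "near_test d c u v = all_below d (\<lambda>i. BAnd
     (BNot (RLess (radius c) (RSub (coord (scalar u) i) (coord (scalar v) i))))
     (BNot (RLess (radius c) (RSub (coord (scalar v) i) (coord (scalar u) i)))))"

definition reach_round :: "nat \<Rightarrow> nat \<Rightarrow> prg" where
  "reach_round d c = Loop ''u'' (Loop ''v'' (When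
     (BAnd (positive (entry2 ''T'' ''p'' ''u''))
       (BAnd (positive (entry2 ''adj'' ''u'' ''v'')) (near_test d c ''p'' ''v'')))
     (Set ''T'' [scalar ''p'', scalar ''v''] (IConst 1))))"

definition reach_prg :: "nat \<Rightarrow> nat \<Rightarrow> prg" where
  "reach_prg d c = Loop ''p'' (
     Loop ''v'' (Set ''T'' [scalar ''p'', scalar ''v''] (IConst 0)) ;;
     Set ''T'' [scalar ''p'', scalar ''p''] (IConst 1) ;;
     Loop ''j'' (reach_round d c))"

context points_graph
begin

definition input :: "state \<Rightarrow> bool" where
  "input s \<longleftrightarrow> ints s ''n'' [] = int n \<and>
     (\<forall>u<n. \<forall>v<n. ints s ''adj'' [int u, int v] = (if adj u v then 1 else 0)) \<and>
     (\<forall>v<n. \<forall>i<d. reals s ''x'' [int v, int i] = X v i)"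

definition env :: "nat \<Rightarrow> real \<Rightarrow> state \<Rightarrow> bool" where
  "env c r s \<longleftrightarrow> input s \<and> rval (radius c) s = r"

lemma env_cong:
  assumes "ints s' ''n'' = ints s ''n''" "ints s' ''adj'' = ints s ''adj''"
    "ints s' ''a'' = ints s ''a''" "ints s' ''b'' = ints s ''b''" "reals s' = reals s"
  shows "env c r s' = env c r s"
  using assms by (simp add: env_def input_def radius_def coord_def)

lemma env_write [simp]:
  "a \<notin> {''n'', ''adj'', ''a'', ''b''} \<Longrightarrow> env c r (write_int a is v s) = env c r s"
  by (rule env_cong) auto

lemma env_run:
  "writes p \<inter> {''n'', ''adj'', ''a'', ''b''} = {} \<Longrightarrow> env c r (run p s) = env c r s"
  by (rule env_cong) (auto intro: ints_run)

lemma env_n: "env c r s \<Longrightarrow> ints s ''n'' [] = int n"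
  by (simp add: env_def input_def)

lemma env_adj: "env c r s \<Longrightarrow> u < n \<Longrightarrow> v < n \<Longrightarrow> ints s ''adj'' [int u, int v] > 0 \<longleftrightarrow> adj u v"
  by (simp add: env_def input_def)

lemma bval_near_test:
  "\<lbrakk>env c r s; ints s a [] = int u; ints s b [] = int v; u < n; v < n\<rbrakk> \<Longrightarrow>
     bval (near_test d c a b) s \<longleftrightarrow> near r u v"
  by (auto simp: near_test_def near_def env_def input_def coord_def abs_le_iff not_less)

definition reached :: "nat \<Rightarrow> state \<Rightarrow> nat set" where
  "reached q s = {v. v < n \<and> ints s ''T'' [int q, int v] > 0}"

lemma reached_write [simp]: "a \<noteq> ''T'' \<Longrightarrow> reached q (write_int a is y s) = reached q s"
  by (simp add: reached_def)

lemma reached_insert: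
  "v < n \<Longrightarrow> reached q (write_int ''T'' [int q, int v] 1 s) = insert v (reached q s)"
  by (auto simp: reached_def)

text \<open>Soundness of row \<open>q\<close> of \<open>''T''\<close>, with all other rows frozen at
  their contents in \<open>s0\<close>; completeness comes from \<open>run_closure\<close>.\<close>

definition reach_inv :: "nat \<Rightarrow> real \<Rightarrow> nat \<Rightarrow> state \<Rightarrow> state \<Rightarrow> bool" where
  "reach_inv c r q s0 s \<longleftrightarrow> env c r s \<and> ints s ''p'' [] = int q \<and> reached q s \<subseteq> {v. reach r q v} \<and>
     (\<forall>q'. q' \<noteq> q \<longrightarrow> (\<forall>v. ints s ''T'' [int q', int v] = ints s0 ''T'' [int q', int v]))"

definition reach_closed :: "real \<Rightarrow> nat \<Rightarrow> nat set \<Rightarrow> bool" where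
  "reach_closed r q S \<longleftrightarrow> (\<forall>u\<in>S. \<forall>v. adj u v \<and> near r q v \<longrightarrow> v \<in> S)"

lemma run_reach_round:
  assumes "reach_inv c r q s0 s" and q: "q < n"
  shows "reach_inv c r q s0 (run (reach_round d c) s) \<and>
     reached q s \<subseteq> reached q (run (reach_round d c) s) \<and>
     (if reach_closed r q (reached q s) then reached q (run (reach_round d c) s) = reached q s
      else reached q (run (reach_round d c) s) \<noteq> reached q s)"
proof -
  let ?A = "reached q s"
  define I where "I s' \<longleftrightarrow> reach_inv c r q s0 s' \<and> ?A \<subseteq> reached q s' \<and>
     (reach_closed r q ?A \<longrightarrow> reached q s' = ?A)" for s'
  \<comment> \<open>The round updates in place, but only edges leaving the set \<open>?A\<close>
    from its beginning are tracked. They guarantee progress whenever \<open>?A\<close> is not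
    closed.\<close>
  define Q where "Q a b s' \<longleftrightarrow> (a \<in> ?A \<and> adj a b \<and> near r q b \<longrightarrow> b \<in> reached q s')" for a b s'
  have idx: "I (write_int i [] v s) = I s" "Q a b (write_int i [] v s) = Q a b s" 
    if "i = ''u'' \<or> i = ''v''" for i v s a b
    using that by (auto simp: I_def Q_def reach_inv_def)
  let ?g = "BAnd (positive (entry2 ''T'' ''p'' ''u''))
       (BAnd (positive (entry2 ''adj'' ''u'' ''v'')) (near_test d c ''p'' ''v''))"
  let ?body = "When ?g (Set ''T'' [scalar ''p'', scalar ''v''] (IConst 1))"
  have step: "(I (run ?body s') \<and> ints (run ?body s') ''u'' [] = int a) \<and>
      reached q s' \<subseteq> reached q (run ?body s') \<and> Q a b (run ?body s')"
    if ab: "a < n" "b < n" and s': "I s' \<and> ints s' ''u'' [] = int a" "ints s' ''v'' [] = int b"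
    for a b s'
  proof -
    have g: "bval ?g s' \<longleftrightarrow> a \<in> reached q s' \<and> adj a b \<and> near r q b"
      unfolding reached_def using s' ab q bval_near_test[of c r s' "''p''" q "''v''" b] env_adj[of c r s' a b]
      by (simp add: I_def reach_inv_def)
    let ?s = "write_int ''T'' [int q, int b] 1 s'"
    have p: "ints s' ''p'' [] = int q" using s' by (simp add: I_def reach_inv_def)
    have r: "reached q ?s = insert b (reached q s')" using ab by (simp add: reached_insert)
    show ?thesis
    proof (cases "bval ?g s'")
      case True
      then have ab': "a \<in> reached q s'" "adj a b" "near r q b" using g by blast+
      have "reach r q b" using ab' s' by (auto simp: I_def reach_inv_def intro: reach.step)
      then have "reach_inv c r q s0 ?s" using s' unfolding reach_inv_def r I_def by auto
      moreover have "reached q ?s = ?A" if c: "reach_closed r q ?A"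
      proof -
        have "reached q s' = ?A" using s' c by (simp add: I_def)
        moreover have "b \<in> ?A" using c ab' calculation unfolding reach_closed_def by blast
        ultimately show ?thesis unfolding r by auto
      qed
      moreover have "?A \<subseteq> reached q ?s" using s' unfolding r I_def by blast
      moreover have "run ?body s' = ?s" using True p s' by (simp del: bval.simps)
      ultimately show ?thesis using r s' unfolding I_def Q_def by auto
    next
      case False
      then have "run ?body s' = s'" by (simp del: bval.simps)
      moreover have "?A \<subseteq> reached q s'" using s' unfolding I_def by blast
      ultimately show ?thesis using False g s' unfolding Q_def by auto
    qed
  qed
  have inner: "(I (run (Loop ''v'' ?body) s') \<and> ints (run (Loop ''v'' ?body) s') ''u'' [] = int a) \<and>
      reached q s' \<subseteq> reached q (run (Loop ''v'' ?body) s') \<and>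
      (\<forall>b<n. Q a b (run (Loop ''v'' ?body) s'))"
    if a: "a < n" and s': "I s'" "ints s' ''u'' [] = int a" for a s'
  proof (rule run_each[where S = "reached q" and I = "\<lambda>s'. I s' \<and> ints s' ''u'' [] = int a"])
    show "ints s' ''n'' [] = int n" using s' by (auto simp: I_def reach_inv_def dest: env_n)
    show "I s' \<and> ints s' ''u'' [] = int a" using s' by blast
  next
    fix b s1 assume "b < n" "I s1 \<and> ints s1 ''u'' [] = int a" "ints s1 ''v'' [] = int b"
    then show "(I (run ?body s1) \<and> ints (run ?body s1) ''u'' [] = int a) \<and>
      reached q s1 \<subseteq> reached q (run ?body s1) \<and> Q a b (run ?body s1)"
      using step[OF a] by blast
  next
    fix b s1 s2 assume "Q a b s1" "reached q s1 \<subseteq> reached q s2"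
    then show "Q a b s2" unfolding Q_def by blast
  qed (simp_all add: idx)
  have "I (run (reach_round d c) s) \<and> reached q s \<subseteq> reached q (run (reach_round d c) s) \<and>
     (\<forall>a<n. (\<forall>b<n. Q a b (run (reach_round d c) s)))"
    unfolding reach_round_def
  proof (rule run_each[where S = "reached q" and I = I])
    show "ints s ''n'' [] = int n" using assms by (auto simp: reach_inv_def dest: env_n)
    show "I s" using assms by (simp add: I_def)
  next
    fix a s' assume "a < n" "I s'" "ints s' ''u'' [] = int a"
    from inner[OF this] show "I (run (Loop ''v'' ?body) s') \<and>
      reached q s' \<subseteq> reached q (run (Loop ''v'' ?body) s') \<and>
      (\<forall>b<n. Q a b (run (Loop ''v'' ?body) s'))" by blast
  next
    fix a s1 s2 assume "\<forall>b<n. Q a b s1" "reached q s1 \<subseteq> reached q s2"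
    then show "\<forall>b<n. Q a b s2" unfolding Q_def by blast
  qed (simp_all add: idx)
  then have "I (run (reach_round d c) s)" and
    Q: "\<And>a b. b < n \<Longrightarrow> a \<in> ?A \<Longrightarrow> adj a b \<Longrightarrow> near r q b \<Longrightarrow> b \<in> reached q (run (reach_round d c) s)"
    unfolding Q_def reached_def by blast+
  moreover have "reached q (run (reach_round d c) s) \<noteq> ?A" if "\<not> reach_closed r q ?A"
    using that Q adj_less unfolding reach_closed_def by blast
  ultimately show ?thesis unfolding I_def by simp
qed

end

text \<open>In contrast to \<open>run_each\<close>, no growing set carries earlier facts along; each
  iteration shows again what its predecessors achieved.\<close>

lemma run_all:
  assumes wf: "well_formed (Loop i p)" and n: "ints s0 ''n'' [] = int N" and init: "I s0"
    and index: "\<And>v s. I (write_int i [] v s) = I s" "\<And>a v s. Q a (write_int i [] v s) = Q a s"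
    and step: "\<And>a s. a < N \<Longrightarrow> I s \<Longrightarrow> ints s i [] = int a \<Longrightarrow> \<forall>b<a. Q b s \<Longrightarrow>
      I (run p s) \<and> (\<forall>b\<le>a. Q b (run p s))"
  shows "I (run (Loop i p) s0) \<and> (\<forall>a<N. Q a (run (Loop i p) s0))"
  by (rule run_Loop[where I = "\<lambda>j s. I s \<and> (\<forall>a<j. Q a s)"])
    (use assms in \<open>auto simp: less_Suc_eq_le\<close>)

definition net_prg :: prg where
  "net_prg = Loop ''v'' (Set ''g'' [scalar ''v''] (IConst 0)) ;; Set ''m'' [] (IConst 0) ;;
     Loop ''p'' (Set ''isc'' [scalar ''p''] (IConst 0) ;;
       When (BNot (positive (entry ''g'' ''p'')))
         (Set ''isc'' [scalar ''p''] (IConst 1) ;;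
          Set ''m'' [] (IAdd (scalar ''m'') (IConst 1)) ;;
          Loop ''v'' (When (positive (entry2 ''T'' ''p'' ''v''))
            (Set ''g'' [scalar ''v''] (IConst 1)))))"

context points_graph
begin

lemma run_reach_prg:
  assumes "env c r s0" and r: "r \<ge> 0"
  shows "\<forall>q<n. reached q (run (reach_prg d c) s0) = {v. reach r q v}"
proof -
  let ?clear = "Loop ''v'' (Set ''T'' [scalar ''p'', scalar ''v''] (IConst 0))"
  let ?init = "Set ''T'' [scalar ''p'', scalar ''p''] (IConst 1)"
  let ?close = "Loop ''j'' (reach_round d c)"
  have "env c r (run (reach_prg d c) s0) \<and>
      (\<forall>q<n. reached q (run (reach_prg d c) s0) = {v. reach r q v})"
    unfolding reach_prg_def
  proof (rule run_all)
    show "ints s0 ''n'' [] = int n" using assms by (auto dest: env_n)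
    show "env c r s0" by fact
  next
    fix q s assume q: "q < n" and s: "env c r s" "ints s ''p'' [] = int q"
      and old: "\<forall>q'<q. reached q' s = {v. reach r q' v}"
    define s1 where "s1 = run ?clear s"
    let ?same = "\<lambda>s'. \<forall>q'. q' \<noteq> q \<longrightarrow> (\<forall>v. ints s' ''T'' [int q', int v] =
      ints s ''T'' [int q', int v])"
    have s1: "(env c r s1 \<and> ints s1 ''p'' [] = int q \<and> ?same s1) \<and>
       (\<forall>v<n. ints s1 ''T'' [int q, int v] = 0)"
      unfolding s1_def
    proof (rule run_all)
      show "ints s ''n'' [] = int n" using s by (auto dest: env_n)
      show "env c r s \<and> ints s ''p'' [] = int q \<and> ?same s" using s by simp
    qed auto
    define s2 where "s2 = run ?init s1"
    have s2: "env c r s2" "ints s2 ''p'' [] = int q" "?same s2" "reached q s2 = {q}"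
      using s1 q by (auto simp: s2_def reached_def)
    define s3 where "s3 = run ?close s2"
    have "reach_inv c r q s s3 \<and> reached q s2 \<subseteq> reached q s3 \<and> reach_closed r q (reached q s3)"
      unfolding s3_def
    proof (rule run_closure[where I = "reach_inv c r q s" and S = "reached q" and
          stop = "reach_closed r q"])
      show "well_formed (Loop ''j'' (reach_round d c))"
        by (simp add: reach_round_def)
      show "ints s2 ''n'' [] = int n" using s2 by (auto dest: env_n)
      show "reach_inv c r q s s2" using s2 q by (auto simp: reach_inv_def intro: reach.refl)
      show "reached q s' \<subseteq> {..<n}" for s' by (auto simp: reached_def)
      show "reach_closed r q (reached q s')" if "reached q s' = {..<n}" for s'
        using that adj_less by (auto simp: reach_closed_def)
      show "reach_inv c r q s (run (reach_round d c) s') \<and>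
          reached q s' \<subseteq> reached q (run (reach_round d c) s') \<and>
          (if reach_closed r q (reached q s') then reached q (run (reach_round d c) s') = reached q s'
           else reached q (run (reach_round d c) s') \<noteq> reached q s')"
        if "reach_inv c r q s s'" for s'
        using run_reach_round[OF that q] .
    qed (auto simp: reach_inv_def)
    then have inv: "reach_inv c r q s s3" and "q \<in> reached q s3"
      and cl: "reach_closed r q (reached q s3)" using s2 by auto
    have "v \<in> reached q s3" if "reach r q v" for v
      using that \<open>q \<in> reached q s3\<close> cl by (induction rule: reach.induct) (auto simp: reach_closed_def)
    then have "reached q s3 = {v. reach r q v}" using inv by (auto simp: reach_inv_def)
    moreover have "reached q' s3 = reached q' s" if "q' \<noteq> q" for q'
      using inv that by (simp add: reached_def reach_inv_def)
    ultimately have "\<forall>q'\<le>q. reached q' s3 =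
      {v. reach r q' v}" using old by (metis le_neq_implies_less)
    moreover have "env c r s3" using inv by (simp add: reach_inv_def)
    moreover have "run (?clear ;; ?init ;; ?close) s = s3"
      by (simp only: run.simps s1_def s2_def s3_def)
    ultimately show "env c r (run (?clear ;; ?init ;; ?close) s) \<and>
        (\<forall>q'\<le>q. reached q' (run (?clear ;; ?init ;; ?close) s) = {v. reach r q' v})" by simp
  qed (auto simp: reach_round_def)
  then show ?thesis by blast
qed

text \<open>The bound \<open>j\<close> excludes entries of \<open>''isc''\<close> that the loop has
  not visited yet, which may be left over from an earlier radius.\<close>

definition centers_below :: "nat \<Rightarrow> state \<Rightarrow> nat set" where
  "centers_below j s = {p. p < j \<and> ints s ''isc'' [int p] > 0}"

definition covered :: "state \<Rightarrow> nat set" where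
  "covered s = {v. v < n \<and> ints s ''g'' [int v] > 0}"

lemma centers_below_write [simp]:
  "a \<noteq> ''isc'' \<Longrightarrow> centers_below j (write_int a is y s) = centers_below j s"
  by (simp add: centers_below_def)

lemma covered_write [simp]: "a \<noteq> ''g'' \<Longrightarrow> covered (write_int a is y s) = covered s"
  by (simp add: covered_def)

definition net_inv :: "real \<Rightarrow> nat \<Rightarrow> state \<Rightarrow> bool" where
  "net_inv r j s \<longleftrightarrow> ints s ''m'' [] = int (card (centers_below j s)) \<and>
     covered s = {v. \<exists>c\<in>centers_below j s. reach r c v} \<and>
     (\<forall>c\<in>centers_below j s. \<forall>c'\<in>centers_below j s. c < c' \<longrightarrow> \<not> reach r c c') \<and>
     {..<j} \<subseteq> covered s"

lemma net_inv_write [simp]: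
  "a \<notin> {''m'', ''g'', ''isc''} \<Longrightarrow> net_inv r j (write_int a is y s) = net_inv r j s"
  by (auto simp: net_inv_def)

lemma run_net_prg:
  assumes "ints s0 ''n'' [] = int n" and T: "\<forall>q<n. reached q s0 = {v. reach r q v}"
  shows "net r (centers_below n (run net_prg s0)) \<and>
    ints (run net_prg s0) ''m'' [] = int (card (centers_below n (run net_prg s0)))"
proof -
  let ?clear = "Loop ''v'' (Set ''g'' [scalar ''v''] (IConst 0))"
  let ?mark = "Loop ''v'' (When (positive (entry2 ''T'' ''p'' ''v'')) (Set ''g'' [scalar ''v''] (IConst 1)))"
  let ?zero = "Set ''m'' [] (IConst 0)"
  let ?new = "Set ''isc'' [scalar ''p''] (IConst 1) ;;
          Set ''m'' [] (IAdd (scalar ''m'') (IConst 1)) ;; ?mark"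
  let ?body = "Set ''isc'' [scalar ''p''] (IConst 0) ;;
       When (BNot (positive (entry ''g'' ''p''))) ?new"
  define s1 where "s1 = run (?clear ;; ?zero) s0"
  have "True \<and> (\<forall>v<n. ints (run ?clear s0) ''g'' [int v] = 0)"
    by (rule run_all) (use assms in auto)
  then have s1: "ints s1 ''n'' [] = int n" "ints s1 ''m'' [] = 0" "covered s1 = {}"
    "ints s1 ''T'' = ints s0 ''T''"
    unfolding s1_def using assms(1) by (auto simp: ints_run covered_def simp del: run.simps(5))
  have mark: "covered (run ?mark s) = covered s \<union> {v. reach r p v}"
    if p: "p < n" "ints s ''p'' [] = int p" and s: "ints s ''n'' [] = int n" "ints s ''T'' =
      ints s0 ''T''"
    for s p
  proof -
    let ?I = "\<lambda>s'. ints s' ''p'' [] = int p \<and> ints s' ''T'' = ints s0 ''T'' \<and>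
      (\<forall>v<n. ints s' ''g'' [int v] = ints s ''g'' [int v] \<or> ints s' ''g'' [int v] = 1 \<and> reach r p v)"
    have reach: "reach r p v \<longleftrightarrow> ints s0 ''T'' [int p, int v] > 0" if "v < n" for v
      using T p(1) that by (auto simp: reached_def)
    have "?I (run ?mark s) \<and> (\<forall>v<n. reach r p v \<longrightarrow> ints (run ?mark s) ''g'' [int v] > 0)"
    proof (rule run_all[where I = ?I])
      show "?I s" using p s by simp
      show "ints s ''n'' [] = int n" by fact
    qed (auto simp: reach order_le_less)
    then have "ints (run ?mark s) ''g'' [int v] > 0 \<longleftrightarrow> ints s ''g'' [int v] > 0 \<or> reach r p v"
      if "v < n" for v using that by (metis zero_less_one)
    then show ?thesis using reach_less unfolding covered_def by blast
  qed
  have "net_inv r n (run (Loop ''p'' ?body) s1)"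
  proof (rule run_Loop[where I = "net_inv r"])
    show "net_inv r 0 s1" using s1 by (simp add: net_inv_def centers_below_def)
    show "ints s1 ''n'' [] = int n" by fact
    show "net_inv r j (write_int ''p'' [] v s)" if "net_inv r j s" for j s v
      using that by simp
  next
    fix p s assume p: "p < n" and inv: "net_inv r p s" and sp: "ints s ''p'' [] = int p"
      and fr: "\<And>a. a \<notin> insert ''p'' (writes ?body) \<Longrightarrow> ints s a = ints s1 a"
    let ?s = "write_int ''isc'' [int p] 0 s"
    have n: "ints s ''n'' [] = int n" "ints s ''T'' = ints s0 ''T''" using fr s1 by auto
    show "net_inv r (Suc p) (run ?body s)"
    proof (cases "p \<in> covered s")
      case True
      then have run: "run ?body s = ?s" using p sp by (simp add: covered_def)
      have "centers_below (Suc p) ?s = centers_below p s"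
        by (auto simp: centers_below_def less_Suc_eq)
      moreover have "{..<Suc p} \<subseteq> covered s"
        using inv True unfolding net_inv_def lessThan_Suc by blast
      moreover have "covered ?s = covered s" "ints ?s ''m'' = ints s ''m''" by simp_all
      ultimately show ?thesis using inv unfolding run net_inv_def by metis
    next
      case False
      define s2 where "s2 = run (Set ''isc'' [scalar ''p''] (IConst 1) ;;
          Set ''m'' [] (IAdd (scalar ''m'') (IConst 1))) ?s"
      have s2: "ints s2 ''p'' [] = int p" "ints s2 ''n'' [] = int n" "ints s2 ''T'' = ints s0 ''T''"
        "ints s2 ''m'' [] = ints s ''m'' [] + 1" "covered s2 = covered s"
        using sp n by (auto simp: s2_def covered_def)
      have run: "run ?body s = run ?mark s2"
        using False p sp by (simp add: covered_def s2_def del: run.simps(5))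
      have "centers_below (Suc p) (run ?mark s2) = centers_below (Suc p) s2"
        by (simp add: centers_below_def ints_run)
      also have "\<dots> = insert p (centers_below p s)"
        using sp by (auto simp: centers_below_def less_Suc_eq s2_def)
      finally have cb: "centers_below (Suc p) (run ?mark s2) = insert p (centers_below p s)" .
      have cov: "covered (run ?mark s2) = covered s \<union> {v. reach r p v}"
        using mark[OF p] s2 by simp
      have m: "ints (run ?mark s2) ''m'' [] = ints s ''m'' [] + 1"
        using s2 by (simp add: ints_run del: run.simps(5))
      have "p \<notin> centers_below p s" "finite (centers_below p s)" by (auto simp: centers_below_def)
      moreover have "\<not> p < c" if "c \<in> centers_below p s" for c using that by (auto simp: centers_below_def)
      moreover have "\<not> reach r c p" if "c \<in> centers_below p s" for c
        using False inv that by (auto simp: net_inv_def)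
      ultimately show ?thesis
        using inv reach.refl[OF p, of r] unfolding run net_inv_def cb cov m
        by (auto simp: lessThan_Suc)
    qed
  qed auto
  moreover have "run net_prg s0 = run (Loop ''p'' ?body) s1"
    unfolding net_prg_def s1_def by (simp only: run.simps)
  ultimately show ?thesis unfolding net_def net_inv_def centers_below_def by auto
qed

end

section \<open>Computing the layers\<close>

text \<open>Loops run up to \<open>n\<close> only, so iterations over coordinates and layers, whose
  number depends on \<open>d\<close>, are expanded in the program text.\<close>

primrec unroll :: "nat \<Rightarrow> (nat \<Rightarrow> prg) \<Rightarrow> prg" where
  "unroll 0 f = Nop"
| "unroll (Suc m) f = unroll m f ;; f m"

lemma writes_unroll [simp]: "writes (unroll m f) = (\<Union>i<m. writes (f i))"
  by (induction m) (auto simp: less_Suc_eq)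

lemma well_formed_unroll:
  "(\<And>i. i < m \<Longrightarrow> well_formed (f i) \<and> ''n'' \<notin> writes (f i)) \<Longrightarrow> well_formed (unroll m f)"
  by (induction m) auto

lemma run_unroll:
  assumes "I 0 s" and "\<And>j s. j < m \<Longrightarrow> I j s \<Longrightarrow> I (Suc j) (run (f j) s)"
  shows "I m (run (unroll m f) s)"
  using assms(2) by (induction m) (auto simp: assms(1))

text \<open>The window has width \<open>2r\<close>, the largest distance of two centers whose
  regions share a point.\<close>

definition left_ends_prg :: "nat \<Rightarrow> nat \<Rightarrow> prg" where
  "left_ends_prg c i = Loop ''v'' (Set ''P'' [scalar ''v''] (scalar ''v'') ;;
     Loop ''u'' (When (BAnd (RLess (coord (scalar ''u'') i) (coord (entry ''P'' ''v'') i))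
         (BNot (RLess (RAdd (coord (scalar ''u'') i) (RAdd (radius c) (radius c)))
           (coord (scalar ''v'') i))))
       (Set ''P'' [scalar ''v''] (scalar ''u''))))"

text \<open>Without a division operation, residues modulo \<open>d + 1\<close> are obtained by
  resetting a value to 0 as soon as it exceeds \<open>d\<close>.\<close>

definition levels_prg :: "nat \<Rightarrow> nat \<Rightarrow> prg" where
  "levels_prg d i = Loop ''v'' (Set ''tau'' [IConst (int i), scalar ''v''] (IConst 0)) ;;
     Loop ''j'' (Loop ''v''
       (When (RLess (coord (entry ''P'' ''v'') i) (coord (scalar ''v'') i))
         (Set ''tau'' [IConst (int i), scalar ''v'']
            (IAdd (IRead ''tau'' [IConst (int i), entry ''P'' ''v'']) (IConst 1)) ;;
          When (ILess (IConst (int d)) (IRead ''tau'' [IConst (int i), scalar ''v'']))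
            (Set ''tau'' [IConst (int i), scalar ''v''] (IConst 0)))))"

definition coloring_prg :: "nat \<Rightarrow> nat \<Rightarrow> prg" where
  "coloring_prg d c = unroll d (\<lambda>i. left_ends_prg c i ;; levels_prg d i)"

context points_graph
begin

definition left_end :: "nat \<Rightarrow> real \<Rightarrow> nat \<Rightarrow> nat \<Rightarrow> state \<Rightarrow> nat \<Rightarrow> bool" where
  "left_end i w j v s q \<longleftrightarrow> ints s ''P'' [int v] = int q \<and> q < n \<and> X q i \<le> X v i \<and> X v i \<le> X q i + w \<and>
     (\<forall>u<j. X v i \<le> X u i + w \<longrightarrow> X q i \<le> X u i)"

lemma left_end_write [simp]:
  "a \<noteq> ''P'' \<Longrightarrow> left_end i w j v (write_int a is y s) q = left_end i w j v s q"
  by (simp add: left_end_def)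

lemma rval_coord:
  "env c r s \<Longrightarrow> i < d \<Longrightarrow> v < n \<Longrightarrow> ival e s = int v \<Longrightarrow> rval (coord e i) s = X v i"
  by (simp add: coord_def env_def input_def)

lemma run_left_ends_prg:
  assumes "env c r s0" and r: "r \<ge> 0" and i: "i < d"
  shows "left_ends n (2 * r) (\<lambda>v. X v i) (\<lambda>v. nat (ints (run (left_ends_prg c i) s0) ''P'' [int v])) \<and>
    (\<forall>v<n. ints (run (left_ends_prg c i) s0) ''P'' [int v] \<ge> 0)"
proof -
  let ?g = "BAnd (RLess (coord (scalar ''u'') i) (coord (entry ''P'' ''v'') i))
         (BNot (RLess (RAdd (coord (scalar ''u'') i) (RAdd (radius c) (radius c)))
           (coord (scalar ''v'') i)))"
  let ?in = "Loop ''u'' (When ?g (Set ''P'' [scalar ''v''] (scalar ''u'')))"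
  have "env c r (run (left_ends_prg c i) s0) \<and>
      (\<forall>v<n. \<exists>q. left_end i (2 * r) n v (run (left_ends_prg c i) s0) q)"
    unfolding left_ends_prg_def
  proof (rule run_all)
    show "ints s0 ''n'' [] = int n" using assms by (auto dest: env_n)
    show "env c r s0" by fact
  next
    fix v s assume v: "v < n" and s: "env c r s" "ints s ''v'' [] = int v"
      and old: "\<forall>b<v. \<exists>q. left_end i (2 * r) n b s q"
    let ?s = "write_int ''P'' [int v] (int v) s"
    let ?I = "\<lambda>j s'. env c r s' \<and> ints s' ''v'' [] = int v \<and> (\<exists>q. left_end i (2 * r) j v s' q) \<and>
      (\<forall>v'. v' \<noteq> v \<longrightarrow> ints s' ''P'' [int v'] = ints s ''P'' [int v'])"
    have "?I n (run ?in ?s)"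
    proof (rule run_Loop[where I = ?I])
      show "ints ?s ''n'' [] = int n" using s by (auto dest: env_n)
      have "left_end i (2 * r) 0 v ?s v" using v r by (simp add: left_end_def)
      then show "?I 0 ?s" using s by auto
    next
      fix u s' assume u: "u < n" "ints s' ''u'' [] = int u" and I: "?I u s'"
      then obtain q where q: "left_end i (2 * r) u v s' q" by blast
      have g: "bval ?g s' \<longleftrightarrow> X u i < X q i \<and> X v i \<le> X u i + 2 * r"
      proof -
        have "rval (coord (scalar ''u'') i) s' = X u i" "rval (coord (scalar ''v'') i) s' = X v i"
          using rval_coord I i u v by auto
        moreover have "rval (coord (entry ''P'' ''v'') i) s' = X q i"
          using rval_coord[of c r s' i q] I i q unfolding left_end_def by auto
        ultimately show ?thesis using I by (auto simp: env_def)
      qed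
      show "?I (Suc u) (run (When ?g (Set ''P'' [scalar ''v''] (scalar ''u''))) s')"
      proof (cases "bval ?g s'")
        case True
        then have *: "X u i < X q i" "X v i \<le> X u i + 2 * r" using g by blast+
        have run: "run (When ?g (Set ''P'' [scalar ''v''] (scalar ''u''))) s' =
            write_int ''P'' [int v] (int u) s'"
          using True I u by (simp del: bval.simps)
        have "left_end i (2 * r) (Suc u) v (write_int ''P'' [int v] (int u) s') u"
          using * q u unfolding left_end_def by (auto simp: less_Suc_eq)
        then show ?thesis using I unfolding run by auto
      next
        case False
        have "left_end i (2 * r) (Suc u) v s' q"
          using q g False unfolding left_end_def by (auto simp: less_Suc_eq)
        then show ?thesis using I False by (auto simp del: bval.simps)
      qed
    qed auto
    moreover define s2 where "s2 = run ?in ?s"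
    ultimately have I: "?I n s2" by blast
    have "\<exists>q. left_end i (2 * r) n b s2 q" if "b \<le> v" for b
    proof (cases "b = v")
      case False
      then have "ints s2 ''P'' [int b] = ints s ''P'' [int b]" using I by blast
      then have "left_end i (2 * r) n b s2 = left_end i (2 * r) n b s"
        by (simp add: left_end_def fun_eq_iff)
      then show ?thesis using old that False by (metis order_le_less)
    qed (use I in blast)
    moreover have "run (Set ''P'' [scalar ''v''] (scalar ''v'') ;; ?in) s = s2"
      using s by (simp add: s2_def)
    ultimately show "env c r (run (Set ''P'' [scalar ''v''] (scalar ''v'') ;; ?in) s) \<and>
       (\<forall>b\<le>v. \<exists>q. left_end i (2 * r) n b (run (Set ''P'' [scalar ''v''] (scalar ''v'') ;; ?in) s) q)"
      using I by metis
  qed auto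
  then have *: "\<exists>q. left_end i (2 * r) n v (run (left_ends_prg c i) s0) q" if "v < n" for v
    using that by blast
  let ?P = "\<lambda>v. ints (run (left_ends_prg c i) s0) ''P'' [int v]"
  have "0 \<le> ?P v \<and> nat (?P v) < n \<and> X (nat (?P v)) i \<le> X v i \<and> X v i \<le> X (nat (?P v)) i + 2 * r \<and>
     (\<forall>u<n. X v i \<le> X u i + 2 * r \<longrightarrow> X (nat (?P v)) i \<le> X u i)" if "v < n" for v
    using *[OF that] by (auto simp: left_end_def)
  then show ?thesis unfolding left_ends_def by blast
qed

text \<open>After \<open>j\<close> rounds all points of level at most \<open>j\<close> have their
  residue. In the next round a point of level at most \<open>j + 1\<close> reads a predecessor that
  is already correct, whatever the processing order, and correct values are rewritten with the same
  value.\<close>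

lemma run_levels_prg:
  assumes "env c r s0" and i: "i < d" and P: "left_ends n w (\<lambda>v. X v i) P"
    and sP: "\<forall>v<n. ints s0 ''P'' [int v] = int (P v)"
  shows "\<forall>v<n. ints (run (levels_prg d i) s0) ''tau'' [int i, int v] =
      int (lev n (\<lambda>v. X v i) P v mod Suc d)"
    and "\<forall>v<n. \<forall>i'<i. ints (run (levels_prg d i) s0) ''tau'' [int i', int v] =
      ints s0 ''tau'' [int i', int v]"
proof -
  let ?l = "lev n (\<lambda>v. X v i) P"
  let ?clear = "Loop ''v'' (Set ''tau'' [IConst (int i), scalar ''v''] (IConst 0))"
  let ?g = "RLess (coord (entry ''P'' ''v'') i) (coord (scalar ''v'') i)"
  let ?wrap = "When (ILess (IConst (int d)) (IRead ''tau'' [IConst (int i), scalar ''v'']))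
            (Set ''tau'' [IConst (int i), scalar ''v''] (IConst 0))"
  let ?body = "When ?g
         (Set ''tau'' [IConst (int i), scalar ''v'']
            (IAdd (IRead ''tau'' [IConst (int i), entry ''P'' ''v'']) (IConst 1)) ;; ?wrap)"
  let ?fix = "\<lambda>s. env c r s \<and> (\<forall>v<n. ints s ''P'' [int v] = int (P v)) \<and>
     (\<forall>v<n. \<forall>i'<i. ints s ''tau'' [int i', int v] = ints s0 ''tau'' [int i', int v])"
  let ?ok = "\<lambda>s v. ints s ''tau'' [int i, int v] = int (?l v mod Suc d)"
  define s1 where "s1 = run ?clear s0"
  have s1: "?fix s1 \<and> (\<forall>v<n. ints s1 ''tau'' [int i, int v] = 0)"
    unfolding s1_def
  proof (rule run_all)
    show "ints s0 ''n'' [] = int n" using assms by (auto dest: env_n)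
    show "?fix s0" using assms by simp
  qed auto
  let ?I = "\<lambda>j s. ?fix s \<and> (\<forall>v<n. ?l v \<le> j \<longrightarrow> ?ok s v)"
  have round: "?I (Suc j) (run (Loop ''v'' ?body) s)" if s: "?I j s" for j s
  proof -
    have "?I j (run (Loop ''v'' ?body) s) \<and> (\<forall>v<n. ?l v \<le> Suc j \<longrightarrow> ?ok (run (Loop ''v'' ?body) s) v)"
    proof (rule run_all[where I = "?I j"])
      show "ints s ''n'' [] = int n" using s by (auto dest: env_n)
      show "?I j s" by fact
    next
      fix v s' assume v: "v < n" and s': "?I j s'" "ints s' ''v'' [] = int v"
        and old: "\<forall>b<v. ?l b \<le> Suc j \<longrightarrow> ?ok s' b"
      have Pv: "P v < n" using P v by (simp add: left_ends_def)
      have g: "bval ?g s' \<longleftrightarrow> X (P v) i < X v i"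
      proof -
        have "rval (coord (scalar ''v'') i) s' = X v i" using rval_coord s' i v by auto
        moreover have "rval (coord (entry ''P'' ''v'') i) s' = X (P v) i"
          using rval_coord[of c r s' i "P v"] s' i Pv v by auto
        ultimately show ?thesis by auto
      qed
      show "?I j (run ?body s') \<and> (\<forall>b\<le>v. ?l b \<le> Suc j \<longrightarrow> ?ok (run ?body s') b)"
      proof (cases "bval ?g s'")
        case True
        then have lv: "?l v = Suc (?l (P v))"
          using g Pv by (simp add: lev.simps[of n _ P v])
        let ?t = "ints s' ''tau'' [int i, int (P v)] + 1"
        have "run ?body s' = (if int d < ?t then
            write_int ''tau'' [int i, int v] 0 (write_int ''tau'' [int i, int v] ?t s')
            else write_int ''tau'' [int i, int v] ?t s')"
          using True s' v by (simp del: bval.simps(2))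
        then have run: "ints (run ?body s') ''tau'' =
            (ints s' ''tau'')([int i, int v] := (if int d < ?t then 0 else ?t))"
          "?fix (run ?body s')"
          using s' by auto
        have okv: "?ok (run ?body s') v" if "?l v \<le> Suc j"
        proof -
          define x where "x = ?l (P v) mod Suc d"
          have t: "?t = int x + 1" using s' that lv Pv by (simp add: x_def)
          have "x \<le> d" by (simp add: x_def less_Suc_eq_le[symmetric])
          then have "(if int d < ?t then 0 else ?t) = int (if Suc x = Suc d then 0 else Suc x)"
            unfolding t by auto
          also have "\<dots> = int (?l v mod Suc d)" unfolding lv x_def by (simp only: mod_Suc)
          finally show ?thesis unfolding run(1) by simp
        qed
        have okb: "?ok (run ?body s') b \<longleftrightarrow> ?ok s' b" if "b \<noteq> v" for b
          unfolding run(1) using that by simp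
        have "?ok (run ?body s') b" if "b < n" "?l b \<le> j" for b
          using okv okb[of b] s' that by (cases "b = v") (simp only: le_SucI, blast)
        moreover have "?ok (run ?body s') b" if "b \<le> v" "?l b \<le> Suc j" for b
          using okv okb[of b] old that by (cases "b = v") (blast, metis order_le_less)
        ultimately show ?thesis using run(2) by blast
      next
        case False
        then have run: "run ?body s' = s'" by (simp del: bval.simps)
        have "?l v = 0" using False g by (simp add: lev.simps[of n _ P v])
        then have "?ok s' v" using s' v by simp
        then show ?thesis unfolding run using s' old by (auto simp: order_le_less)
      qed
    qed auto
    then show ?thesis by blast
  qed
  have "?I n (run (Loop ''j'' (Loop ''v'' ?body)) s1)"
  proof (rule run_Loop[where I = ?I])
    show "ints s1 ''n'' [] = int n" using s1 by (auto dest: env_n)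
    show "?I 0 s1" using s1 by simp
    show "?I (Suc j) (run (Loop ''v'' ?body) s)" if "?I j s" for j s using round[OF that] .
  qed auto
  moreover have "?l v \<le> n" if "v < n" for v using lev_less[OF that] by (simp add: order_less_imp_le)
  moreover have "run (levels_prg d i) s0 = run (Loop ''j'' (Loop ''v'' ?body)) s1"
    unfolding levels_prg_def s1_def by (simp only: run.simps(3))
  ultimately show "\<forall>v<n. ?ok (run (levels_prg d i) s0) v"
    "\<forall>v<n. \<forall>i'<i. ints (run (levels_prg d i) s0) ''tau'' [int i', int v] =
      ints s0 ''tau'' [int i', int v]" by auto
qed

definition color :: "state \<Rightarrow> nat \<Rightarrow> nat \<Rightarrow> nat" where
  "color s i v = nat (ints s ''tau'' [int i, int v])"

text \<open>The array \<open>''P''\<close> is overwritten for each coordinate, so the invariant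
  keeps only the existence of left ends that explain the stored residues.\<close>

lemma run_coloring_prg:
  assumes "env c r s0" and r: "r \<ge> 0"
  shows "colored (2 * r) (color (run (coloring_prg d c) s0)) \<and>
    (\<forall>i<d. \<forall>v<n. ints (run (coloring_prg d c) s0) ''tau'' [int i, int v] \<ge> 0)"
proof -
  define s where "s = run (coloring_prg d c) s0"
  have "env c r s \<and> (\<forall>i<d. \<exists>P. left_ends n (2 * r) (\<lambda>v. X v i) P \<and>
      (\<forall>v<n. ints s ''tau'' [int i, int v] = int (lev n (\<lambda>v. X v i) P v mod Suc d)))"
    unfolding coloring_prg_def s_def
  proof (rule run_unroll[where I = "\<lambda>j s. env c r s \<and> (\<forall>i<j. \<exists>P. left_ends n (2 * r) (\<lambda>v. X v i) P \<and>
      (\<forall>v<n. ints s ''tau'' [int i, int v] = int (lev n (\<lambda>v. X v i) P v mod Suc d)))"])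
    show "env c r s0 \<and> (\<forall>i<0. \<exists>P. left_ends n (2 * r) (\<lambda>v. X v i) P \<and>
      (\<forall>v<n. ints s0 ''tau'' [int i, int v] = int (lev n (\<lambda>v. X v i) P v mod Suc d)))"
      using assms by simp
  next
    fix i s assume i: "i < d" and s: "env c r s \<and> (\<forall>h<i. \<exists>P. left_ends n (2 * r) (\<lambda>v. X v h) P \<and>
      (\<forall>v<n. ints s ''tau'' [int h, int v] = int (lev n (\<lambda>v. X v h) P v mod Suc d)))"
    define s1 where "s1 = run (left_ends_prg c i) s"
    define P where "P = (\<lambda>v. nat (ints s1 ''P'' [int v]))"
    have P: "left_ends n (2 * r) (\<lambda>v. X v i) P" "\<forall>v<n. ints s1 ''P'' [int v] = int (P v)"
      using run_left_ends_prg[OF conjunct1[OF s] r i] by (auto simp: P_def s1_def)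
    have e: "env c r s1" "ints s1 ''tau'' = ints s ''tau''"
      using s by (auto simp: s1_def left_ends_prg_def env_run ints_run)
    define s2 where "s2 = run (levels_prg d i) s1"
    have "env c r s2" using e by (simp add: s2_def levels_prg_def env_run)
    moreover have "\<exists>P. left_ends n (2 * r) (\<lambda>v. X v i') P \<and>
      (\<forall>v<n. ints s2 ''tau'' [int i', int v] = int (lev n (\<lambda>v. X v i') P v mod Suc d))"
      if "i' < Suc i" for i'
    proof (cases "i' = i")
      case True
      then show ?thesis using run_levels_prg(1)[OF e(1) i P] P(1) unfolding s2_def by blast
    next
      case False
      then have "i' < i" using that by simp
      then obtain P' where "left_ends n (2 * r) (\<lambda>v. X v i') P'"
        "\<forall>v<n. ints s ''tau'' [int i', int v] = int (lev n (\<lambda>v. X v i') P' v mod Suc d)"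
        using s by blast
      moreover have "\<forall>v<n. ints s2 ''tau'' [int i', int v] = ints s ''tau'' [int i', int v]"
        using run_levels_prg(2)[OF e(1) i P] \<open>i' < i\<close> e(2) unfolding s2_def by simp
      ultimately show ?thesis by metis
    qed
    moreover have "run (left_ends_prg c i ;; levels_prg d i) s = s2" by (simp add: s1_def s2_def)
    ultimately show "env c r (run (left_ends_prg c i ;; levels_prg d i) s) \<and>
      (\<forall>i'<Suc i. \<exists>P. left_ends n (2 * r) (\<lambda>v. X v i') P \<and>
      (\<forall>v<n. ints (run (left_ends_prg c i ;; levels_prg d i) s) ''tau'' [int i', int v] =
        int (lev n (\<lambda>v. X v i') P v mod Suc d)))"
      by simp
  qed
  then obtain P where P: "\<And>i. i < d \<Longrightarrow> left_ends n (2 * r) (\<lambda>v. X v i) (P i)"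
     "\<And>i v. i < d \<Longrightarrow> v < n \<Longrightarrow> ints s ''tau'' [int i, int v] =
        int (lev n (\<lambda>v. X v i) (P i) v mod Suc d)"
    by metis
  have "colored (2 * r) (color s)"
    by (rule colored_levels[where P = P]) (use r P in \<open>auto simp: color_def\<close>)
  then show ?thesis using P by (simp add: s_def)
qed

end

section \<open>Computing the clusters\<close>

definition active_test :: "nat \<Rightarrow> nat \<Rightarrow> string \<Rightarrow> bexp" where
  "active_test d t p = BAnd (positive (entry ''isc'' p)) (all_below d (\<lambda>i. BNot (BAnd
     (BNot (ILess (IRead ''tau'' [IConst (int i), scalar p]) (IConst (int t))))
     (BNot (ILess (IConst (int t)) (IRead ''tau'' [IConst (int i), scalar p]))))))"

definition attach_test :: bexp where
  "attach_test = BAnd (positive (entry2 ''T'' ''p'' ''u'')) (BAnd (positive (entry2 ''T'' ''p'' ''v''))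
     (BAnd (positive (entry2 ''adj'' ''u'' ''v''))
       (BAnd (positive (entry ''lab'' ''u'')) (BNot (positive (entry ''lab'' ''v''))))))"

definition attach_prg :: prg where
  "attach_prg = Set ''lab'' [scalar ''v''] (entry ''lab'' ''u'') ;;
     Set ''ord'' [scalar ''cnt''] (scalar ''v'') ;;
     Set ''cnt'' [] (IAdd (scalar ''cnt'') (IConst 1))"

definition flood_round :: "nat \<Rightarrow> nat \<Rightarrow> prg" where
  "flood_round d t = Loop ''p'' (When (active_test d t ''p'')
     (Loop ''u'' (Loop ''v'' (When attach_test attach_prg))))"

definition layer_prg :: "nat \<Rightarrow> nat \<Rightarrow> prg" where
  "layer_prg d t = Loop ''j'' (flood_round d t) ;;
     Loop ''q'' (When (BAnd (active_test d t ''q'') (BNot (positive (entry ''lab'' ''q''))))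
       (Set ''num'' [] (IAdd (scalar ''num'') (IConst 1)) ;;
        Set ''lab'' [scalar ''q''] (scalar ''num'') ;;
        Loop ''j'' (flood_round d t)))"

definition layers_prg :: "nat \<Rightarrow> prg" where
  "layers_prg d = Loop ''v'' (Set ''lab'' [scalar ''v''] (IConst 0)) ;;
     Set ''num'' [] (IConst 0) ;; Set ''cnt'' [] (IConst 0) ;;
     unroll (Suc d) (layer_prg d)"

lemma well_formed_flood_round: "well_formed (flood_round d t)"
  by (simp add: flood_round_def attach_prg_def)

lemma writes_flood_round:
  "writes (flood_round d t) = {''p'', ''u'', ''v'', ''lab'', ''ord'', ''cnt''}"
  by (auto simp: flood_round_def attach_prg_def)

definition stack :: "state \<Rightarrow> nat list" where
  "stack s = map (\<lambda>i. nat (ints s ''ord'' [int i])) (rev [0..<nat (ints s ''cnt'' [])])"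

context points_graph
begin

text \<open>The value 0 outside the point set makes this agree as a function with the labels of
  \<open>grown\<close>, which start from the zero function.\<close>

definition lab :: "state \<Rightarrow> nat \<Rightarrow> int" where
  "lab s v = (if v < n then ints s ''lab'' [int v] else 0)"

definition labelled :: "state \<Rightarrow> nat set" where
  "labelled s = {v. lab s v > 0}"

definition forest :: "state \<Rightarrow> bool" where
  "forest s \<longleftrightarrow> grown n adj (lab s) (ints s ''num'' []) (stack s) \<and>
     ints s ''cnt'' [] \<ge> 0 \<and> (\<forall>i. int i < ints s ''cnt'' [] \<longrightarrow> ints s ''ord'' [int i] \<ge> 0)"

lemma lab_write [simp]: "a \<noteq> ''lab'' \<Longrightarrow> lab (write_int a is y s) = lab s"
  by (simp add: lab_def fun_eq_iff)

lemma stack_write [simp]: "a \<notin> {''ord'', ''cnt''} \<Longrightarrow> stack (write_int a is y s) = stack s"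
  by (auto simp: stack_def)

lemma labelled_write [simp]: "a \<noteq> ''lab'' \<Longrightarrow> labelled (write_int a is y s) = labelled s"
  by (simp add: labelled_def)

lemma forest_write [simp]:
  "a \<notin> {''lab'', ''num'', ''ord'', ''cnt''} \<Longrightarrow> forest (write_int a is y s) = forest s"
  by (auto simp: forest_def)

lemma lab_update: "v < n \<Longrightarrow> lab (write_int ''lab'' [int v] y s) = (lab s)(v := y)"
  by (auto simp: lab_def fun_eq_iff)

lemma labelled_subset: "labelled s \<subseteq> {..<n}"
  by (auto simp: labelled_def lab_def split: if_splits)

lemma run_attach_prg:
  assumes f: "forest s" and uv: "u < n" "v < n" "lab s u > 0" "lab s v = 0" "adj u v"
    and s: "ints s ''u'' [] = int u" "ints s ''v'' [] = int v"
  shows "forest (run attach_prg s)" "lab (run attach_prg s) = (lab s)(v := lab s u)"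
    "ints (run attach_prg s) ''num'' [] = ints s ''num'' []"
proof -
  let ?s = "run attach_prg s"
  show l: "lab ?s = (lab s)(v := lab s u)"
    using uv s by (simp add: attach_prg_def lab_update) (simp add: lab_def)
  show num: "ints ?s ''num'' [] = ints s ''num'' []" by (simp add: attach_prg_def)
  have c: "ints s ''cnt'' [] \<ge> 0" using f by (simp add: forest_def)
  then have "stack ?s = v # stack s"
    using s by (simp add: attach_prg_def stack_def nat_add_distrib) auto
  moreover have "ints ?s ''cnt'' [] \<ge> 0" using c by (simp add: attach_prg_def)
  moreover have "\<forall>i. int i < ints ?s ''cnt'' [] \<longrightarrow> ints ?s ''ord'' [int i] \<ge> 0"
    using f s by (auto simp: attach_prg_def forest_def)
  ultimately show "forest ?s"
    unfolding forest_def l num using f uv by (auto simp: forest_def intro: grown.attach)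
qed

end

section \<open>Layers for a fixed net and coloring\<close>

locale layered = points_graph n d adj X
  for n d :: nat and adj :: "nat \<Rightarrow> nat \<Rightarrow> bool" and X :: "nat \<Rightarrow> nat \<Rightarrow> real" +
  fixes c :: nat and r :: real and Z :: "nat set" and \<tau> :: "nat \<Rightarrow> nat \<Rightarrow> nat"
  assumes r: "r \<ge> 0" and net: "net r Z" and colored: "colored (2 * r) \<tau>"
begin

definition active :: "nat \<Rightarrow> nat set" where
  "active t = {p \<in> Z. \<forall>i<d. \<tau> i p \<noteq> t}"

definition width :: real where
  "width = real (d + 1) * (2 * r)"

definition cells :: "nat \<Rightarrow> nat \<Rightarrow> nat \<Rightarrow> real \<times> nat" where
  "cells t = (SOME C. \<forall>u<n. \<forall>v<n.
     (\<forall>i<d. \<tau> i u \<noteq> t) \<and> (\<forall>i<d. \<tau> i v \<noteq> t) \<longrightarrow>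
       (near (2 * r) u v \<longrightarrow> C u = C v) \<and> (C u = C v \<longrightarrow> near width u v))"

lemma active_less: "p \<in> active t \<Longrightarrow> p < n"
  using net by (auto simp: active_def net_def)

lemma cells:
  assumes "t \<le> d" "p \<in> active t" "p' \<in> active t"
  shows "near (2 * r) p p' \<Longrightarrow> cells t p = cells t p'" "cells t p = cells t p' \<Longrightarrow> near width p p'"
proof -
  have "\<exists>C :: nat \<Rightarrow> nat \<Rightarrow> real \<times> nat. \<forall>u<n. \<forall>v<n.
     (\<forall>i<d. \<tau> i u \<noteq> t) \<and> (\<forall>i<d. \<tau> i v \<noteq> t) \<longrightarrow>
       (near (2 * r) u v \<longrightarrow> C u = C v) \<and> (C u = C v \<longrightarrow> near width u v)"
    using colored assms(1) unfolding colored_def width_def by blast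
  from someI_ex[OF this] have *: "\<forall>u<n. \<forall>v<n.
     (\<forall>i<d. \<tau> i u \<noteq> t) \<and> (\<forall>i<d. \<tau> i v \<noteq> t) \<longrightarrow>
       (near (2 * r) u v \<longrightarrow> cells t u = cells t v) \<and> (cells t u = cells t v \<longrightarrow> near width u v)"
    unfolding cells_def .
  have "p < n" "p' < n" "\<forall>i<d. \<tau> i p \<noteq> t" "\<forall>i<d. \<tau> i p' \<noteq> t"
    using assms active_less by (auto simp: active_def)
  with * show "near (2 * r) p p' \<Longrightarrow> cells t p = cells t p'"
    "cells t p = cells t p' \<Longrightarrow> near width p p'" by blast+
qed

text \<open>Two radii meet in the common point, so the centers are at distance at most
  \<open>2r\<close>, the quantization width.\<close>

lemma cells_overlap:
  assumes "t \<le> d" "p \<in> active t" "p' \<in> active t" "reach r p v" "reach r p' v"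
  shows "cells t p = cells t p'"
  using cells(1)[OF assms(1-3)] near_trans[OF reach_near[OF assms(4) r] near_sym[OF reach_near[OF assms(5) r]]]
  by simp

definition static :: "state \<Rightarrow> bool" where
  "static s \<longleftrightarrow> env c r s \<and> (\<forall>q<n. reached q s = {v. reach r q v}) \<and> centers_below n s = Z \<and>
     (\<forall>i<d. \<forall>v<n. ints s ''tau'' [int i, int v] = int (\<tau> i v))"

lemma static_write [simp]:
  assumes "a \<notin> {''n'', ''adj'', ''a'', ''b'', ''T'', ''isc'', ''tau''}"
  shows "static (write_int a is y s) = static s"
proof -
  have "env c r (write_int a is y s) = env c r s" using assms by simp
  moreover have "reached q (write_int a is y s) = reached q s" for q using assms by simp
  moreover have "centers_below n (write_int a is y s) = centers_below n s" using assms by simp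
  moreover have "ints (write_int a is y s) ''tau'' = ints s ''tau''" using assms by auto
  ultimately show ?thesis unfolding static_def by simp
qed

lemma static_n: "static s \<Longrightarrow> ints s ''n'' [] = int n"
  by (auto simp: static_def dest: env_n)

lemma bval_active_test:
  assumes "static s" "ints s q [] = int p" "p < n"
  shows "bval (active_test d t q) s \<longleftrightarrow> p \<in> active t"
proof -
  have "p \<in> Z \<longleftrightarrow> ints s ''isc'' [int p] > 0"
    using assms by (auto simp: static_def centers_below_def)
  moreover have "ints s ''tau'' [int i, int p] = int (\<tau> i p)" if "i < d" for i
    using assms that by (simp add: static_def)
  ultimately show ?thesis using assms by (auto simp: active_test_def active_def)
qed

text \<open>The count bound holds because each cluster is founded at a center that was unlabelled
  before; centers swallowed by existing clusters only create slack. It ends as a bound by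
  \<open>card Z\<close>.\<close>

definition growing :: "nat \<Rightarrow> real \<Rightarrow> (nat \<Rightarrow> int) \<Rightarrow> state \<Rightarrow> bool" where
  "growing t B L s \<longleftrightarrow> static s \<and> forest s \<and>
     ints s ''num'' [] \<le> int (card {p \<in> Z. lab s p > 0}) \<and>
     layer (active t) (cells t) r B L (lab s)"

lemma growing_write [simp]:
  assumes "a \<notin> {''n'', ''adj'', ''a'', ''b'', ''T'', ''isc'', ''tau'', ''lab'', ''num'', ''ord'', ''cnt''}"
  shows "growing t B L (write_int a is y s) = growing t B L s"
proof -
  have "ints (write_int a is y s) ''num'' = ints s ''num''" using assms by auto
  then show ?thesis using assms unfolding growing_def by simp
qed

lemma finite_Z: "finite Z"
  using net finite_subset by (auto simp: net_def)

lemma lab_nonneg: "forest s \<Longrightarrow> lab s v \<ge> 0"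
  using grown_labels by (auto simp: forest_def)

lemma growing_attach:
  assumes g: "growing t B L s" and t: "t \<le> d" and p: "p \<in> active t" "reach r p u" "reach r p v"
    and uv: "adj u v" "lab s u > 0" "\<not> lab s v > 0"
    and s: "ints s ''u'' [] = int u" "ints s ''v'' [] = int v"
  shows "growing t B L (run attach_prg s)" "labelled (run attach_prg s) = insert v (labelled s)"
proof -
  let ?s = "run attach_prg s"
  have f: "forest s" using g by (simp add: growing_def)
  have v0: "lab s v = 0" using lab_nonneg[OF f, of v] uv by simp
  note a = run_attach_prg[OF f _ _ uv(2) v0 uv(1) s]
  have n: "u < n" "v < n" using adj_less uv by auto
  show "labelled ?s = insert v (labelled s)"
    unfolding labelled_def a(2)[OF n] using uv by auto
  have "static ?s" using g unfolding growing_def attach_prg_def by simp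
  moreover have "{p \<in> Z. lab s p > 0} \<subseteq> {p \<in> Z. lab ?s p > 0}"
    unfolding a(2)[OF n] using v0 by auto
  then have "card {p \<in> Z. lab s p > 0} \<le> card {p \<in> Z. lab ?s p > 0}"
    using finite_Z by (intro card_mono) auto
  moreover have "layer (active t) (cells t) r B L (lab ?s)"
    unfolding a(2)[OF n]
    by (rule layer_attach[OF _ cells_overlap[OF t] p uv(2) v0]) (use g in \<open>auto simp: growing_def\<close>)
  ultimately show "growing t B L ?s"
    using g a(1,3)[OF n] unfolding growing_def by simp
qed

definition saturated :: "nat \<Rightarrow> nat set \<Rightarrow> bool" where
  "saturated t S \<longleftrightarrow> (\<forall>p\<in>active t. \<forall>u\<in>S. \<forall>v. reach r p u \<and> reach r p v \<and> adj u v \<longrightarrow> v \<in> S)"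

text \<open>Progress is argued as in \<open>run_reach_round\<close>. A saturated state stays
  unchanged because any attachment would witness a violation of saturation.\<close>

lemma run_flood_round:
  assumes g: "growing t B L s" and t: "t \<le> d"
  shows "growing t B L (run (flood_round d t) s) \<and> labelled s \<subseteq> labelled (run (flood_round d t) s) \<and>
    (if saturated t (labelled s) then labelled (run (flood_round d t) s) = labelled s
     else labelled (run (flood_round d t) s) \<noteq> labelled s)"
proof -
  let ?A = "labelled s"
  define I where "I s' \<longleftrightarrow> growing t B L s' \<and> ?A \<subseteq> labelled s' \<and>
     (saturated t ?A \<longrightarrow> labelled s' = ?A)" for s'
  define Q where "Q p u v s' \<longleftrightarrow> (p \<in> active t \<and> u \<in> ?A \<and> reach r p u \<and> reach r p v \<and> adj u v \<longrightarrow>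
     v \<in> labelled s')" for p u v s'
  have idx: "I (write_int i [] y s) = I s" "Q p u v (write_int i [] y s) = Q p u v s"
    if "i \<in> {''p'', ''u'', ''v''}" for i y s p u v
    using that by (auto simp: I_def Q_def)
  have mono: "Q p u v s2" if "Q p u v s1" "labelled s1 \<subseteq> labelled s2" for p u v s1 s2
    using that unfolding Q_def by blast
  have n: "ints s' ''n'' [] = int n" if "I s'" for s'
    using that by (auto simp: I_def growing_def intro: static_n)
  let ?body = "When attach_test attach_prg"
  have step: "(I (run ?body s') \<and> p \<in> active t \<and> ints (run ?body s') ''p'' [] = int p \<and>
       ints (run ?body s') ''u'' [] = int u) \<and>
      labelled s' \<subseteq> labelled (run ?body s') \<and> Q p u v (run ?body s')"
    if uv: "u < n" "v < n" and s': "I s' \<and> p \<in> active t \<and> ints s' ''p'' [] = int p \<and>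
       ints s' ''u'' [] = int u" "ints s' ''v'' [] = int v" for p u v s'
  proof -
    have p: "p < n" using s' active_less by blast
    have st: "static s'" using s' by (simp add: I_def growing_def)
    then have "reached p s' = {v. reach r p v}" using p by (simp add: static_def)
    then have T: "w < n \<Longrightarrow> ints s' ''T'' [int p, int w] > 0 \<longleftrightarrow> reach r p w" for w
      by (auto simp: reached_def)
    have test: "bval attach_test s' \<longleftrightarrow>
        reach r p u \<and> reach r p v \<and> adj u v \<and> lab s' u > 0 \<and> \<not> lab s' v > 0"
      using s' uv T env_adj[of c r s' u v] st by (simp add: attach_test_def lab_def static_def)
    show ?thesis
    proof (cases "bval attach_test s'")
      case True
      then have h: "reach r p u" "reach r p v" "adj u v" "lab s' u > 0" "\<not> lab s' v > 0"
        using test by blast+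
      have g': "growing t B L (run attach_prg s')" "labelled (run attach_prg s') =
        insert v (labelled s')"
        using growing_attach[OF _ t _ h] s' by (auto simp: I_def)
      have "\<not> saturated t ?A"
      proof
        assume sat: "saturated t ?A"
        then have "labelled s' = ?A" using s' by (simp add: I_def)
        then have "u \<in> ?A" "v \<notin> ?A" using h by (auto simp: labelled_def)
        then show False using sat h s' unfolding saturated_def by blast
      qed
      then have "I (run attach_prg s')" using g' s' unfolding I_def by blast
      moreover have "ints (run attach_prg s') ''p'' = ints s' ''p''"
        "ints (run attach_prg s') ''u'' = ints s' ''u''" by (simp_all add: attach_prg_def)
      ultimately show ?thesis using True s' g' unfolding Q_def by auto
    next
      case False
      have "?A \<subseteq> labelled s'" using s' by (simp add: I_def)
      then have "Q p u v s'" using False test unfolding Q_def by (auto simp: labelled_def)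
      then show ?thesis using False s' by simp
    qed
  qed
  have inner: "(I (run (Loop ''v'' ?body) s') \<and> p \<in> active t \<and>
        ints (run (Loop ''v'' ?body) s') ''p'' [] = int p \<and>
        ints (run (Loop ''v'' ?body) s') ''u'' [] = int u) \<and>
      labelled s' \<subseteq> labelled (run (Loop ''v'' ?body) s') \<and>
      (\<forall>v<n. Q p u v (run (Loop ''v'' ?body) s'))"
    if u: "u < n" and s': "I s' \<and> p \<in> active t \<and> ints s' ''p'' [] = int p \<and> ints s' ''u'' [] =
      int u"
    for p u s'
  proof (rule run_each[where S = labelled and I = "\<lambda>s'. I s' \<and> p \<in> active t \<and>
      ints s' ''p'' [] = int p \<and> ints s' ''u'' [] = int u"])
    show "ints s' ''n'' [] = int n" using s' n by blast
    show "I s' \<and> p \<in> active t \<and> ints s' ''p'' [] = int p \<and> ints s' ''u'' [] = int u" by fact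
    show "(I (run ?body s') \<and> p \<in> active t \<and> ints (run ?body s') ''p'' [] = int p \<and>
       ints (run ?body s') ''u'' [] = int u) \<and>
      labelled s' \<subseteq> labelled (run ?body s') \<and> Q p u v (run ?body s')"
      if "v < n" "I s' \<and> p \<in> active t \<and> ints s' ''p'' [] = int p \<and>
       ints s' ''u'' [] = int u" "ints s' ''v'' [] = int v" for v s'
      using step[OF u that] .
    show "Q p u v s2" if "Q p u v s1" "labelled s1 \<subseteq> labelled s2" for v s1 s2 using mono that .
  qed (simp_all add: idx attach_prg_def)
  let ?uv = "Loop ''u'' (Loop ''v'' ?body)"
  have middle: "(I (run ?uv s') \<and> p \<in> active t \<and> ints (run ?uv s') ''p'' [] = int p) \<and>
      labelled s' \<subseteq> labelled (run ?uv s') \<and> (\<forall>u<n. \<forall>v<n. Q p u v (run ?uv s'))"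
    if s': "I s' \<and> p \<in> active t \<and> ints s' ''p'' [] = int p" for p s'
  proof (rule run_each[where S = labelled and I = "\<lambda>s'. I s' \<and> p \<in> active t \<and>
      ints s' ''p'' [] = int p"])
    show "ints s' ''n'' [] = int n" using s' n by blast
    show "I s' \<and> p \<in> active t \<and> ints s' ''p'' [] = int p" by fact
    show "(I (run (Loop ''v'' ?body) s') \<and> p \<in> active t \<and>
        ints (run (Loop ''v'' ?body) s') ''p'' [] = int p) \<and>
      labelled s' \<subseteq> labelled (run (Loop ''v'' ?body) s') \<and>
      (\<forall>v<n. Q p u v (run (Loop ''v'' ?body) s'))"
      if "u < n" "I s' \<and> p \<in> active t \<and> ints s' ''p'' [] = int p" "ints s' ''u'' [] =
        int u" for u s'
      using inner[of u s' p] that by blast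
    show "\<forall>v<n. Q p u v s2" if "\<forall>v<n. Q p u v s1" "labelled s1 \<subseteq> labelled s2" for u s1 s2
      using mono that by blast
  qed (simp_all add: idx attach_prg_def)
  have "I (run (flood_round d t) s) \<and> ?A \<subseteq> labelled (run (flood_round d t) s) \<and>
     (\<forall>p<n. \<forall>u<n. \<forall>v<n. Q p u v (run (flood_round d t) s))"
    unfolding flood_round_def
  proof (rule run_each[where S = labelled and I = I])
    show "I s" using g by (simp add: I_def)
    then show "ints s ''n'' [] = int n" by (rule n)
    show "\<forall>u<n. \<forall>v<n. Q p u v s2"
      if "\<forall>u<n. \<forall>v<n. Q p u v s1" "labelled s1 \<subseteq> labelled s2" for p s1 s2
      using mono that by blast
    fix p s' assume p: "p < n" "I s'" "ints s' ''p'' [] = int p"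
    have test: "bval (active_test d t ''p'') s' \<longleftrightarrow> p \<in> active t"
      using p by (intro bval_active_test) (auto simp: I_def growing_def)
    show "I (run (When (active_test d t ''p'') ?uv) s') \<and>
        labelled s' \<subseteq> labelled (run (When (active_test d t ''p'') ?uv) s') \<and>
        (\<forall>u<n. \<forall>v<n. Q p u v (run (When (active_test d t ''p'') ?uv) s'))"
    proof (cases "p \<in> active t")
      case True
      then have "run (When (active_test d t ''p'') ?uv) s' = run ?uv s'" using test by simp
      then show ?thesis using middle[of s' p] p True by metis
    next
      case False
      then have "run (When (active_test d t ''p'') ?uv) s' = s'" using test by simp
      then show ?thesis using p False by (simp add: Q_def)
    qed
  qed (simp_all add: idx attach_prg_def)
  then have I: "I (run (flood_round d t) s)" and
    Q: "\<And>p u v. p < n \<Longrightarrow> u < n \<Longrightarrow> v < n \<Longrightarrow> Q p u v (run (flood_round d t) s)" by blast+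
  have "labelled (run (flood_round d t) s) \<noteq> ?A" if ns: "\<not> saturated t ?A"
  proof -
    obtain p u v where "p \<in> active t" "u \<in> ?A" "v \<notin> ?A" "reach r p u" "reach r p v" "adj u v"
      using ns unfolding saturated_def by blast
    then have "v \<in> labelled (run (flood_round d t) s)"
      using Q[of p u v] active_less adj_less unfolding Q_def by blast
    then show ?thesis using \<open>v \<notin> ?A\<close> by blast
  qed
  then show ?thesis using I unfolding I_def by simp
qed

lemma run_flood:
  assumes g: "growing t B L s" and t: "t \<le> d"
  shows "growing t B L (run (Loop ''j'' (flood_round d t)) s) \<and>
    labelled s \<subseteq> labelled (run (Loop ''j'' (flood_round d t)) s) \<and>
    saturated t (labelled (run (Loop ''j'' (flood_round d t)) s))"
proof (rule run_closure[where I = "growing t B L" and S = labelled and stop = "saturated t"])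
  show "well_formed (Loop ''j'' (flood_round d t))"
    by (simp add: writes_flood_round well_formed_flood_round)
  show "ints s ''n'' [] = int n" using g by (auto simp: growing_def intro: static_n)
  show "growing t B L s" by fact
  show "labelled s' \<subseteq> {..<n}" for s' by (rule labelled_subset)
  show "saturated t (labelled s')" if "labelled s' = {..<n}" for s'
    using that adj_less by (auto simp: saturated_def)
  show "growing t B L (run (flood_round d t) s') \<and>
    labelled s' \<subseteq> labelled (run (flood_round d t) s') \<and>
    (if saturated t (labelled s') then labelled (run (flood_round d t) s') = labelled s'
     else labelled (run (flood_round d t) s') \<noteq> labelled s')" if "growing t B L s'" for s'
    using run_flood_round[OF that t] .
qed simp_all

end

section \<open>Splitting, output and the resulting diameter bound\<close>

definition split_prg :: prg where
  "split_prg = Loop ''q'' (When (BAnd (ILess (scalar ''num'') (scalar ''k'')) (positive (scalar ''cnt'')))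
     (Set ''cnt'' [] (ISub (scalar ''cnt'') (IConst 1)) ;;
      Set ''num'' [] (IAdd (scalar ''num'') (IConst 1)) ;;
      Set ''lab'' [entry ''ord'' ''cnt''] (scalar ''num'')))"

text \<open>Labels \<open>1, ..., k\<close> are shifted to cluster indices
  \<open>0, ..., k - 1\<close>. The last visited point of a cluster becomes its center; any member
  would do, as the analysis bounds the diameter.\<close>

definition output_prg :: prg where
  "output_prg = Loop ''v'' (
     Set ''cluster'' [scalar ''v''] (ISub (entry ''lab'' ''v'') (IConst 1)) ;;
     Set ''center'' [ISub (entry ''lab'' ''v'') (IConst 1)] (scalar ''v''))"

definition main_prg :: "nat \<Rightarrow> nat \<Rightarrow> prg" where
  "main_prg d c = coloring_prg d c ;; layers_prg d ;; split_prg ;; output_prg"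

lemma well_formed_layer_prg: "well_formed (layer_prg d t)"
  by (simp add: layer_prg_def well_formed_flood_round writes_flood_round)

lemma writes_layer_prg:
  "writes (layer_prg d t) = {''p'', ''u'', ''v'', ''lab'', ''ord'', ''cnt'', ''j'', ''q'', ''num''}"
  by (auto simp: layer_prg_def writes_flood_round)

context points_graph
begin

definition outcome :: "nat \<Rightarrow> real \<Rightarrow> state \<Rightarrow> bool" where
  "outcome k D s \<longleftrightarrow> (\<exists>l vs. grown n adj l (int k) vs \<and>
     (\<forall>v<n. l v > 0 \<and> ints s ''cluster'' [int v] = l v - 1) \<and>
     (\<forall>u<n. \<forall>v<n. l u = l v \<longrightarrow> near D u v) \<and>
     (\<forall>j<k. \<exists>w<n. l w = int j + 1 \<and> ints s ''center'' [int j] = int w))"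

lemma run_output_prg:
  assumes n: "ints s0 ''n'' [] = int n" and g: "grown n adj (lab s0) (int k) vs"
    and pos: "\<forall>v<n. lab s0 v > 0" and D: "\<forall>u<n. \<forall>v<n. lab s0 u = lab s0 v \<longrightarrow> near D u v"
  shows "outcome k D (run output_prg s0)"
proof -
  let ?s = "run output_prg s0"
  let ?Q = "\<lambda>v (s :: state). ints s ''cluster'' [int v] = lab s0 v - 1 \<and>
    (\<exists>w<n. lab s0 w = lab s0 v \<and> ints s ''center'' [lab s0 v - 1] = int w)"
  have "ints ?s ''lab'' = ints s0 ''lab'' \<and> (\<forall>v<n. ?Q v ?s)"
    unfolding output_prg_def
  proof (rule run_all[where Q = ?Q])
    show "ints s0 ''n'' [] = int n" by fact
    let ?b = "Set ''cluster'' [scalar ''v''] (ISub (entry ''lab'' ''v'') (IConst 1)) ;;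
     Set ''center'' [ISub (entry ''lab'' ''v'') (IConst 1)] (scalar ''v'')"
    fix v s assume v: "v < n" "ints s ''lab'' = ints s0 ''lab''" "ints s ''v'' [] = int v"
      and old: "\<forall>b<v. ?Q b s"
    have l: "ints s ''lab'' [int v] = lab s0 v" using v by (simp add: lab_def)
    have c: "ints (run ?b s) ''cluster'' = (ints s ''cluster'')([int v] := lab s0 v - 1)"
      "ints (run ?b s) ''center'' = (ints s ''center'')([lab s0 v - 1] := int v)"
      using v l by simp_all
    have "?Q b (run ?b s)" if "b \<le> v" for b
    proof (cases "b = v")
      case True
      then show ?thesis unfolding c using v by auto
    next
      case False
      then have "?Q b s" using old that by simp
      then show ?thesis unfolding c using v False by (cases "lab s0 b = lab s0 v") auto
    qed
    then show "ints (run ?b s) ''lab'' = ints s0 ''lab'' \<and> (\<forall>b\<le>v. ?Q b (run ?b s))"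
      using v by (simp add: ints_run)
  qed auto
  then have Q: "?Q v ?s" if "v < n" for v using that by blast
  have "\<exists>w<n. lab s0 w = int j + 1 \<and> ints ?s ''center'' [int j] = int w" if "j < k" for j
  proof -
    obtain v where "v < n" "lab s0 v =
      int j + 1" using grown_surj[OF g, of "int j + 1"] \<open>j < k\<close> by auto
    then show ?thesis using Q[of v] by auto
  qed
  then show ?thesis unfolding outcome_def using g pos Q D by blast
qed

text \<open>With all points labelled, clusters and leaves add up to \<open>n\<close>. So after
  \<open>n\<close> rounds either \<open>k\<close> clusters exist or no leaf is left, and in the
  latter case \<open>num = n \<ge> k\<close>.\<close>

lemma run_split_prg:
  assumes n: "ints s0 ''n'' [] = int n" and k: "ints s0 ''k'' [] = int k" "k \<le> n"
    and f: "forest s0" and m: "ints s0 ''num'' [] \<le> int k"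
    and pos: "\<forall>v<n. lab s0 v > 0" and D: "\<forall>u<n. \<forall>v<n. lab s0 u = lab s0 v \<longrightarrow> near D u v"
    and D0: "D \<ge> 0"
  defines "s1 \<equiv> run split_prg s0"
  shows "grown n adj (lab s1) (int k) (stack s1) \<and> (\<forall>v<n. lab s1 v > 0) \<and>
    (\<forall>u<n. \<forall>v<n. lab s1 u = lab s1 v \<longrightarrow> near D u v)"
proof -
  let ?I = "\<lambda>s. forest s \<and> ints s ''k'' [] = int k \<and> ints s ''num'' [] \<le> int k \<and>
    (\<forall>v<n. lab s v > 0) \<and>
    (\<forall>u<n. \<forall>v<n. lab s u = lab s v \<longrightarrow> near D u v)"
  let ?b = "When (BAnd (ILess (scalar ''num'') (scalar ''k'')) (positive (scalar ''cnt'')))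
     (Set ''cnt'' [] (ISub (scalar ''cnt'') (IConst 1)) ;;
      Set ''num'' [] (IAdd (scalar ''num'') (IConst 1)) ;;
      Set ''lab'' [entry ''ord'' ''cnt''] (scalar ''num''))"
  have full: "ints s ''num'' [] + ints s ''cnt'' [] = int n" if "?I s" for s
  proof -
    have "{v. v < n \<and> lab s v > 0} = {..<n}" using that by auto
    then show ?thesis using that grown_card[of n adj "lab s" "ints s ''num'' []" "stack s"]
      by (auto simp: forest_def stack_def)
  qed
  have "?I s1 \<and> (ints s1 ''num'' [] = int k \<or> ints s1 ''cnt'' [] \<le> int n - int n)"
    unfolding s1_def split_prg_def
  proof (rule run_Loop[where I = "\<lambda>j s. ?I s \<and> (ints s ''num'' [] = int k \<or>
    ints s ''cnt'' [] \<le> int n - int j)"])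
    show "ints s0 ''n'' [] = int n" by fact
    have "ints s0 ''num'' [] \<ge> 0" using f grown_labels unfolding forest_def by blast
    moreover have "?I s0" using assms by blast
    ultimately show "?I s0 \<and> (ints s0 ''num'' [] = int k \<or> ints s0 ''cnt'' [] \<le> int n - int 0)"
      using full[of s0] by auto
  next
    fix j s assume j: "j < n" and I: "?I s \<and> (ints s ''num'' [] = int k \<or>
      ints s ''cnt'' [] \<le> int n - int j)"
    show "?I (run ?b s) \<and> (ints (run ?b s) ''num'' [] = int k \<or>
      ints (run ?b s) ''cnt'' [] \<le> int n - int (Suc j))"
    proof (cases "ints s ''num'' [] < int k \<and> ints s ''cnt'' [] > 0")
      case True
      then obtain i where i: "ints s ''cnt'' [] =
        int (Suc i)" by (metis gr0_implies_Suc zero_less_imp_eq_int)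
      define v where "v = nat (ints s ''ord'' [int i])"
      have ord: "ints s ''ord'' [int i] = int v" using I i unfolding forest_def v_def by simp
      have stk: "stack s = v # stack (write_int ''cnt'' [] (int i) s)"
        using i by (simp add: stack_def v_def del: of_nat_Suc)
      have "grown n adj (lab s) (ints s ''num'' []) (v # stack (write_int ''cnt'' [] (int i) s))"
        using I stk by (simp add: forest_def)
      note g = grown_split[OF this] grown_pop[OF this HOL.refl]
      have lm: "lab s u \<le> ints s ''num'' []" for u
        using I grown_labels unfolding forest_def by blast
      define s' where "s' = run ?b s"
      have s': "lab s' = (lab s)(v := ints s ''num'' [] + 1)" "ints s' ''cnt'' [] = int i"
        "ints s' ''num'' [] = ints s ''num'' [] + 1" "ints s' ''ord'' = ints s ''ord''"
        "ints s' ''k'' = ints s ''k''"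
        using True I i ord g(2) unfolding s'_def by (simp_all add: lab_update)
      have "stack s' = stack (write_int ''cnt'' [] (int i) s)"
        using s' by (simp add: stack_def)
      then have "grown n adj (lab s') (ints s' ''num'' []) (stack s')"
        unfolding s'(1,3) using g(1) by simp
      then have "forest s'" using s' I i by (auto simp: forest_def)
      \<comment> \<open>The new label exceeds all old ones, so the split refines the partition and
        cannot increase a diameter.\<close>
      moreover have "near D u w" if uw: "u < n" "w < n" "lab s' u = lab s' w" for u w
      proof -
        have "u = w \<or> lab s u = lab s w"
          using uw(3) lm[of u] lm[of w] unfolding s'(1) by (auto split: if_splits)
        then show ?thesis using I near_refl[OF D0] uw by blast
      qed
      moreover have "lab s' u > 0" if "u < n" for u
        using I that lm[of u] unfolding s'(1) by auto
      moreover have "ints s' ''k'' [] = int k" "ints s' ''num'' [] \<le> int k"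
        "ints s' ''cnt'' [] \<le> int n - int (Suc j) \<or> ints s' ''num'' [] = int k"
        using I True i unfolding s' by auto
      ultimately show ?thesis unfolding s'_def[symmetric] by blast
    next
      case False
      then have "run ?b s = s" using I by auto
      then show ?thesis using I False j by auto
    qed
  qed simp_all
  then have I: "?I s1" and e: "ints s1 ''num'' [] = int k \<or> ints s1 ''cnt'' [] \<le> 0" by simp_all
  have "ints s1 ''num'' [] = int k" using e full[OF I] I k(2) by (auto simp: forest_def)
  then show ?thesis using I by (simp add: forest_def)
qed

lemma rooted_near:
  assumes "rooted B l" "l u = l v" "l v > 0"
  shows "near (2 * B) u v"
proof -
  obtain rt where rt: "\<forall>v. l v > 0 \<longrightarrow> near B v (rt (l v))" using assms by (auto simp: rooted_def)
  have "near B u (rt (l v))" "near B v (rt (l v))" using rt assms by (metis, metis)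
  from near_trans[OF this(1) near_sym[OF this(2)]] have "near (B + B) u v" .
  then show ?thesis by (simp only: mult_2)
qed

end

context layered
begin

lemma growing_root:
  assumes g: "growing t B L s" and B: "B \<ge> 0" and p: "p \<in> active t" "\<not> lab s p > 0"
    and s: "ints s ''q'' [] = int p"
  defines "s' \<equiv> run (Set ''num'' [] (IAdd (scalar ''num'') (IConst 1)) ;;
        Set ''lab'' [scalar ''q''] (scalar ''num'')) s"
  shows "growing t B L s'" "labelled s' = insert p (labelled s)"
proof -
  have f: "forest s" using g by (simp add: growing_def)
  have m: "ints s ''num'' [] \<ge> 0" using f grown_labels unfolding forest_def by blast
  have p0: "lab s p = 0" using lab_nonneg[OF f, of p] p by simp
  have n: "p < n" using active_less p by blast
  have s': "lab s' = (lab s)(p := ints s ''num'' [] + 1)" "ints s' ''cnt'' = ints s ''cnt''"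
    "ints s' ''num'' [] = ints s ''num'' [] + 1" "ints s' ''ord'' = ints s ''ord''"
    using s n unfolding s'_def by (simp_all add: lab_update)
  show "labelled s' = insert p (labelled s)"
    unfolding labelled_def s' using m by auto
  have "static s'" using g unfolding growing_def s'_def by simp
  moreover have "stack s' = stack s" using s' by (simp add: stack_def)
  moreover have "grown n adj (lab s') (ints s' ''num'' []) (stack s)"
    unfolding s' using f n p0 by (auto simp: forest_def intro: grown.root)
  ultimately have st: "static s'" "forest s'" using f s' by (simp_all add: forest_def)
  have "{q \<in> Z. lab s' q > 0} = insert p {q \<in> Z. lab s q > 0}"
    unfolding s' using m p by (auto simp: active_def)
  then have "card {q \<in> Z. lab s' q > 0} = Suc (card {q \<in> Z. lab s q > 0})"
    using finite_Z p0 by simp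
  moreover have "layer (active t) (cells t) r B L (lab s')"
    unfolding s' using g f by (intro layer_root[of _ _ _ _ _ _ _ "stack s"] p(1) n p0 B)
      (auto simp: growing_def forest_def)
  ultimately show "growing t B L s'" using g st s' unfolding growing_def by simp
qed

text \<open>Every path that witnesses \<open>reach\<close> stays in the region of \<open>p\<close>,
  so saturation passes membership along it from \<open>p\<close> on.\<close>

lemma saturated_reach:
  assumes "saturated t S" "p \<in> active t" "p \<in> S"
  shows "reach r p v \<Longrightarrow> v \<in> S"
proof (induction rule: reach.induct)
  case (step u v)
  then show ?case using assms reach.step[OF step.hyps] unfolding saturated_def by blast
qed (rule assms)

text \<open>State before layer \<open>t\<close>: each completed layer has cost
  \<open>width + 2 * r\<close>, and the regions of all centers active so far are fully
  labelled.\<close>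

definition grown_layers :: "nat \<Rightarrow> state \<Rightarrow> bool" where
  "grown_layers t s \<longleftrightarrow> static s \<and> forest s \<and>
     ints s ''num'' [] \<le> int (card {p \<in> Z. lab s p > 0}) \<and>
     rooted (real t * (width + 2 * r)) (lab s) \<and>
     (\<forall>t'<t. \<forall>p\<in>active t'. \<forall>v. reach r p v \<longrightarrow> lab s v > 0)"

lemma width_nonneg: "width \<ge> 0"
  using r by (simp add: width_def)

lemma run_layer_prg:
  assumes g: "grown_layers t s0" and t: "t \<le> d"
  shows "grown_layers (Suc t) (run (layer_prg d t) s0)"
proof -
  let ?B = "real t * (width + 2 * r)" and ?L = "lab s0"
  let ?flood = "Loop ''j'' (flood_round d t)"
  have B: "?B \<ge> 0" using width_nonneg r by simp
  have g0: "growing t ?B ?L s0" using g by (auto simp: grown_layers_def growing_def intro!: layer_start)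
  let ?new = "Set ''num'' [] (IAdd (scalar ''num'') (IConst 1)) ;;
        Set ''lab'' [scalar ''q''] (scalar ''num'')"
  let ?g = "BAnd (active_test d t ''q'') (BNot (positive (entry ''lab'' ''q'')))"
  let ?b = "When ?g (Set ''num'' [] (IAdd (scalar ''num'') (IConst 1)) ;;
        Set ''lab'' [scalar ''q''] (scalar ''num'') ;; ?flood)"
  let ?I = "\<lambda>s. growing t ?B ?L s \<and> saturated t (labelled s)"
  define s1 where "s1 = run ?flood s0"
  have s1: "?I s1" using run_flood[OF g0 t] unfolding s1_def by blast
  define s2 where "s2 = run (Loop ''q'' ?b) s1"
  have "?I s2 \<and> labelled s1 \<subseteq> labelled s2 \<and> (\<forall>p<n. p \<in> active t \<longrightarrow> p \<in> labelled s2)"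
    unfolding s2_def
  proof (rule run_each[where I = ?I and S = labelled])
    show "?I s1" by (rule s1)
    show "ints s1 ''n'' [] = int n" using s1 by (auto simp: growing_def intro: static_n)
    show "well_formed (Loop ''q'' ?b)" by (simp add: well_formed_flood_round writes_flood_round)
    fix p s assume p: "p < n" and s: "?I s" "ints s ''q'' [] = int p"
    have "bval (active_test d t ''q'') s \<longleftrightarrow> p \<in> active t"
      using p s by (intro bval_active_test) (auto simp: growing_def)
    then have test: "bval ?g s \<longleftrightarrow> p \<in> active t \<and> \<not> lab s p > 0"
      using p s by (simp add: lab_def)
    show "?I (run ?b s) \<and> labelled s \<subseteq> labelled (run ?b s) \<and> (p \<in> active t \<longrightarrow>
      p \<in> labelled (run ?b s))"
    proof (cases "bval ?g s")
      case True
      define s' where "s' = run ?new s"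
      have s': "growing t ?B ?L s'" "labelled s' = insert p (labelled s)"
        using growing_root[OF conjunct1[OF s(1)] B _ _ s(2)] True test unfolding s'_def by blast+
      have "run ?b s = run ?flood s'" using True unfolding s'_def by simp
      then show ?thesis using run_flood[OF s'(1) t] s'(2) by auto
    next
      case False
      then have "run ?b s = s" by (simp del: bval.simps)
      then show ?thesis using s False test by (auto simp: labelled_def)
    qed
  next
    show "p \<in> active t \<longrightarrow> p \<in> labelled s2"
      if "p \<in> active t \<longrightarrow> p \<in> labelled s1" "labelled s1 \<subseteq> labelled s2" for p s1 s2
      using that by blast
  qed simp_all
  then have s2: "growing t ?B ?L s2" "saturated t (labelled s2)" "\<forall>p\<in>active t. p \<in> labelled s2"
    using active_less by blast+
  have "rooted (?B + (width + 2 * r)) (lab s2)"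
    by (rule layer_end[where A = "active t" and C = "cells t" and L = ?L])
      (use s2 r width_nonneg cells(2)[OF t] in \<open>auto simp: growing_def\<close>)
  then have "rooted (real (Suc t) * (width + 2 * r)) (lab s2)" by (simp add: algebra_simps)
  moreover have "lab s2 v > 0" if "t' < Suc t" "p \<in> active t'" "reach r p v" for t' p v
  proof (cases "t' = t")
    case True
    then show ?thesis using saturated_reach[OF s2(2) _ _ that(3)] s2(3) that by (auto simp: labelled_def)
  next
    case False
    then have "t' < t" using that by simp
    then have "?L v > 0" using g that unfolding grown_layers_def by blast
    then show ?thesis using s2(1) by (auto simp: growing_def layer_def)
  qed
  ultimately have "grown_layers (Suc t) s2"
    using s2(1) unfolding grown_layers_def growing_def by blast
  moreover have "run (layer_prg d t) s0 = s2"
    unfolding layer_prg_def s1_def s2_def by (simp only: run.simps(3))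
  ultimately show ?thesis by simp
qed

text \<open>Twice the distance to the root after all \<open>d + 1\<close> layers, which evaluates to
  \<open>4(d+1)(d+2)r\<close>.\<close>

definition spread :: real where
  "spread = 2 * (real (Suc d) * (width + 2 * r))"

lemma run_layers_prg:
  assumes s0: "static s0"
  defines "s1 \<equiv> run (layers_prg d) s0"
  shows "forest s1 \<and> ints s1 ''num'' [] \<le> int (card Z) \<and> (\<forall>v<n. lab s1 v > 0) \<and>
    (\<forall>u<n. \<forall>v<n. lab s1 u = lab s1 v \<longrightarrow> near spread u v)"
proof -
  let ?clear = "Loop ''v'' (Set ''lab'' [scalar ''v''] (IConst 0))"
  define s2 where "s2 = run ?clear s0"
  have s2: "static s2 \<and> (\<forall>v<n. ints s2 ''lab'' [int v] = 0)"
    unfolding s2_def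
  proof (rule run_all)
    show "ints s0 ''n'' [] = int n" using s0 by (rule static_n)
    show "static s0" by fact
  qed auto
  define s3 where "s3 = run (Set ''num'' [] (IConst 0) ;; Set ''cnt'' [] (IConst 0)) s2"
  have l: "lab s3 = (\<lambda>_. 0)" using s2 by (auto simp: s3_def lab_def)
  have "grown_layers 0 s3"
    unfolding grown_layers_def forest_def l
    using s2 by (auto simp: s3_def stack_def rooted_def intro: grown.empty)
  then have "grown_layers (Suc d) (run (unroll (Suc d) (layer_prg d)) s3)"
    by (rule run_unroll) (rule run_layer_prg, auto)
  moreover have "s1 = run (unroll (Suc d) (layer_prg d)) s3"
    unfolding s1_def layers_prg_def s2_def s3_def by (simp only: run.simps(3))
  ultimately have g: "grown_layers (Suc d) s1" by simp
  have pos: "lab s1 v > 0" if "v < n" for v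
  proof -
    \<comment> \<open>All points end up labelled because the net covers \<open>v\<close> and the
      covering center is active in some layer.\<close>
    obtain p where p: "p \<in> Z" "reach r p v" using net \<open>v < n\<close> unfolding net_def by blast
    obtain t where "t \<le> d" "\<forall>i<d. \<tau> i p \<noteq> t" using exists_good_layer[of "\<lambda>i. \<tau> i p"] by blast
    then have "t < Suc d" "p \<in> active t" using p by (auto simp: active_def)
    then show ?thesis using g p unfolding grown_layers_def by blast
  qed
  moreover have "card {p \<in> Z. lab s1 p > 0} \<le> card Z" using finite_Z by (intro card_mono) auto
  moreover have "near spread u v" if "u < n" "v < n" "lab s1 u = lab s1 v" for u v
    unfolding spread_def
  proof (rule rooted_near[where l = "lab s1"])
    show "rooted (real (Suc d) * (width + 2 * r)) (lab s1)" using g unfolding grown_layers_def by blast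
  qed (use pos that in auto)
  moreover have "forest s1" "ints s1 ''num'' [] \<le> int (card {p \<in> Z. lab s1 p > 0})"
    using g unfolding grown_layers_def by blast+
  ultimately show ?thesis by (smt (verit) of_nat_mono)
qed

end

context points_graph
begin

lemma run_main_prg:
  assumes s0: "env c r s0" "ints s0 ''k'' [] = int k" and r: "r \<ge> 0" and k: "k \<le> n" "card Z \<le> k"
    and T: "\<forall>q<n. reached q s0 = {v. reach r q v}" and Z: "centers_below n s0 = Z" "net r Z"
  shows "outcome k (4 * (real d + 1) * (real d + 2) * r) (run (main_prg d c) s0)"
proof -
  define s1 where "s1 = run (coloring_prg d c) s0"
  define \<tau> where "\<tau> = color s1"
  have s1: "colored (2 * r) \<tau>" "\<forall>i<d. \<forall>v<n. ints s1 ''tau'' [int i, int v] = int (\<tau> i v)"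
    using run_coloring_prg[OF s0(1) r] by (simp_all add: \<tau>_def color_def s1_def)
  interpret layered n d adj X c r Z \<tau>
    by unfold_locales (use r Z s1 in auto)
  have fr: "ints s1 a = ints s0 a" if "a \<notin> {''v'', ''u'', ''j'', ''P'', ''tau''}" for a
    using that unfolding s1_def
    by (intro ints_run) (auto simp: coloring_prg_def left_ends_prg_def levels_prg_def)
  have "env c r s1" using s0(1) env_cong[of s1 s0] fr by (simp add: s1_def)
  moreover have "reached q s1 = reached q s0" for q using fr by (simp add: reached_def)
  moreover have "centers_below n s1 = centers_below n s0" using fr by (simp add: centers_below_def)
  ultimately have st: "static s1" using T Z s1 by (simp add: static_def)
  define s2 where "s2 = run (layers_prg d) s1"
  have s2: "forest s2" "ints s2 ''num'' [] \<le> int k" "\<forall>v<n. lab s2 v > 0"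
    "\<forall>u<n. \<forall>v<n. lab s2 u = lab s2 v \<longrightarrow> near spread u v"
  proof -
    have *: "forest s2 \<and> ints s2 ''num'' [] \<le> int (card Z) \<and> (\<forall>v<n. lab s2 v > 0) \<and>
      (\<forall>u<n. \<forall>v<n. lab s2 u = lab s2 v \<longrightarrow> near spread u v)"
      using run_layers_prg[OF st] unfolding s2_def .
    then show "forest s2" "\<forall>v<n. lab s2 v > 0"
      "\<forall>u<n. \<forall>v<n. lab s2 u = lab s2 v \<longrightarrow> near spread u v" by blast+
    show "ints s2 ''num'' [] \<le> int k" using * k(2) by linarith
  qed
  have fr2: "ints s2 a = ints s1 a" if "a \<in> {''n'', ''k''}" for a
    using that unfolding s2_def by (intro ints_run) (auto simp: layers_prg_def writes_layer_prg)
  have n: "ints s2 ''n'' [] = int n" "ints s2 ''k'' [] = int k"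
    using fr2 fr s0 static_n[OF st] by simp_all
  have "spread \<ge> 0" using width_nonneg r by (simp add: spread_def)
  note s3 = run_split_prg[OF n k(1) s2 this]
  define s3 where "s3 = run split_prg s2"
  have "ints s3 ''n'' [] = int n" using n by (simp add: s3_def split_prg_def ints_run)
  then have "outcome k spread (run output_prg s3)"
    using s3 unfolding s3_def[symmetric] by (intro run_output_prg[of _ k "stack s3"]) blast+
  moreover have "run (main_prg d c) s0 = run output_prg s3"
    by (simp add: main_prg_def s1_def s2_def s3_def)
  moreover have "spread = 4 * (real d + 1) * (real d + 2) * r"
    by (simp add: spread_def width_def algebra_simps)
  ultimately show ?thesis by simp
qed

end

section \<open>Searching for the radius\<close>

text \<open>The record is kept as two point indices and a coordinate index, since no real number may
  be stored.\<close>

definition best_radius :: rexp where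
  "best_radius = RSub (RRead ''x'' [scalar ''ba'', scalar ''bc'']) (RRead ''x'' [scalar ''bb'', scalar ''bc''])"

text \<open>Only a strictly better radius with at most \<open>k\<close> centers gets as far as
  \<open>main_prg\<close>, so the output arrays always belong to the recorded radius and failed
  attempts leave them alone.\<close>

definition candidate_prg :: "nat \<Rightarrow> nat \<Rightarrow> prg" where
  "candidate_prg d c = When (BAnd (BNot (RLess (radius c) (RConst 0)))
       (BNot (BAnd (positive (scalar ''found'')) (BNot (RLess (radius c) best_radius)))))
     (reach_prg d c ;; net_prg ;;
      When (BNot (ILess (scalar ''k'') (scalar ''m'')))
        (Set ''found'' [] (IConst 1) ;; Set ''ba'' [] (scalar ''a'') ;; Set ''bb'' [] (scalar ''b'') ;;
         Set ''bc'' [] (IConst (int c)) ;; main_prg d c))"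

definition cluster_prg :: "nat \<Rightarrow> prg" where
  "cluster_prg d = Loop ''a'' (Loop ''b'' (unroll d (candidate_prg d)))"

lemma writes_reach_prg: "writes (reach_prg d c) = {''p'', ''v'', ''T'', ''j'', ''u''}"
  by (auto simp: reach_prg_def reach_round_def)

lemma writes_net_prg: "writes net_prg = {''v'', ''g'', ''m'', ''p'', ''isc''}"
  by (auto simp: net_prg_def)

lemma writes_main_prg: "writes (main_prg d c) \<subseteq>
  {''v'', ''P'', ''u'', ''tau'', ''j'', ''lab'', ''num'', ''cnt'', ''p'', ''ord'', ''q'', ''cluster'', ''center''}"
  by (simp add: main_prg_def coloring_prg_def left_ends_prg_def levels_prg_def layers_prg_def
      writes_layer_prg split_prg_def output_prg_def UN_subset_iff)

lemma writes_candidate_prg: "writes (candidate_prg d c) \<subseteq>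
  {''v'', ''P'', ''u'', ''tau'', ''j'', ''lab'', ''num'', ''cnt'', ''p'', ''ord'', ''q'', ''cluster'', ''center'',
   ''T'', ''g'', ''m'', ''isc'', ''found'', ''ba'', ''bb'', ''bc''}"
  (is "_ \<subseteq> ?W")
  using order_trans[OF writes_main_prg[of d c], of ?W]
  by (simp add: candidate_prg_def writes_reach_prg writes_net_prg)

lemma well_formed_main_prg: "well_formed (main_prg d c)"
proof -
  have "well_formed (coloring_prg d c)" "''n'' \<notin> writes (coloring_prg d c)"
    unfolding coloring_prg_def
    by (rule well_formed_unroll) (simp_all add: left_ends_prg_def levels_prg_def)
  moreover have "well_formed (unroll (Suc d) (layer_prg d))"
    by (rule well_formed_unroll) (simp add: well_formed_layer_prg writes_layer_prg)
  then have "well_formed (layers_prg d)" "''n'' \<notin> writes (layers_prg d)"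
    by (simp_all add: layers_prg_def writes_layer_prg del: unroll.simps)
  ultimately show ?thesis by (simp add: main_prg_def split_prg_def output_prg_def)
qed

lemma well_formed_candidate_prg: "well_formed (candidate_prg d c)"
  by (simp add: candidate_prg_def well_formed_main_prg writes_reach_prg writes_net_prg)
    (simp add: reach_prg_def reach_round_def net_prg_def)

lemma not_in_writes_candidate_prg:
  "a \<in> {''n'', ''a'', ''b''} \<Longrightarrow> a \<notin> writes (candidate_prg d c)"
  using subsetD[OF writes_candidate_prg[of d c], of a] by auto

lemma well_formed_cluster_prg: "well_formed (cluster_prg d)"
  using well_formed_unroll[of d "candidate_prg d"]
  by (simp add: cluster_prg_def not_in_writes_candidate_prg well_formed_candidate_prg)

locale clustering_problem = points_graph +
  fixes k :: nat
  assumes k_le: "k \<le> n"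
begin

definition stretch :: real where
  "stretch = 4 * (real d + 1) * (real d + 2)"

definition found_best :: "state \<Rightarrow> bool" where
  "found_best s \<longleftrightarrow> input s \<and> ints s ''k'' [] = int k \<and>
     (ints s ''found'' [] > 0 \<longrightarrow> rval best_radius s \<ge> 0 \<and> outcome k (stretch * rval best_radius s) s)"

text \<open>Stated for a single \<open>R\<close> so that it can be collected candidate by candidate;
  it persists because the recorded radius only decreases.\<close>

definition beats :: "state \<Rightarrow> real \<Rightarrow> bool" where
  "beats s R \<longleftrightarrow> (coverable k R \<and> R \<ge> 0 \<longrightarrow> ints s ''found'' [] > 0 \<and> rval best_radius s \<le> R)"

lemma found_best_cong:
  assumes "ints s' ''n'' = ints s ''n''" "ints s' ''k'' = ints s ''k''" "ints s' ''adj'' =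
    ints s ''adj''"
    "ints s' ''found'' = ints s ''found''" "ints s' ''ba'' = ints s ''ba''"
    "ints s' ''bb'' = ints s ''bb''" "ints s' ''bc'' = ints s ''bc''"
    "ints s' ''cluster'' = ints s ''cluster''" "ints s' ''center'' = ints s ''center''"
    "reals s' = reals s"
  shows "found_best s' = found_best s" "beats s' R = beats s R"
  using assms by (simp_all add: found_best_def beats_def input_def outcome_def best_radius_def)

lemma run_candidate_prg:
  fixes c :: nat
  assumes s: "found_best s"
  defines "s' \<equiv> run (candidate_prg d c) s"
  shows "found_best s' \<and> (\<forall>R. beats s R \<longrightarrow> beats s' R) \<and> beats s' (rval (radius c) s)"
proof -
  define r where "r = rval (radius c) s"
  let ?g = "BAnd (BNot (RLess (radius c) (RConst 0)))
       (BNot (BAnd (positive (scalar ''found'')) (BNot (RLess (radius c) best_radius))))"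
  let ?set = "Set ''found'' [] (IConst 1) ;; Set ''ba'' [] (scalar ''a'') ;;
    Set ''bb'' [] (scalar ''b'') ;;
         Set ''bc'' [] (IConst (int c))"
  have g: "bval ?g s \<longleftrightarrow> r \<ge> 0 \<and> (ints s ''found'' [] > 0 \<longrightarrow> r < rval best_radius s)"
    by (auto simp: r_def)
  show ?thesis
  proof (cases "bval ?g s")
    case False
    then have "s' = s" unfolding s'_def candidate_prg_def by (simp del: bval.simps)
    then show ?thesis using s False g by (auto simp: beats_def r_def[symmetric])
  next
    case True
    then have r: "r \<ge> 0" and better: "ints s ''found'' [] > 0 \<longrightarrow> r < rval best_radius s"
      using g by blast+
    define s1 where "s1 = run (reach_prg d c) s"
    define s2 where "s2 = run net_prg s1"
    have env: "env c r s" using s by (simp add: found_best_def env_def r_def)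
    have e1: "env c r s1" using env by (simp add: s1_def env_run writes_reach_prg)
    have e2: "env c r s2" using e1 by (simp add: s2_def env_run writes_net_prg)
    have fr: "ints s2 a = ints s a"
      if "a \<notin> {''p'', ''v'', ''T'', ''j'', ''u'', ''g'', ''m'', ''isc''}" for a
      using that by (simp add: s1_def s2_def ints_run writes_reach_prg writes_net_prg)
    have T1: "\<forall>q<n. reached q s1 = {v. reach r q v}"
      using run_reach_prg[OF env r] by (simp add: s1_def)
    define Z where "Z = centers_below n s2"
    have Z: "net r Z" "ints s2 ''m'' [] = int (card Z)"
      using run_net_prg[OF env_n[OF e1] T1] by (simp_all add: Z_def s2_def)
    have "ints s2 ''T'' = ints s1 ''T''" by (simp add: s2_def ints_run writes_net_prg)
    then have T2: "\<forall>q<n. reached q s2 = {v. reach r q v}" using T1 by (simp add: reached_def)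
    have k: "ints s2 ''k'' [] = int k" using fr s by (simp add: found_best_def)
    have "reals s2 = reals s" by (simp add: s1_def s2_def)
    then have same: "found_best s2" "beats s2 R = beats s R" for R
      using found_best_cong[of s2 s] fr s by simp_all
    let ?t = "BNot (ILess (scalar ''k'') (scalar ''m''))"
    have t: "bval ?t s2 \<longleftrightarrow> card Z \<le> k" using k Z by (simp add: not_less)
    have s': "s' = run (When ?t (Set ''found'' [] (IConst 1) ;; Set ''ba'' [] (scalar ''a'') ;;
        Set ''bb'' [] (scalar ''b'') ;; Set ''bc'' [] (IConst (int c)) ;; main_prg d c)) s2"
      unfolding s'_def candidate_prg_def s1_def s2_def using True
      by (simp only: run.simps(3,4) if_True)
    show ?thesis
    proof (cases "card Z \<le> k")
      case False
      then have "s' = s2" unfolding s' using t by (simp del: bval.simps)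
      \<comment> \<open>Too many centers refute the radius, so skipping it loses nothing.\<close>
      moreover have "\<not> coverable k r" using card_net[OF Z(1)] False by blast
      ultimately show ?thesis using same by (simp add: beats_def[of _ r] r_def[symmetric])
    next
      case le: True
      define s3 where "s3 = run ?set s2"
      have w: "writes (main_prg d c) \<inter> {''n'', ''adj'', ''a'', ''b''} = {}"
        using writes_main_prg[of d c] by auto
      have "env c r s3" "ints s3 ''k'' [] = int k" "reached q s3 = reached q s2"
        "centers_below n s3 = Z" for q
        using e2 k by (simp_all add: s3_def Z_def)
      moreover have main: "s' = run (main_prg d c) s3"
        unfolding s' s3_def using t le by (simp only: run.simps(3,4) if_True)
      ultimately have out: "outcome k (stretch * r) s'" and env': "env c r s'"
        using run_main_prg[of c r s3 k Z] r k_le le T2 Z(1) w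
        by (auto simp: stretch_def env_run)
      have fr': "ints s' a = ints s3 a" if "a \<in> {''k'', ''found'', ''ba'', ''bb'', ''bc'', ''a'', ''b''}" for a
        using that writes_main_prg[of d c] unfolding main by (intro ints_run) auto
      have f: "ints s' ''found'' [] = 1" "ints s' ''k'' [] = int k"
        using fr' k by (simp_all add: s3_def)
      have "rval best_radius s' = rval (radius c) s'"
        using fr' by (simp add: best_radius_def radius_def coord_def s3_def)
      then have b: "rval best_radius s' = r" using env' by (simp add: env_def)
      have "found_best s'" using out env' f b r by (simp add: found_best_def env_def)
      moreover have "beats s' R" if "beats s R" for R
        using that better f b unfolding beats_def by auto
      moreover have "beats s' r" using f b by (simp add: beats_def)
      ultimately show ?thesis by (simp add: r_def[symmetric])
    qed
  qed
qed

lemma run_cluster_prg: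
  assumes s0: "found_best s0"
  defines "s1 \<equiv> run (cluster_prg d) s0"
  shows "found_best s1 \<and> (\<forall>a<n. \<forall>b<n. \<forall>c<d. beats s1 (X a c - X b c))"
proof -
  let ?coords = "unroll d (candidate_prg d)"
  have fb: "found_best (write_int i [] y s) = found_best s" "beats (write_int i [] y s) R =
    beats s R"
    if "i \<in> {''a'', ''b''}" for i y s R
    by (rule found_best_cong; use that in auto)+
  have n: "ints s ''n'' [] = int n" if "found_best s" for s
    using that by (simp add: found_best_def input_def)
  have w: "''a'' \<notin> writes (candidate_prg d c)" "''b'' \<notin> writes (candidate_prg d c)" for c
    by (simp_all add: not_in_writes_candidate_prg)
  have wf: "well_formed (Loop ''a'' (Loop ''b'' ?coords))"
    using well_formed_cluster_prg by (simp add: cluster_prg_def)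
  have step: "found_best (run ?coords s) \<and> (\<forall>R. beats s R \<longrightarrow> beats (run ?coords s) R) \<and>
      (\<forall>c<d. beats (run ?coords s) (X a c - X b c))"
    if s: "found_best s" and ab: "a < n" "b < n" "ints s ''a'' [] = int a" "ints s ''b'' [] =
      int b" for s a b
  proof -
    let ?I = "\<lambda>j s'. found_best s' \<and> ints s' ''a'' [] = int a \<and> ints s' ''b'' [] = int b \<and>
      (\<forall>R. beats s R \<longrightarrow> beats s' R) \<and> (\<forall>c<j. beats s' (X a c - X b c))"
    have "?I d (run ?coords s)"
    proof (rule run_unroll[where I = ?I])
      show "?I 0 s" using s ab by simp
      fix c s' assume c: "c < d" and I: "?I c s'"
      have "rval (radius c) s' = X a c - X b c"
        using I c ab by (simp add: found_best_def input_def radius_def coord_def)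
      moreover have "ints (run (candidate_prg d c) s') ''a'' = ints s' ''a''"
        "ints (run (candidate_prg d c) s') ''b'' = ints s' ''b''" by (simp_all add: ints_run w)
      ultimately show "?I (Suc c) (run (candidate_prg d c) s')"
        using run_candidate_prg[of s' c] I by (simp add: less_Suc_eq)
    qed
    then show ?thesis by blast
  qed
  have inner: "(found_best (run (Loop ''b'' ?coords) s) \<and>
    ints (run (Loop ''b'' ?coords) s) ''a'' [] = int a \<and>
        (\<forall>R. beats s R \<longrightarrow> beats (run (Loop ''b'' ?coords) s) R)) \<and>
      (\<forall>b<n. \<forall>c<d. beats (run (Loop ''b'' ?coords) s) (X a c - X b c))"
    if s: "found_best s" and a: "a < n" "ints s ''a'' [] = int a" for s a
  proof (rule run_all[where I = "\<lambda>s'. found_best s' \<and> ints s' ''a'' [] = int a \<and>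
       (\<forall>R. beats s R \<longrightarrow> beats s' R)"])
    show "well_formed (Loop ''b'' ?coords)" using wf by simp
    show "ints s ''n'' [] = int n" using n s by blast
    show "found_best s \<and> ints s ''a'' [] = int a \<and> (\<forall>R. beats s R \<longrightarrow> beats s R)" using s a by simp
    fix b s' assume b: "b < n" "ints s' ''b'' [] = int b"
      and I: "found_best s' \<and> ints s' ''a'' [] = int a \<and> (\<forall>R. beats s R \<longrightarrow> beats s' R)"
      and old: "\<forall>b'<b. \<forall>c<d. beats s' (X a c - X b' c)"
    have "ints (run ?coords s') ''a'' = ints s' ''a''" using w by (simp add: ints_run)
    then show "(found_best (run ?coords s') \<and> ints (run ?coords s') ''a'' [] = int a \<and>
         (\<forall>R. beats s R \<longrightarrow> beats (run ?coords s') R)) \<and>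
       (\<forall>b'\<le>b. \<forall>c<d. beats (run ?coords s') (X a c - X b' c))"
      using step[of s' a b] I a b old by (metis order_le_less)
  qed (simp_all add: fb)
  have "found_best s1 \<and> (\<forall>a<n. \<forall>b<n. \<forall>c<d. beats s1 (X a c - X b c))"
    unfolding s1_def cluster_prg_def
  proof (rule run_all[where I = found_best])
    show "well_formed (Loop ''a'' (Loop ''b'' ?coords))" by (rule wf)
    show "ints s0 ''n'' [] = int n" using n s0 by blast
    show "found_best s0" by fact
    fix a s assume a: "a < n" "found_best s" "ints s ''a'' [] = int a"
      and old: "\<forall>a'<a. \<forall>b<n. \<forall>c<d. beats s (X a' c - X b c)"
    show "found_best (run (Loop ''b'' ?coords) s) \<and>
      (\<forall>a'\<le>a. \<forall>b<n. \<forall>c<d. beats (run (Loop ''b'' ?coords) s) (X a' c - X b c))"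
      using inner[OF a(2,1,3)] old by (metis order_le_less)
  qed (simp_all add: fb)
  then show ?thesis .
qed

end

section \<open>Inputs, outputs and costs\<close>

lemma coordinate_le_Lp_dist:
  assumes "p \<ge> 1" "i < d"
  shows "\<bar>x ! i - y ! i\<bar> \<le> Lp_dist d p x y"
proof (cases p)
  case (enat q)
  then have q: "q > 0" using assms by (auto simp: one_enat_def)
  have "\<bar>x ! i - y ! i\<bar> ^ q \<le> (\<Sum>i<d. \<bar>x ! i - y ! i\<bar> ^ q)"
    using assms by (intro member_le_sum) auto
  then have "root q (\<bar>x ! i - y ! i\<bar> ^ q) \<le> root q (\<Sum>i<d. \<bar>x ! i - y ! i\<bar> ^ q)"
    using q by simp
  then show ?thesis using q enat by (simp add: Lp_dist_def real_root_power_cancel)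
next
  case infinity
  then show ?thesis using assms by (auto simp: Lp_dist_def)
qed

lemma Lp_dist_le:
  assumes "p \<ge> 1" "d \<ge> 1" and M: "\<And>i. i < d \<Longrightarrow> \<bar>x ! i - y ! i\<bar> \<le> M"
  shows "Lp_dist d p x y \<le> real d powr inverse_exponent p * M"
proof (cases p)
  case (enat q)
  then have q: "q > 0" using assms by (auto simp: one_enat_def)
  have "M \<ge> 0" using M[of 0] assms(2) by force
  have "(\<Sum>i<d. \<bar>x ! i - y ! i\<bar> ^ q) \<le> (\<Sum>i<d. M ^ q)"
    using M by (intro sum_mono power_mono) auto
  then have "root q (\<Sum>i<d. \<bar>x ! i - y ! i\<bar> ^ q) \<le> root q (real d * M ^ q)"
    using q by simp
  also have "\<dots> = root q (real d) * M"
    using q \<open>M \<ge> 0\<close> by (simp add: real_root_mult real_root_power_cancel)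
  also have "root q (real d) = real d powr (1 / real q)"
    using q assms(2) by (simp add: root_powr_inverse)
  finally show ?thesis using enat by (simp add: Lp_dist_def inverse_exponent_def)
next
  case infinity
  have "0 \<in> {..<d}" using assms(2) by simp
  then have "{..<d} \<noteq> {}" by blast
  then have "Max ((\<lambda>i. \<bar>x ! i - y ! i\<bar>) ` {..<d}) \<le> M"
    using M by (intro Max.boundedI) auto
  then show ?thesis using infinity assms(2) by (simp add: Lp_dist_def inverse_exponent_def)
qed

text \<open>Reduces the comparison with the optimum to one with each feasible solution; the set of
  costs is nonempty by feasibility.\<close>

lemma le_mult_Inf:
  fixes y \<alpha> :: real
  assumes "S \<noteq> {}" "\<alpha> > 0" "\<And>x. x \<in> S \<Longrightarrow> y \<le> \<alpha> * x"
  shows "y \<le> \<alpha> * Inf S"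
proof -
  have "y / \<alpha> \<le> Inf S"
    using assms by (intro cInf_greatest) (auto simp: field_simps)
  then show ?thesis using assms(2) by (simp add: field_simps)
qed

lemma poly_nat_mono:
  fixes q :: "nat poly"
  assumes "a \<le> b" shows "poly q a \<le> poly q b"
  by (induction q) (auto intro: add_mono mult_mono assms)

section \<open>Translation between points and their positions\<close>

definition index_adj :: "clustering_input \<Rightarrow> nat \<Rightarrow> nat \<Rightarrow> bool" where
  "index_adj I u v \<longleftrightarrow> u < length (points I) \<and> v < length (points I) \<and>
     {points I ! u, points I ! v} \<in> edges I"

abbreviation coords :: "clustering_input \<Rightarrow> nat \<Rightarrow> nat \<Rightarrow> real" where
  "coords I v i \<equiv> points I ! v ! i"

interpretation instance_graph: points_graph "length (points I)" d "index_adj I" "coords I" for I d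
  by unfold_locales (auto simp: index_adj_def insert_commute)

lemma input_initial_state:
  assumes "valid_input d I"
  shows "instance_graph.input I d (initial_state I)"
  using assms by (auto simp: instance_graph.input_def initial_state_def Let_def index_adj_def valid_input_def)

lemma feasible_count:
  assumes "feasible_clustering V E k C" "finite V"
  shows "k \<le> card V"
proof -
  define z where "z j = (SOME x. x \<in> C j)" for j
  have z: "z j \<in> C j" if "j < k" for j
    using assms(1) that unfolding feasible_clustering_def induces_connected_def z_def
    by (simp add: some_in_eq)
  have "inj_on z {..<k}"
    using assms(1) z unfolding feasible_clustering_def disjoint_family_on_def inj_on_def
    by (metis IntI empty_iff lessThan_iff)
  moreover have "z ` {..<k} \<subseteq> V" using z assms(1) unfolding feasible_clustering_def by blast
  ultimately show ?thesis using card_inj_on_le[of z "{..<k}" V] assms(2) by simp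
qed

text \<open>A path inside a cluster stays within \<open>R\<close> of its start in every coordinate,
  because the whole cluster does. Hence connectedness of the cluster yields \<open>reach\<close>
  between any two members.\<close>

lemma coverable_feasible:
  assumes I: "valid_input d I" and C: "feasible_clustering (set (points I)) (edges I) k C"
    and R: "\<And>j u v i. j < k \<Longrightarrow> u < length (points I) \<Longrightarrow> v < length (points I) \<Longrightarrow>
      points I ! u \<in> C j \<Longrightarrow> points I ! v \<in> C j \<Longrightarrow> i < d \<Longrightarrow> coords I u i - coords I v i \<le> R"
  shows "instance_graph.coverable I d k R"
proof -
  let ?n = "length (points I)"
  have "\<exists>j<k. points I ! v \<in> C j" if "v < ?n" for v
    using C nth_mem[OF that] unfolding feasible_clustering_def by blast
  then obtain f where f: "\<And>v. v < ?n \<Longrightarrow> f v < k \<and> points I ! v \<in> C (f v)" by metis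
  have "instance_graph.reach I d R u v" if uv: "u < ?n" "v < ?n" "f u = f v" for u v
  proof -
    let ?j = "f u"
    have j: "?j < k" using f uv by simp
    have "induces_connected (edges I) (C ?j)" using C j unfolding feasible_clustering_def by blast
    moreover have pu: "points I ! u \<in> C ?j" and "points I ! v \<in> C ?j" using f[of u] f[of v] uv by simp_all
    ultimately have "(points I ! u, points I ! v) \<in>
        {(x, y). x \<in> C ?j \<and> y \<in> C ?j \<and> {x, y} \<in> edges I}\<^sup>*"
      unfolding induces_connected_def by blast
    then have "\<exists>w<?n. points I ! w = points I ! v \<and> instance_graph.reach I d R u w"
    proof (induction rule: rtrancl_induct)
      case base
      then show ?case using uv instance_graph.reach.refl by blast
    next
      case (step y z)
      then obtain w where w: "w < ?n" "points I ! w = y" "instance_graph.reach I d R u w" by blast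
      have z: "y \<in> C ?j" "z \<in> C ?j" "{y, z} \<in> edges I" using step by auto
      then have "z \<in> set (points I)" using C j unfolding feasible_clustering_def by blast
      then obtain x where x: "x < ?n" "points I ! x = z" by (auto simp: in_set_conv_nth)
      have "coords I u i - coords I x i \<le> R" "coords I x i - coords I u i \<le> R" if "i < d" for i
        using R[OF j uv(1) x(1) pu _ that] R[OF j x(1) uv(1) _ pu that] x z by simp_all
      then have "instance_graph.near d I R u x" by (auto simp: instance_graph.near_def abs_le_iff)
      then have "instance_graph.reach I d R u x"
        using instance_graph.reach.step[OF w(3)] w x z by (auto simp: index_adj_def)
      then show ?case using x by blast
    qed
    \<comment> \<open>The path ends at a position carrying the same point as \<open>v\<close>; as
      the input list is distinct, this position is \<open>v\<close>.\<close>
    then show ?thesis using I uv by (metis nth_eq_iff_index_eq valid_input_def)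
  qed
  then show ?thesis unfolding instance_graph.coverable_def using f by blast
qed

lemma feasible_output:
  assumes I: "valid_input d I" and out: "instance_graph.outcome I d (num_clusters I) D s"
  shows "feasible_centers (set (points I)) (edges I) (num_clusters I) (output_clusters I s) (output_centers I s)"
    and "\<And>j x y i. j < num_clusters I \<Longrightarrow> x \<in> output_clusters I s j \<Longrightarrow> y \<in> output_clusters I s j \<Longrightarrow>
      i < d \<Longrightarrow> \<bar>x ! i - y ! i\<bar> \<le> D"
proof -
  let ?n = "length (points I)" and ?k = "num_clusters I" and ?C = "output_clusters I s"
  obtain l vs where g: "grown ?n (index_adj I) l (int ?k) vs"
    and l: "\<forall>v<?n. l v > 0 \<and> ints s ''cluster'' [int v] = l v - 1"
    and D: "\<forall>u<?n. \<forall>v<?n. l u = l v \<longrightarrow> instance_graph.near d I D u v"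
    and z: "\<forall>j<?k. \<exists>w<?n. l w = int j + 1 \<and> ints s ''center'' [int j] = int w"
    using out unfolding instance_graph.outcome_def by blast
  have C: "?C j = {points I ! v | v. v < ?n \<and> l v = int j + 1}" for j
    unfolding output_clusters_def using l by force
  have "(\<Union>j<?k. ?C j) = set (points I)"
  proof (intro equalityI subsetI)
    fix x assume "x \<in> set (points I)"
    then obtain v where v: "v < ?n" "x = points I ! v" by (auto simp: in_set_conv_nth)
    moreover have "l v \<le> int ?k" using grown_labels[OF g] by blast
    ultimately have "l v = int (nat (l v - 1)) + 1" "nat (l v - 1) < ?k" using l by auto
    then show "x \<in> (\<Union>j<?k. ?C j)" using v unfolding C by blast
  qed (auto simp: C)
  moreover have "disjoint_family_on ?C {..<?k}"
    using I unfolding disjoint_family_on_def C valid_input_def by (auto simp: nth_eq_iff_index_eq)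
  moreover have "induces_connected (edges I) (?C j)" if "j < ?k" for j
    unfolding induces_connected_def
  proof (intro conjI ballI)
    show "?C j \<noteq> {}" using z that unfolding C by blast
    fix x y assume "x \<in> ?C j" "y \<in> ?C j"
    then obtain u v where uv: "x = points I ! u" "y = points I ! v" "u < ?n" "l u = int j + 1"
      "l v = int j + 1" unfolding C by blast
    have "(u, v) \<in> {(u, v). l u = int j + 1 \<and> l v = int j + 1 \<and> index_adj I u v}\<^sup>*"
      by (rule grown_connected[OF instance_graph.adj_sym g uv(4,5)]) auto
    then have "(points I ! u, points I ! v) \<in> {(x, y). x \<in> ?C j \<and> y \<in> ?C j \<and> {x, y} \<in> edges I}\<^sup>*"
    proof (induction rule: rtrancl_induct)
      case (step a b)
      then have "(points I ! a, points I ! b) \<in> {(x, y). x \<in> ?C j \<and> y \<in> ?C j \<and> {x, y} \<in> edges I}"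
        unfolding C by (auto simp: index_adj_def)
      then show ?case using step.IH by (rule rtrancl_into_rtrancl[rotated])
    qed simp
    then show "(x, y) \<in> {(x, y). x \<in> ?C j \<and> y \<in> ?C j \<and> {x, y} \<in> edges I}\<^sup>*" using uv by simp
  qed
  moreover have "output_centers I s j \<in> ?C j" if "j < ?k" for j
    using z that unfolding C output_centers_def by fastforce
  ultimately show "feasible_centers (set (points I)) (edges I) ?k ?C (output_centers I s)"
    by (simp add: feasible_centers_def feasible_clustering_def)
  show "\<bar>x ! i - y ! i\<bar> \<le> D" if "j < ?k" "x \<in> ?C j" "y \<in> ?C j" "i < d" for j x y i
    using that D unfolding C instance_graph.near_def by force
qed

lemma finite_costs:
  assumes "feasible_clustering V E k C" "finite V"
  shows "finite {\<delta> x y | x y j. j < k \<and> x \<in> C j \<and> y \<in> C j}"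
    and "(\<forall>j<k. z j \<in> C j) \<Longrightarrow> finite {\<delta> x (z j) | x j. j < k \<and> x \<in> C j}"
proof -
  have *: "x \<in> V" if "j < k" "x \<in> C j" for x j
    using assms(1) that unfolding feasible_clustering_def by blast
  have fin: "finite ((\<lambda>(x, y). \<delta> x y) ` (V \<times> V))" using assms(2) by simp
  show "finite {\<delta> x y | x y j. j < k \<and> x \<in> C j \<and> y \<in> C j}"
    by (rule finite_subset[OF _ fin]) (use * in force)
  show "finite {\<delta> x (z j) | x j. j < k \<and> x \<in> C j}" if "\<forall>j<k. z j \<in> C j"
    by (rule finite_subset[OF _ fin]) (use * that in force)
qed

text \<open>Bounds the \<open>L_\<infinity>\<close>-diameters: both orders of each pair are covered,
  so signed differences, the form of the candidate radii, are enough.\<close>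

definition box_width_le :: "nat \<Rightarrow> nat \<Rightarrow> (nat \<Rightarrow> real list set) \<Rightarrow> real \<Rightarrow> bool" where
  "box_width_le d k C R \<longleftrightarrow> (\<forall>j<k. \<forall>x\<in>C j. \<forall>y\<in>C j. \<forall>i<d. x ! i - y ! i \<le> R)"

text \<open>The bound \<open>R\<close> itself need not be a candidate radius. The largest coordinate
  difference within a cluster of \<open>C\<close> is one, is at most \<open>R\<close>, and is
  coverable by \<open>C\<close>.\<close>

lemma cluster_prg_spread:
  assumes I: "valid_input d I" and d: "d \<ge> 1"
    and C: "feasible_clustering (set (points I)) (edges I) (num_clusters I) C"
    and R: "box_width_le d (num_clusters I) C R"
  defines "s \<equiv> run (cluster_prg d) (initial_state I)"
  shows "feasible_centers (set (points I)) (edges I) (num_clusters I) (output_clusters I s) (output_centers I s)"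
    and "\<And>j x y i. j < num_clusters I \<Longrightarrow> x \<in> output_clusters I s j \<Longrightarrow> y \<in> output_clusters I s j \<Longrightarrow>
      i < d \<Longrightarrow> \<bar>x ! i - y ! i\<bar> \<le> 4 * (real d + 1) * (real d + 2) * R"
proof -
  let ?n = "length (points I)" and ?k = "num_clusters I"
  have "?k \<le> ?n"
    using feasible_count[OF C] card_length[of "points I"] by simp
  then interpret clustering_problem ?n d "index_adj I" "coords I" ?k by unfold_locales
  have k: "?k \<ge> 1" using I by (simp add: valid_input_def)
  have "found_best (initial_state I)"
    using input_initial_state[OF I] by (simp add: found_best_def initial_state_def Let_def)
  note run = run_cluster_prg[OF this, folded s_def]
  let ?S = "{coords I u i - coords I v i | j u v i. j < ?k \<and> u < ?n \<and> v < ?n \<and> points I ! u \<in> C j \<and>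
     points I ! v \<in> C j \<and> i < d}"
  have "x \<in> (\<lambda>(u, v, i). coords I u i - coords I v i) ` ({..<?n} \<times> {..<?n} \<times> {..<d})"
    if "x \<in> ?S" for x
  proof -
    obtain u v i where "x = coords I u i - coords I v i" "u < ?n" "v < ?n" "i < d" using \<open>x \<in> ?S\<close> by blast
    then show ?thesis by (intro image_eqI[of _ _ "(u, v, i)"]) auto
  qed
  then have "?S \<subseteq> (\<lambda>(u, v, i). coords I u i - coords I v i) ` ({..<?n} \<times> {..<?n} \<times> {..<d})"
    by blast
  then have fin: "finite ?S" by (rule finite_subset) simp
  have "C 0 \<noteq> {}" "C 0 \<subseteq> set (points I)"
    using C k unfolding feasible_clustering_def induces_connected_def by force+
  then obtain u0 where "u0 < ?n" "points I ! u0 \<in> C 0" by (metis all_not_in_conv in_set_conv_nth subsetD)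
  moreover have "0 < ?k" "0 < d" using k d by simp_all
  ultimately have "coords I u0 0 - coords I u0 0 \<in> ?S" by blast
  then have zero: "0 \<in> ?S" by (simp only: diff_self)
  define r where "r = Max ?S"
  have "r \<in> ?S" unfolding r_def by (rule Max_in[OF fin]) (use zero in blast)
  then obtain j a b c where abc: "j < ?k" "a < ?n" "b < ?n" "c < d" "points I ! a \<in> C j" "points I ! b \<in> C j"
    "r = coords I a c - coords I b c" by blast
  have "r \<le> R" using R abc unfolding box_width_le_def by simp
  have "r \<ge> 0" unfolding r_def using fin zero by (rule Max_ge)
  have "instance_graph.coverable I d ?k r"
  proof (rule coverable_feasible[OF I C])
    fix j u v i assume "j < ?k" "u < ?n" "v < ?n" "points I ! u \<in> C j" "points I ! v \<in> C j" "i < d"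
    then have "coords I u i - coords I v i \<in> ?S" by blast
    then show "coords I u i - coords I v i \<le> r" unfolding r_def by (rule Max_ge[OF fin])
  qed
  moreover have "beats s r" using run abc by simp
  ultimately have b: "ints s ''found'' [] > 0" "rval best_radius s \<le> r"
    using \<open>r \<ge> 0\<close> by (simp_all add: beats_def)
  then have out: "instance_graph.outcome I d ?k (stretch * rval best_radius s) s" using run by (simp add: found_best_def)
  show "feasible_centers (set (points I)) (edges I) ?k (output_clusters I s) (output_centers I s)"
    by (rule feasible_output(1)[OF I out])
  fix j x y i assume "j < ?k" "x \<in> output_clusters I s j" "y \<in> output_clusters I s j" "i < d"
  then have "\<bar>x ! i - y ! i\<bar> \<le> stretch * rval best_radius s" by (rule feasible_output(2)[OF I out])
  also have "\<dots> \<le> stretch * R" using b \<open>r \<le> R\<close> by (intro mult_left_mono) (auto simp: stretch_def)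
  finally show "\<bar>x ! i - y ! i\<bar> \<le> 4 * (real d + 1) * (real d + 2) * R" by (simp add: stretch_def)
qed

section \<open>Running time and approximation factors\<close>

lemma exec_cluster_prg:
  "\<exists>t\<le>poly (time_poly (cluster_prg d)) (length (points I)).
    exec (compile (cluster_prg d)) (initial_state I) t 0 (run (cluster_prg d) (initial_state I))"
proof -
  have "ints (initial_state I) ''n'' [] = int (length (points I))"
    by (simp add: initial_state_def Let_def)
  then show ?thesis using exec_compile[OF well_formed_cluster_prg, of d "initial_state I"] by simp
qed

lemma polynomial_time_cluster_prg: "polynomial_time d (compile (cluster_prg d))"
  unfolding polynomial_time_def
proof (intro exI[of _ "time_poly (cluster_prg d)"] allI impI)
  fix I assume I: "valid_input d I"
  have "length (points I) \<le> input_count d I"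
    using self_le_power[of "length (points I)" 2] by (cases "points I") (auto simp: input_count_def)
  from poly_nat_mono[OF this]
  show "\<exists>t m s. exec (compile (cluster_prg d)) (initial_state I) t m s \<and>
      t \<le> poly (time_poly (cluster_prg d)) (input_count d I) \<and>
      ((\<forall>x\<in>set (points I). set x \<subseteq> \<rat>) \<longrightarrow> m \<le> poly (time_poly (cluster_prg d)) (input_bits I))"
    using exec_cluster_prg[of d I] by (meson le0 order_trans)
qed

lemma exec_cluster_prg_state:
  assumes "exec (compile (cluster_prg d)) (initial_state I) t m s"
  shows "s = run (cluster_prg d) (initial_state I)"
  using exec_cluster_prg[of d I] exec_deterministic assms by blast

text \<open>For \<open>d \<ge> 1\<close> one has \<open>d + 1 \<le> 2d\<close> and
  \<open>d + 2 \<le> 3d\<close>, and 4 times 2 times 3 is 24.\<close>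

lemma stretch_bound:
  assumes "d \<ge> 1" and "R \<ge> 0"
  shows "real d powr e * (4 * (real d + 1) * (real d + 2) * R) \<le> 24 * real d powr (2 + e) * R"
proof -
  have "(real d + 1) * (real d + 2) \<le> (2 * real d) * (3 * real d)"
    using assms(1) by (intro mult_mono) auto
  then have "4 * (real d + 1) * (real d + 2) \<le> 24 * (real d)\<^sup>2"
    by (simp add: power2_eq_square algebra_simps)
  then have "4 * (real d + 1) * (real d + 2) * R \<le> 24 * (real d)\<^sup>2 * R"
    using assms(2) by (rule mult_right_mono)
  then have "real d powr e * (4 * (real d + 1) * (real d + 2) * R) \<le> real d powr e * (24 * (real d)\<^sup>2 * R)"
    by (intro mult_left_mono) auto
  also have "\<dots> = 24 * real d powr (2 + e) * R"
    using assms(1) by (simp add: powr_add)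
  finally show ?thesis .
qed

lemma cluster_prg_diameter:
  assumes p: "p \<ge> 1" and I: "valid_input d I" and d: "d \<ge> 1"
    and C: "feasible_clustering (set (points I)) (edges I) (num_clusters I) C"
    and R: "box_width_le d (num_clusters I) C R"
  defines "s \<equiv> run (cluster_prg d) (initial_state I)"
  shows "feasible_centers (set (points I)) (edges I) (num_clusters I) (output_clusters I s) (output_centers I s)"
    and "\<And>j x y. j < num_clusters I \<Longrightarrow> x \<in> output_clusters I s j \<Longrightarrow> y \<in> output_clusters I s j \<Longrightarrow>
      Lp_dist d p x y \<le> 24 * real d powr (2 + inverse_exponent p) * R"
proof -
  show "feasible_centers (set (points I)) (edges I) (num_clusters I) (output_clusters I s) (output_centers I s)"
    unfolding s_def by (rule cluster_prg_spread(1)[OF I d C R])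
  have "C 0 \<noteq> {}"
    using C I unfolding feasible_clustering_def induces_connected_def valid_input_def
    by (metis less_eq_Suc_le One_nat_def)
  then have "R \<ge> 0" using R I d unfolding valid_input_def box_width_le_def
    by (metis all_not_in_conv diff_self less_eq_Suc_le One_nat_def)
  fix j x y
  assume "j < num_clusters I" "x \<in> output_clusters I s j" "y \<in> output_clusters I s j"
  then have "\<bar>x ! i - y ! i\<bar> \<le> 4 * (real d + 1) * (real d + 2) * R" if "i < d" for i
    using that unfolding s_def by (rule cluster_prg_spread(2)[OF I d C R])
  then have "Lp_dist d p x y \<le> real d powr inverse_exponent p * (4 * (real d + 1) * (real d + 2) * R)"
    by (rule Lp_dist_le[OF p d])
  also have "\<dots> \<le> 24 * real d powr (2 + inverse_exponent p) * R"
    by (rule stretch_bound[OF d \<open>R \<ge> 0\<close>])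
  finally show "Lp_dist d p x y \<le> 24 * real d powr (2 + inverse_exponent p) * R" .
qed

text \<open>Coordinatewise, two points of a cluster are within twice the center cost of each other,
  which doubles 24. In the output, the distance to a center is bounded by the cluster
  diameter.\<close>

lemma approximates_k_center_cluster_prg:
  assumes p: "p \<ge> 1" and d: "d \<ge> 1"
  shows "approximates_k_center d p (48 * real d powr (2 + inverse_exponent p)) (compile (cluster_prg d))"
  unfolding approximates_k_center_def Let_def
proof (intro allI impI, elim conjE exE, intro conjI)
  fix I :: clustering_input and t m :: nat and s :: state and C z
  let ?V = "set (points I)" and ?E = "edges I" and ?k = "num_clusters I" and ?\<delta> = "Lp_dist d p"
  let ?C = "output_clusters I s" and ?z = "output_centers I s"
  assume I: "valid_input d I" and feas: "feasible_centers ?V ?E ?k C z"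
    and ex: "exec (compile (cluster_prg d)) (initial_state I) t m s"
  note s = exec_cluster_prg_state[OF ex]
  have R: "box_width_le d ?k C (2 * center_cost ?\<delta> ?k C z)"
    if f: "feasible_centers ?V ?E ?k C z" for C z
    unfolding box_width_le_def
  proof (intro allI impI ballI)
    fix j x y i assume h: "j < ?k" "x \<in> C j" "y \<in> C j" "i < d"
    have fin: "finite {?\<delta> x (z j) | x j. j < ?k \<and> x \<in> C j}"
      using f finite_costs(2)[of ?V ?E ?k C z] unfolding feasible_centers_def by simp
    have "\<bar>w ! i - z j ! i\<bar> \<le> center_cost ?\<delta> ?k C z" if "w \<in> C j" for w
    proof -
      have "\<bar>w ! i - z j ! i\<bar> \<le> ?\<delta> w (z j)" by (rule coordinate_le_Lp_dist[OF p h(4)])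
      also have "\<dots> \<le> center_cost ?\<delta> ?k C z"
        unfolding center_cost_def by (rule Max_ge[OF fin]) (use h that in blast)
      finally show ?thesis .
    qed
    from this[OF h(2)] this[OF h(3)] show "x ! i - y ! i \<le> 2 * center_cost ?\<delta> ?k C z" by linarith
  qed
  have feas_cl: "feasible_clustering ?V ?E ?k C" if "feasible_centers ?V ?E ?k C z" for C z
    using that by (simp add: feasible_centers_def)
  show out: "feasible_centers ?V ?E ?k ?C ?z"
    unfolding s by (rule cluster_prg_diameter(1)[OF p I d feas_cl[OF feas] R[OF feas]])
  have "center_cost ?\<delta> ?k ?C ?z \<le> 48 * real d powr (2 + inverse_exponent p) * center_cost ?\<delta> ?k C z"
    if f: "feasible_centers ?V ?E ?k C z" for C z
    unfolding center_cost_def[of _ _ ?C]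
  proof (rule Max.boundedI)
    show "finite {?\<delta> x (?z j) | x j. j < ?k \<and> x \<in> ?C j}"
      using out finite_costs(2)[of ?V ?E ?k ?C ?z] unfolding feasible_centers_def by simp
    have "0 < ?k" using I by (simp add: valid_input_def)
    moreover have "?z 0 \<in> ?C 0" using out \<open>0 < ?k\<close> by (simp add: feasible_centers_def)
    ultimately show "{?\<delta> x (?z j) | x j. j < ?k \<and> x \<in> ?C j} \<noteq> {}" by blast
    fix y assume "y \<in> {?\<delta> x (?z j) | x j. j < ?k \<and> x \<in> ?C j}"
    then obtain x j where xj: "y = ?\<delta> x (?z j)" "j < ?k" "x \<in> ?C j" by blast
    have "?z j \<in> ?C j" using out xj(2) by (simp add: feasible_centers_def)
    from cluster_prg_diameter(2)[OF p I d feas_cl[OF f] R[OF f], folded s, OF xj(2,3) this]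
    show "y \<le> 48 * real d powr (2 + inverse_exponent p) * center_cost ?\<delta> ?k C z"
      using xj(1) by simp
  qed
  then show "center_cost ?\<delta> ?k ?C ?z \<le>
      48 * real d powr (2 + inverse_exponent p) * center_opt ?\<delta> ?V ?E ?k"
    unfolding center_opt_def using feas d by (intro le_mult_Inf) auto
qed

lemma approximates_k_diameter_cluster_prg:
  assumes p: "p \<ge> 1" and d: "d \<ge> 1"
  shows "approximates_k_diameter d p (48 * real d powr (2 + inverse_exponent p)) (compile (cluster_prg d))"
  unfolding approximates_k_diameter_def Let_def
proof (intro allI impI, elim conjE exE, intro conjI)
  fix I :: clustering_input and t m :: nat and s :: state and C
  let ?V = "set (points I)" and ?E = "edges I" and ?k = "num_clusters I" and ?\<delta> = "Lp_dist d p"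
  let ?C = "output_clusters I s"
  assume I: "valid_input d I" and feas: "feasible_clustering ?V ?E ?k C"
    and ex: "exec (compile (cluster_prg d)) (initial_state I) t m s"
  note s = exec_cluster_prg_state[OF ex]
  have k: "0 < ?k" using I by (simp add: valid_input_def)
  have R: "box_width_le d ?k C (diameter_cost ?\<delta> ?k C)"
    if f: "feasible_clustering ?V ?E ?k C" for C
    unfolding box_width_le_def
  proof (intro allI impI ballI)
    fix j x y i assume h: "j < ?k" "x \<in> C j" "y \<in> C j" "i < d"
    have "x ! i - y ! i \<le> ?\<delta> x y" using coordinate_le_Lp_dist[OF p h(4), of x y] by linarith
    also have "\<dots> \<le> diameter_cost ?\<delta> ?k C"
      unfolding diameter_cost_def by (rule Max_ge[OF finite_costs(1)[OF f]]) (use h in auto)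
    finally show "x ! i - y ! i \<le> diameter_cost ?\<delta> ?k C" .
  qed
  show out: "feasible_clustering ?V ?E ?k ?C"
    using cluster_prg_diameter(1)[OF p I d feas R[OF feas], folded s] by (simp add: feasible_centers_def)
  have "diameter_cost ?\<delta> ?k ?C \<le> 48 * real d powr (2 + inverse_exponent p) * diameter_cost ?\<delta> ?k C"
    if f: "feasible_clustering ?V ?E ?k C" for C
  proof -
    have "C 0 \<noteq> {}" "?C 0 \<noteq> {}"
      using f out k unfolding feasible_clustering_def induces_connected_def by blast+
    then have R0: "0 \<le> diameter_cost ?\<delta> ?k C" 
      using R[OF f] k d unfolding box_width_le_def
      by (metis all_not_in_conv diff_self less_eq_Suc_le One_nat_def)
    show ?thesis unfolding diameter_cost_def[of _ _ ?C]
    proof (rule Max.boundedI)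
      show "finite {?\<delta> x y | x y j. j < ?k \<and> x \<in> ?C j \<and> y \<in> ?C j}"
        by (rule finite_costs(1)[OF out]) simp
      show "{?\<delta> x y | x y j. j < ?k \<and> x \<in> ?C j \<and> y \<in> ?C j} \<noteq> {}" using k \<open>?C 0 \<noteq> {}\<close> by blast
      fix a assume "a \<in> {?\<delta> x y | x y j. j < ?k \<and> x \<in> ?C j \<and> y \<in> ?C j}"
      then obtain x y j where xy: "a = ?\<delta> x y" "j < ?k" "x \<in> ?C j" "y \<in> ?C j" by blast
      have "a \<le> 24 * real d powr (2 + inverse_exponent p) * diameter_cost ?\<delta> ?k C"
        using cluster_prg_diameter(2)[OF p I d f R[OF f], folded s, OF xy(2-4)] xy(1) by simp
      \<comment> \<open>Weakened from 24 so that both objectives share one constant.\<close>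
      also have "\<dots> \<le> 48 * real d powr (2 + inverse_exponent p) * diameter_cost ?\<delta> ?k C"
        using R0 by (intro mult_right_mono) auto
      finally show "a \<le> 48 * real d powr (2 + inverse_exponent p) * diameter_cost ?\<delta> ?k C" .
    qed
  qed
  then show "diameter_cost ?\<delta> ?k ?C \<le>
      48 * real d powr (2 + inverse_exponent p) * diameter_opt ?\<delta> ?V ?E ?k"
    unfolding diameter_opt_def using feas d by (intro le_mult_Inf) auto
qed

text \<open>The constant is uniform in \<open>p\<close> and \<open>d\<close>, while the program and
  its time polynomial depend on \<open>d\<close>, whose coordinates and layers are expanded in the
  code.\<close>

theorem theorem20:
  "\<exists>c::real. c > 0 \<and>
     (\<forall>(p::enat) (d::nat). p \<ge> 1 \<and> d \<ge> 1 \<longrightarrow>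
        (\<exists>A. polynomial_time d A \<and>
             approximates_k_center d p (c * real d powr (2 + inverse_exponent p)) A) \<and>
        (\<exists>A. polynomial_time d A \<and>
             approximates_k_diameter d p (c * real d powr (2 + inverse_exponent p)) A))"
proof (intro exI[of _ 48] conjI allI impI; (elim conjE)?)
  fix p :: enat and d :: nat
  assume "p \<ge> 1" "d \<ge> 1"
  then show "\<exists>A. polynomial_time d A \<and>
      approximates_k_center d p (48 * real d powr (2 + inverse_exponent p)) A"
    "\<exists>A. polynomial_time d A \<and>
      approximates_k_diameter d p (48 * real d powr (2 + inverse_exponent p)) A"
    using polynomial_time_cluster_prg approximates_k_center_cluster_prg
      approximates_k_diameter_cluster_prg by blast+
qed simp

end
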